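(* Suppose that $0$ is in the discrete spectrum of $H$, and set $K_V=-H^{-1/2}VH^{-1/2}$. Then the following hold. (1) We have $$N^+(K_V;1)\le N^-(H_V)\le N^+(K_V;1)+\dim\ker H.$$ (2) Assume further that $V\le0$ and $K_V\in\mathscr{L}_{p,\infty}$ for some $p\in(0,\infty)$. Then $$0\le N^-(H_V)-N^-(\Pi_0V\Pi_0)\le\|K_V\|_{\mathscr{L}_{p,\infty}}^p.$$ In particular, if $V(\ker H)\subset\operatorname{ran}H$, then $$N^-(H_V)\le\|K_V\|_{\mathscr{L}_{p,\infty}}^p.$$
   Context: $\mathscr{H}$ is a separable Hilbert space, and $H$ is a densely defined selfadjoint operator on $\mathscr{H}$ with non-negative spectrum containing $0$. Its quadratic form $Q_H$ has domain $\operatorname{dom}(H+1)^{1/2}$. $\mathscr{H}_+$ is this domain with Hilbert norm $\|\xi\|_+=(Q_H(\xi,\xi)+\|\xi\|^2)^{1/2}=\|(1+H)^{1/2}\xi\|$, and $\mathscr{H}_-$ is the space of continuous anti-linear functionals on $\mathscr{H}_+$, with duality pairing $\langle\cdot,\cdot\rangle:\mathscr{H}_-\times\mathscr{H}_+\to\mathbb{C}$; $\mathscr{H}$ embeds in $\mathscr{H}_-$ by $\xi\mapsto\langle\xi|\cdot\rangle$. $H$ extends to a bounded operator $H:\mathscr{H}_+\to\mathscr{H}_-$ by $\langle H\xi,\eta\rangle=Q_H(\xi,\eta)$. $V:\mathscr{H}_+\to\mathscr{H}_-$ is a bounded operator whose form $Q_V(\xi,\eta)=\langle V\xi,\eta\rangle$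 is symmetric and which is $H$-form compact, i.e. $V:\mathscr{H}_+\to\mathscr{H}_-$ is compact. $V\le0$ means $Q_V(\xi,\xi)\le0$ for all $\xi\in\mathscr{H}_+$. $H_V=H+V$ is the form sum: the bounded below selfadjoint operator on $\mathscr{H}$ with quadratic form $Q_H+Q_V$ on $\mathscr{H}_+$. The discrete spectrum consists of isolated eigenvalues of finite multiplicity. When $0$ is in the discrete spectrum, $H^{-1}$ is the partial inverse of $H$ (zero on $\ker H$, inverse of $H$ on $(\ker H)^\perp$) and $H^{-1/2}=(H^{-1})^{1/2}$; it is bounded $\mathscr{H}\to\mathscr{H}_+$ and extends by duality to a bounded operator $\mathscr{H}_-\to\mathscr{H}$, so $K_V$ is a bounded selfadjoint operator on $\mathscr{H}$. $\Pi_0$ is the orthogonal projection onto $\ker H$; it is bounded $\mathscr{H}\to\mathscr{H}_+$ and extends by duality to a bounded operator $\mathscr{H}_-\to\mathscr{H}$ (with $\langle\Pi_0\xi|\eta\rangle=\langle\xi,\Pi_0\eta\rangle$), so $\Pi_0V\Pi_0$ is a selfadjoint finite-rank operator on $\mathscr{H}$. For a selfadjoint operator $A$ bounded from below (or bounded) and $\lambda\in\mathbb{R}$: $N^+(A;\lambda)=\dim\operatorname{ran}\mathbf{1}_{(\lambda,\infty)}(A)$, $N^-(A;\lambda)=\dim\operatorname{ran}\mathbf{1}_{(-\infty,\lambda)}(A)$, and $N^-(A)=N^-(A;0)$. $\mathscr{L}_{p,\infty}$ is the weak Schatten class of compact operators $T$ on $\mathscr{H}$ with $\|T\|_{\mathscr{L}_{p,\infty}}=\sup_{j\ge0}(j+1)^{1/p}\mu_j(T)<\infty$,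 $\mu_j(T)$ being the $(j+1)$-th singular value. *)

theory Defs
  imports "HOL-Analysis.Analysis"
begin

section \<open>Complex Hilbert spaces\<close>

text \<open>The inner product is linear in the first and antilinear in the second variable, so that
  the functional \<open>\<eta> \<mapsto> cinner \<xi> \<eta>\<close> is antilinear. Norm and
  topology are those of the underlying real inner product \<open>Re (cinner x y)\<close>.\<close>

class complex_hilbert = real_inner + complete_space +
  fixes scaleC :: "complex \<Rightarrow> 'a \<Rightarrow> 'a"  (infixr \<open>*\<^sub>C\<close> 75)
    and cinner :: "'a \<Rightarrow> 'a \<Rightarrow> complex"
  assumes scaleC_add_right: "a *\<^sub>C (x + y) = a *\<^sub>C x + a *\<^sub>C y"
    and scaleC_add_left: "(a + b) *\<^sub>C x = a *\<^sub>C x + b *\<^sub>C x"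
    and scaleC_scaleC: "a *\<^sub>C (b *\<^sub>C x) = (a * b) *\<^sub>C x"
    and scaleC_of_real: "complex_of_real r *\<^sub>C x = r *\<^sub>R x"
    and cinner_commute: "cinner x y = cnj (cinner y x)"
    and cinner_add_left: "cinner (x + y) z = cinner x z + cinner y z"
    and cinner_scaleC_left: "cinner (a *\<^sub>C x) y = a * cinner x y"
    and inner_eq_Re_cinner: "inner x y = Re (cinner x y)"

global_interpretation complex_vector: vector_space "scaleC :: complex \<Rightarrow> 'a \<Rightarrow> 'a::complex_hilbert"
proof
  fix x :: 'a
  show "1 *\<^sub>C x = x"
    using scaleC_of_real[of 1 x] by simp
qed (simp_all add: scaleC_add_right scaleC_add_left scaleC_scaleC)

instantiation complex :: complex_hilbert
begin
definition scaleC_complex :: "complex \<Rightarrow> complex \<Rightarrow> complex" where "scaleC_complex a x = a * x"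
definition cinner_complex :: "complex \<Rightarrow> complex \<Rightarrow> complex" where "cinner_complex x y = x * cnj y"
instance
  by standard (auto simp: scaleC_complex_def cinner_complex_def algebra_simps scaleR_conv_of_real
      inner_complex_def)
end

definition cdimension :: "'a::complex_hilbert set \<Rightarrow> enat" where
  "cdimension S = (if \<exists>B. finite B \<and> S \<subseteq> complex_vector.span B
                   then enat (complex_vector.dim S) else \<infinity>)"

definition orthocomplement :: "'a::complex_hilbert set \<Rightarrow> 'a set" where
  "orthocomplement S = {x. \<forall>y\<in>S. cinner x y = 0}"

definition projection_onto :: "'a::complex_hilbert set \<Rightarrow> 'a \<Rightarrow> 'a" where
  "projection_onto S x = (THE y. y \<in> S \<and> x - y \<in> orthocomplement S)"

definition clinear_map :: "('a::complex_hilbert \<Rightarrow> 'a) \<Rightarrow> bool" where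
  "clinear_map T \<longleftrightarrow>
     (\<forall>x y. T (x + y) = T x + T y) \<and> (\<forall>a x. T (a *\<^sub>C x) = a *\<^sub>C T x)"

definition orthogonal_projection :: "('a::complex_hilbert \<Rightarrow> 'a) \<Rightarrow> bool" where
  "orthogonal_projection P \<longleftrightarrow>
     clinear_map P \<and> (\<forall>x. P (P x) = P x) \<and> (\<forall>x y. cinner (P x) y = cinner x (P y))"

definition compact_operator :: "('a::complex_hilbert \<Rightarrow> 'a) \<Rightarrow> bool" where
  "compact_operator T \<longleftrightarrow> clinear_map T \<and> compact (closure (T ` cball 0 1))"


section \<open>Unbounded operators\<close>

text \<open>A (possibly unbounded) operator on the Hilbert space is represented by its graph. Domain and
  range are \<^const>\<open>Domain\<close> and \<^const>\<open>Range\<close>, and \<open>S O S\<close> is the square of \<open>S\<close>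
  on its natural domain.\<close>

type_synonym 'a operator = "('a \<times> 'a) set"

definition is_operator :: "'a::complex_hilbert operator \<Rightarrow> bool" where
  "is_operator A \<longleftrightarrow> single_valued A \<and> (0, 0) \<in> A \<and>
     (\<forall>x y x' y'. (x, y) \<in> A \<longrightarrow> (x', y') \<in> A \<longrightarrow> (x + x', y + y') \<in> A) \<and>
     (\<forall>a x y. (x, y) \<in> A \<longrightarrow> (a *\<^sub>C x, a *\<^sub>C y) \<in> A)"

definition op_apply :: "'a operator \<Rightarrow> 'a \<Rightarrow> 'a" where
  "op_apply A x = (THE y. (x, y) \<in> A)"

definition graph_of :: "('a \<Rightarrow> 'a) \<Rightarrow> 'a operator" where
  "graph_of T = {(x, T x) | x. True}"

definition add_scalar :: "'a::complex_hilbert operator \<Rightarrow> complex \<Rightarrow> 'a operator" where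
  "add_scalar A c = {(x, y + c *\<^sub>C x) | x y. (x, y) \<in> A}"

definition op_adjoint :: "'a::complex_hilbert operator \<Rightarrow> 'a operator" where
  "op_adjoint A = {(y, z). \<forall>(x, w)\<in>A. cinner w y = cinner x z}"

definition selfadjoint :: "'a::complex_hilbert operator \<Rightarrow> bool" where
  "selfadjoint A \<longleftrightarrow> is_operator A \<and> closure (Domain A) = UNIV \<and> op_adjoint A = A"

definition op_nonneg :: "'a::complex_hilbert operator \<Rightarrow> bool" where
  "op_nonneg A \<longleftrightarrow> (\<forall>(x, y)\<in>A. 0 \<le> Re (cinner y x))"

text \<open>The square root of a nonnegative selfadjoint operator is uniquely determined.\<close>

definition op_sqrt :: "'a::complex_hilbert operator \<Rightarrow> 'a operator" where
  "op_sqrt A = (SOME S. selfadjoint S \<and> op_nonneg S \<and> S O S = A)"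

definition eigenspace :: "'a::complex_hilbert operator \<Rightarrow> complex \<Rightarrow> 'a set" where
  "eigenspace A z = {x. (x, z *\<^sub>C x) \<in> A}"

definition op_kernel :: "'a::complex_hilbert operator \<Rightarrow> 'a set" where
  "op_kernel A = {x. (x, 0) \<in> A}"

definition resolvent_set :: "'a::complex_hilbert operator \<Rightarrow> complex set" where
  "resolvent_set A = {z. \<exists>R. bounded_linear R \<and> (add_scalar A (- z))\<inverse> = graph_of R}"

definition spectrum :: "'a::complex_hilbert operator \<Rightarrow> complex set" where
  "spectrum A = - resolvent_set A"

definition discrete_spectrum :: "'a::complex_hilbert operator \<Rightarrow> complex set" where
  "discrete_spectrum A = {z. z isolated_in spectrum A \<and>
     eigenspace A z \<noteq> {0} \<and> cdimension (eigenspace A z) \<noteq> \<infinity>}"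

text \<open>Zero on the kernel of \<open>A\<close>, inverse of \<open>A\<close> on its orthogonal complement.\<close>

definition partial_inverse :: "'a::complex_hilbert operator \<Rightarrow> 'a operator" where
  "partial_inverse A =
     {(z + y, x) | z x y. z \<in> op_kernel A \<and> (x, y) \<in> A \<and> x \<in> orthocomplement (op_kernel A)}"


section \<open>Spectral projections and counting functions\<close>

definition projection_valued_measure :: "(real set \<Rightarrow> 'a::complex_hilbert \<Rightarrow> 'a) \<Rightarrow> bool" where
  "projection_valued_measure E \<longleftrightarrow>
     (\<forall>B\<in>sets borel. orthogonal_projection (E B)) \<and> E UNIV = id \<and>
     (\<forall>B::nat \<Rightarrow> real set. range B \<subseteq> sets borel \<longrightarrow> disjoint_family B \<longrightarrow>
        (\<forall>x. (\<lambda>n. E (B n) x) sums E (\<Union>n. B n) x))"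

definition scalar_measure :: "(real set \<Rightarrow> 'a::complex_hilbert \<Rightarrow> 'a) \<Rightarrow> 'a \<Rightarrow> real measure" where
  "scalar_measure E x = measure_of UNIV (sets borel) (\<lambda>B. ennreal (Re (cinner (E B x) x)))"

text \<open>\<open>A = \<integral> t dE(t)\<close>. By polarization the operator is determined by the
  integrals against the measures \<open>\<langle>E(\<cdot>)x|x\<rangle>\<close>.\<close>

definition spectral_measure_of ::
    "'a::complex_hilbert operator \<Rightarrow> (real set \<Rightarrow> 'a \<Rightarrow> 'a) \<Rightarrow> bool" where
  "spectral_measure_of A E \<longleftrightarrow> projection_valued_measure E \<and>
     Domain A = {x. integrable (scalar_measure E x) (\<lambda>t. t\<^sup>2)} \<and>
     (\<forall>(x, y)\<in>A. cinner y x = complex_of_real (\<integral>t. t \<partial>scalar_measure E x))"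

text \<open>The indicator function of the Borel set \<open>B\<close> applied to the selfadjoint operator \<open>A\<close>. By the
  spectral theorem the spectral measure exists and is unique on Borel sets.\<close>

definition spectral_projection :: "'a::complex_hilbert operator \<Rightarrow> real set \<Rightarrow> 'a \<Rightarrow> 'a" where
  "spectral_projection A B = (SOME E. spectral_measure_of A E) B"

definition N_plus :: "'a::complex_hilbert operator \<Rightarrow> real \<Rightarrow> enat" where
  "N_plus A l = cdimension (range (spectral_projection A {l<..}))"

definition N_minus :: "'a::complex_hilbert operator \<Rightarrow> real \<Rightarrow> enat" where
  "N_minus A l = cdimension (range (spectral_projection A {..<l}))"


section \<open>Weak Schatten classes\<close>

definition op_abs :: "('a::complex_hilbert \<Rightarrow> 'a) \<Rightarrow> 'a operator" where
  "op_abs T = op_sqrt (graph_of T O op_adjoint (graph_of T))"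

text \<open>The eigenvalues of \<open>\<bar>T\<bar>\<close> in nonincreasing order, each positive one repeated according to its
  multiplicity, and padded with zeros if \<open>T\<close> has finite rank. For compact \<open>T\<close> this sequence exists
  and is unique.\<close>

definition singular_value :: "('a::complex_hilbert \<Rightarrow> 'a) \<Rightarrow> nat \<Rightarrow> real" where
  "singular_value T = (SOME \<mu>. decseq \<mu> \<and> (\<forall>j. 0 \<le> \<mu> j) \<and>
     (\<forall>e>0. finite {j. \<mu> j = e} \<and>
        enat (card {j. \<mu> j = e}) = cdimension (eigenspace (op_abs T) (complex_of_real e))))"

definition weak_schatten :: "real \<Rightarrow> ('a::complex_hilbert \<Rightarrow> 'a) set" where
  "weak_schatten p = {T. compact_operator T \<and>
     bdd_above (range (\<lambda>j. (real j + 1) powr (1 / p) * singular_value T j))}"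

definition weak_schatten_norm :: "real \<Rightarrow> ('a::complex_hilbert \<Rightarrow> 'a) \<Rightarrow> real" where
  "weak_schatten_norm p T = (SUP j. (real j + 1) powr (1 / p) * singular_value T j)"


section \<open>Quadratic forms and form perturbations\<close>

definition form_domain :: "'a::complex_hilbert operator \<Rightarrow> 'a set" where
  "form_domain H = Domain (op_sqrt (add_scalar H 1))"

text \<open>The form \<open>Q\<^sub>H(x,y) = \<langle>(1+H)\<^sup>1\<^sup>/\<^sup>2x|(1+H)\<^sup>1\<^sup>/\<^sup>2y\<rangle> - \<langle>x|y\<rangle>\<close>. The functional
  \<open>form_of H x\<close> is also the image of \<open>x\<close> under the extension of \<open>H\<close> to the form domain.\<close>

definition form_of :: "'a::complex_hilbert operator \<Rightarrow> 'a \<Rightarrow> 'a \<Rightarrow> complex" where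
  "form_of H x y =
     (let S = op_apply (op_sqrt (add_scalar H 1)) in cinner (S x) (S y) - cinner x y)"

definition plus_norm :: "'a::complex_hilbert operator \<Rightarrow> 'a \<Rightarrow> real" where
  "plus_norm H x = sqrt (Re (form_of H x x) + (norm x)\<^sup>2)"

text \<open>The space of continuous antilinear functionals on the form domain. Functionals are total
  functions whose values outside the form domain are irrelevant.\<close>

definition antidual :: "'a::complex_hilbert operator \<Rightarrow> ('a \<Rightarrow> complex) set" where
  "antidual H = {f.
     (\<forall>x\<in>form_domain H. \<forall>y\<in>form_domain H. f (x + y) = f x + f y) \<and>
     (\<forall>a. \<forall>x\<in>form_domain H. f (a *\<^sub>C x) = cnj a * f x) \<and>
     (\<exists>C. \<forall>x\<in>form_domain H. cmod (f x) \<le> C * plus_norm H x)}"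

definition minus_norm :: "'a::complex_hilbert operator \<Rightarrow> ('a \<Rightarrow> complex) \<Rightarrow> real" where
  "minus_norm H f = Sup {cmod (f x) | x. x \<in> form_domain H \<and> plus_norm H x \<le> 1}"

text \<open>An operator from the form domain to its antidual is a curried function \<open>V\<close>, so that \<open>V x y\<close> is
  both the pairing of \<open>V x\<close> with \<open>y\<close> and the value \<open>Q\<^sub>V(x,y)\<close> of its form.\<close>

definition form_bounded_operator ::
    "'a::complex_hilbert operator \<Rightarrow> ('a \<Rightarrow> 'a \<Rightarrow> complex) \<Rightarrow> bool" where
  "form_bounded_operator H V \<longleftrightarrow>
     (\<forall>x\<in>form_domain H. V x \<in> antidual H) \<and>
     (\<forall>x\<in>form_domain H. \<forall>x'\<in>form_domain H. \<forall>y\<in>form_domain H.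
        V (x + x') y = V x y + V x' y) \<and>
     (\<forall>a. \<forall>x\<in>form_domain H. \<forall>y\<in>form_domain H. V (a *\<^sub>C x) y = a * V x y) \<and>
     (\<exists>C. \<forall>x\<in>form_domain H. minus_norm H (V x) \<le> C * plus_norm H x)"

definition form_symmetric ::
    "'a::complex_hilbert operator \<Rightarrow> ('a \<Rightarrow> 'a \<Rightarrow> complex) \<Rightarrow> bool" where
  "form_symmetric H V \<longleftrightarrow>
     (\<forall>x\<in>form_domain H. \<forall>y\<in>form_domain H. V x y = cnj (V y x))"

definition form_nonpos ::
    "'a::complex_hilbert operator \<Rightarrow> ('a \<Rightarrow> 'a \<Rightarrow> complex) \<Rightarrow> bool" where
  "form_nonpos H V \<longleftrightarrow> (\<forall>x\<in>form_domain H. Re (V x x) \<le> 0)"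

definition form_compact ::
    "'a::complex_hilbert operator \<Rightarrow> ('a \<Rightarrow> 'a \<Rightarrow> complex) \<Rightarrow> bool" where
  "form_compact H V \<longleftrightarrow>
     (\<forall>u C. (\<forall>n::nat. u n \<in> form_domain H \<and> plus_norm H (u n) \<le> C) \<longrightarrow>
        (\<exists>f\<in>antidual H. \<exists>r. strict_mono r \<and>
           (\<lambda>k. minus_norm H (\<lambda>y. V (u (r k)) y - f y)) \<longlonglongrightarrow> 0))"

text \<open>The operator on the Hilbert space associated with the form \<open>Q\<^sub>H + Q\<^sub>V\<close>: its
  domain consists of the \<open>x\<close> for which the functional \<open>(H + V) x\<close> is of the form
  \<open>\<langle>z|\<cdot>\<rangle>\<close> with \<open>z\<close> in the Hilbert space. By the KLMN theorem this is the selfadjoint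
  operator bounded from below whose quadratic form is \<open>Q\<^sub>H + Q\<^sub>V\<close> on the form domain of \<open>H\<close>.\<close>

definition form_sum ::
    "'a::complex_hilbert operator \<Rightarrow> ('a \<Rightarrow> 'a \<Rightarrow> complex) \<Rightarrow> 'a operator" where
  "form_sum H V = {(x, z). x \<in> form_domain H \<and>
     (\<forall>y\<in>form_domain H. form_of H x y + V x y = cinner z y)}"

text \<open>Range of the extension of \<open>H\<close> to an operator from the form domain to its antidual.\<close>

definition extended_range :: "'a::complex_hilbert operator \<Rightarrow> ('a \<Rightarrow> complex) set" where
  "extended_range H = {f. \<exists>x\<in>form_domain H. \<forall>y\<in>form_domain H. f y = form_of H x y}"

text \<open>Extension by duality of a symmetric \<open>R\<close> mapping boundedly into the form domain: the vector
  \<open>R f\<close> with \<open>\<langle>R f|y\<rangle> = \<langle>f, R y\<rangle>\<close> for all \<open>y\<close>.\<close>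

definition dual_extension ::
    "('a::complex_hilbert \<Rightarrow> 'a) \<Rightarrow> ('a \<Rightarrow> complex) \<Rightarrow> 'a" where
  "dual_extension R f = (THE z. \<forall>y. cinner z y = f (R y))"

definition K_op ::
    "'a::complex_hilbert operator \<Rightarrow> ('a \<Rightarrow> 'a \<Rightarrow> complex) \<Rightarrow> 'a \<Rightarrow> 'a" where
  "K_op H V x =
     (let R = op_apply (op_sqrt (partial_inverse H)) in - dual_extension R (V (R x)))"

definition kernel_compression ::
    "'a::complex_hilbert operator \<Rightarrow> ('a \<Rightarrow> 'a \<Rightarrow> complex) \<Rightarrow> 'a \<Rightarrow> 'a" where
  "kernel_compression H V x =
     (let P = projection_onto (op_kernel H) in dual_extension P (V (P x)))"

end

theory Submission
  imports Defs "HOL-Probability.Distribution_Functions"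
begin

text \<open>The Birman--Schwinger principle is linear algebra once every object is transported to the
  Hilbert space itself. Let \<open>T = (H + 1)\<^sup>-\<^sup>1\<close> and \<open>G = T\<^sup>1\<^sup>/\<^sup>2\<close>; then \<open>G\<close> is unitary onto the form
  domain, and \<open>V(G u)(G v) = \<langle>W u|v\<rangle>\<close> for a bounded selfadjoint \<open>W\<close>, which is compact because \<open>V\<close> is
  form compact. Let \<open>P\<close> be the projection onto \<open>ker H = ker (1 - T)\<close> and \<open>Q = 1 - P\<close>. Since \<open>0\<close> is
  isolated in the spectrum, \<open>1 - T + P\<close> is coercive; put \<open>Z = (1 - T + P)\<^sup>-\<^sup>1\<^sup>/\<^sup>2\<close>. All these functions of
  \<open>H\<close> commute, \<open>H\<^sup>-\<^sup>1\<^sup>/\<^sup>2 = G Z Q\<close> and \<open>P = G Z P\<close>, so with \<open>W' = Z W Z\<close> one finds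
  \<open>K\<^sub>V = - Q W' Q\<close>, \<open>\<Pi>\<^sub>0 V \<Pi>\<^sub>0 = P W' P\<close>, and the form of \<open>H\<^sub>V\<close> at \<open>G Z v\<close> is
  \<open>h(v) = \<parallel>Q v\<parallel>\<^sup>2 + \<langle>W' v|v\<rangle>\<close>.

  The inequalities now compare dimensions of subspaces on which such forms have a sign. Following a
  linear map by a spectral projection keeps it injective if it sends no nonzero vector to the kernel of
  the projection, where the form has the opposite sign; \<open>cdimension_rank_nullity\<close> does the rest.
  If \<open>\<langle>K v|v\<rangle> > \<parallel>v\<parallel>\<^sup>2\<close> then \<open>h(Q v) < 0\<close>, which
  gives the lower bound; on the vectors with \<open>P v = 0\<close>, \<open>h(v) = \<parallel>v\<parallel>\<^sup>2 - \<langle>K v|v\<rangle>\<close>, which gives the upper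
  bound with loss \<open>dim ker H\<close>. If \<open>W' \<le> 0\<close>, it suffices to annihilate the negative part of \<open>P W' P\<close>:
  then \<open>\<langle>W' P v|P v\<rangle> = 0\<close>, hence \<open>W' P v = 0\<close> and \<open>h(v) = \<parallel>Q v\<parallel>\<^sup>2 - \<langle>K Q v|Q v\<rangle>\<close>. Finally
  \<open>N\<^sup>+(K; 1)\<close> is at most the number \<open>J\<close> of eigenvalues of \<open>K\<close> above \<open>1\<close>; as the \<open>J\<close>-th singular value
  exceeds \<open>1\<close>, \<open>J\<^sup>1\<^sup>/\<^sup>p\<close> is at most the weak norm (\<open>cdimension_le_weak_schatten_norm\<close>).

  The counting functions refer to a spectral measure, so its existence has to be proved, for
  \<open>H\<^sub>V\<close> as well as for bounded operators. Both have the form \<open>T'\<^sup>-\<^sup>1 - c\<close> with \<open>T'\<close> bounded, positive and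
  injective. Square roots of positive operators (\<open>positive_sqrt_exists\<close>) yield the subspaces
  where \<open>\<bar>T' - r\<bar> = T' - r\<close>; their projections form a resolution of the identity, the associated
  Stieltjes measures are represented by projections on all Borel sets by a Dynkin argument
  (\<open>projection_valued_measure_exists\<close>), and the moments of these measures are computed by
  bisection of intervals (\<open>spectral_measure_exists\<close>). For \<open>H\<^sub>V\<close>, the operator \<open>T'\<close> is
  \<open>G (1 + (c - 1) T + W)\<^sup>-\<^sup>1 G\<close>, where the bracket is coercive for large \<open>c\<close> since \<open>W\<close> is compact.\<close>

section \<open>Geometry of complex Hilbert spaces\<close>

lemma cinner_add_right: "cinner x (y + z) = cinner x y + cinner x (z::'a::complex_hilbert)"
  by (metis cinner_commute cinner_add_left complex_cnj_add)

lemma cinner_scaleC_right: "cinner x (a *\<^sub>C y) = cnj a * cinner x (y::'a::complex_hilbert)"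
  by (metis cinner_commute cinner_scaleC_left complex_cnj_mult)

lemma cinner_scaleR_left: "cinner (r *\<^sub>R x) y = of_real r * cinner x (y::'a::complex_hilbert)"
  by (metis cinner_scaleC_left scaleC_of_real)

lemma cinner_scaleR_right: "cinner x (r *\<^sub>R y) = of_real r * cinner x (y::'a::complex_hilbert)"
  by (metis cinner_scaleC_right scaleC_of_real complex_cnj_complex_of_real)

lemma cinner_self: "cinner x x = complex_of_real ((norm (x::'a::complex_hilbert))\<^sup>2)"
proof -
  have "Im (cinner x x) = 0"
    using cinner_commute[of x x] by (metis cnj.sel(2) equal_neg_zero)
  moreover have "Re (cinner x x) = (norm x)\<^sup>2"
    by (simp add: inner_eq_Re_cinner[symmetric] power2_norm_eq_inner)
  ultimately show ?thesis
    by (simp add: complex_eq_iff)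
qed

lemma norm_scaleC: "norm (a *\<^sub>C x) = cmod a * norm (x::'a::complex_hilbert)"
proof -
  have "cinner (a *\<^sub>C x) (a *\<^sub>C x) = (a * cnj a) * cinner x x"
    by (simp add: cinner_scaleC_left cinner_scaleC_right)
  then have "complex_of_real ((norm (a *\<^sub>C x))\<^sup>2) = complex_of_real ((cmod a * norm x)\<^sup>2)"
    unfolding complex_norm_square[symmetric] cinner_self by (simp add: power_mult_distrib)
  then show ?thesis
    by (metis norm_ge_zero of_real_eq_iff power2_eq_imp_eq mult_nonneg_nonneg)
qed

lemma cmod_cinner_le: "cmod (cinner x y) \<le> norm x * norm (y::'a::complex_hilbert)"
proof (cases "cinner x y = 0")
  case False
  \<comment> \<open>A phase that makes the inner product real, so that the real inequality applies.\<close>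
  define a where "a = cnj (cinner x y) / cmod (cinner x y)"
  have a: "cmod a = 1"
    using False by (simp add: a_def norm_divide)
  have "cinner (a *\<^sub>C x) y = cmod (cinner x y)"
    using False unfolding a_def cinner_scaleC_left
    by (simp add: field_simps) (metis complex_norm_square of_real_mult power2_eq_square mult.commute)
  then have "cmod (cinner x y) = inner (a *\<^sub>C x) y"
    by (simp add: inner_eq_Re_cinner)
  also have "\<dots> \<le> norm (a *\<^sub>C x) * norm y"
    by (rule norm_cauchy_schwarz)
  finally show ?thesis by (simp add: norm_scaleC a)
qed simp

lemma bounded_bilinear_cinner: "bounded_bilinear (cinner :: 'a::complex_hilbert \<Rightarrow> 'a \<Rightarrow> complex)"
  by (rule bounded_bilinear.intro)
    (auto simp: cinner_add_left cinner_add_right cinner_scaleR_left cinner_scaleR_right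
      scaleR_conv_of_real intro!: exI[of _ 1] cmod_cinner_le)

interpretation cinner: bounded_bilinear "cinner :: 'a::complex_hilbert \<Rightarrow> 'a \<Rightarrow> complex"
  by (rule bounded_bilinear_cinner)

lemmas cinner_simps = cinner_add_left cinner_add_right cinner_scaleC_left cinner_scaleC_right
  cinner.diff_left cinner.diff_right cinner.minus_left cinner.minus_right

lemma cinner_eqI: "(\<And>z. cinner x z = cinner y z) \<Longrightarrow> x = (y::'a::complex_hilbert)"
  by (metis cinner.diff_left cinner_self eq_iff_diff_eq_0 norm_eq_zero of_real_eq_0_iff
      power_eq_0_iff)

lemma Im_cinner: "Im (cinner x y) = inner x (\<i> *\<^sub>C (y::'a::complex_hilbert))"
  by (simp add: inner_eq_Re_cinner cinner_scaleC_right)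

lemma scaleC_minus_right: "a *\<^sub>C (- x) = - (a *\<^sub>C (x::'a::complex_hilbert))"
  using complex_vector.scale_minus_right by blast

lemma scaleC_diff_right: "a *\<^sub>C (x - y) = a *\<^sub>C x - a *\<^sub>C (y::'a::complex_hilbert)"
  using complex_vector.scale_right_diff_distrib by blast

lemma bounded_linear_scaleC: "bounded_linear (\<lambda>x::'a::complex_hilbert. a *\<^sub>C x)"
  by (rule bounded_linear_intro[of _ "cmod a"])
    (auto simp: scaleC_add_right norm_scaleC scaleC_of_real[symmetric] scaleC_scaleC mult.commute)

lemma csubspace_scaleR:
  "complex_vector.subspace M \<Longrightarrow> x \<in> M \<Longrightarrow> r *\<^sub>R (x::'a::complex_hilbert) \<in> M"
  by (metis scaleC_of_real complex_vector.subspace_scale)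

lemma csubspace_orthocomplement: "complex_vector.subspace (orthocomplement (S::'a::complex_hilbert set))"
  unfolding complex_vector.subspace_def orthocomplement_def
  by (auto simp: cinner_simps cinner.zero_left)

text \<open>A complex subspace contains \<open>\<i> y\<close> along with \<open>y\<close>, and \<open>\<langle>x|\<i> y\<rangle>\<close> has the imaginary part of
  \<open>\<langle>x|y\<rangle>\<close> as its real part.\<close>

lemma orthocomplement_inner: 
  assumes "complex_vector.subspace (M::'a::complex_hilbert set)" "\<And>y. y \<in> M \<Longrightarrow> inner x y = 0"
  shows "x \<in> orthocomplement M"
proof -
  have "cinner x y = 0" if "y \<in> M" for y
    using assms(2)[OF that] assms(2)[OF complex_vector.subspace_scale[OF assms(1) that, of \<i>]]
    by (simp add: complex_eq_iff Im_cinner inner_eq_Re_cinner)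
  then show ?thesis by (simp add: orthocomplement_def)
qed

text \<open>A minimizing sequence for the distance to \<open>M\<close> is Cauchy by the parallelogram law; its limit
  is the foot of the perpendicular.\<close>

theorem closed_subspace_decomposition:
  fixes M :: "'a::complex_hilbert set"
  assumes M: "complex_vector.subspace M" "closed M"
  shows "\<exists>y\<in>M. x - y \<in> orthocomplement M"
proof -
  have M0: "0 \<in> M" using M(1) by (rule complex_vector.subspace_0)
  then have ne: "M \<noteq> {}" by auto
  define d where "d = infdist x M"
  have d0: "0 \<le> d" by (simp add: d_def infdist_nonneg)
  have dle: "d \<le> norm (x - y)" if "y \<in> M" for y
    using infdist_le[OF that, of x] by (simp add: d_def dist_norm)
  have ex: "\<exists>y\<in>M. norm (x - y) < d + 1 / Suc n" for n :: nat
  proof -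
    have "(INF a\<in>M. dist x a) < d + 1 / Suc n"
      using ne by (simp add: d_def infdist_def)
    then show ?thesis
      using cINF_less_iff[OF ne, of "dist x"] bdd_belowI2[of M 0 "dist x"] by (auto simp: dist_norm)
  qed
  then obtain u where u: "\<And>n. u n \<in> M" "\<And>n. norm (x - u n) < d + 1 / Suc n"
    by metis
  have par: "(norm (u m - u n))\<^sup>2 \<le> 2 * (norm (x - u m))\<^sup>2 + 2 * (norm (x - u n))\<^sup>2 - 4 * d\<^sup>2" for m n
  proof -
    have "(1/2) *\<^sub>R (u m + u n) \<in> M"
      by (intro csubspace_scaleR M complex_vector.subspace_add u)
    from dle[OF this] have "d\<^sup>2 \<le> (norm (x - (1/2) *\<^sub>R (u m + u n)))\<^sup>2"
      using d0 by (intro power_mono) auto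
    moreover have "(norm (u m - u n))\<^sup>2 + 4 * (norm (x - (1/2) *\<^sub>R (u m + u n)))\<^sup>2
        = 2 * (norm (x - u m))\<^sup>2 + 2 * (norm (x - u n))\<^sup>2"
      unfolding power2_norm_eq_inner by (simp add: inner_simps inner_commute algebra_simps)
    ultimately show ?thesis by linarith
  qed
  have lim: "(\<lambda>n. norm (x - u n)) \<longlonglongrightarrow> d"
  proof (rule tendsto_sandwich[of "\<lambda>_. d" _ _ "\<lambda>n. d + 1 / real (Suc n)"])
    show "(\<lambda>n. d + 1 / real (Suc n)) \<longlonglongrightarrow> d"
      using tendsto_add[OF tendsto_const[of d] LIMSEQ_Suc[OF lim_1_over_n]] by simp
    show "\<forall>\<^sub>F n in sequentially. d \<le> norm (x - u n)" using dle u by auto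
    show "\<forall>\<^sub>F n in sequentially. norm (x - u n) \<le> d + 1 / real (Suc n)"
      using less_imp_le[OF u(2)] by (intro always_eventually allI)
  qed (rule tendsto_const)
  have "Cauchy u"
  proof (rule metric_CauchyI)
    fix e :: real assume e: "0 < e"
    have "(\<lambda>n. (norm (x - u n))\<^sup>2) \<longlonglongrightarrow> d\<^sup>2" by (intro tendsto_intros lim)
    from LIMSEQ_D[OF this, of "e\<^sup>2/4"] e obtain N where
      N: "\<And>n. n \<ge> N \<Longrightarrow> \<bar>(norm (x - u n))\<^sup>2 - d\<^sup>2\<bar> < e\<^sup>2/4" by auto
    have "dist (u m) (u n) < e" if "m \<ge> N" "n \<ge> N" for m n
    proof -
      have "(norm (u m - u n))\<^sup>2 < e\<^sup>2"
        using par[of m n] N[OF that(1)] N[OF that(2)] by linarith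
      then show ?thesis using e by (simp add: dist_norm power2_less_imp_less)
    qed
    then show "\<exists>N. \<forall>m\<ge>N. \<forall>n\<ge>N. dist (u m) (u n) < e" by blast
  qed
  then obtain y where y: "u \<longlonglongrightarrow> y" by (auto simp: Cauchy_convergent_iff convergent_def)
  have yM: "y \<in> M" using closed_sequentially[OF M(2) _ y] u(1) by blast
  have nd: "norm (x - y) = d"
    by (rule LIMSEQ_unique[OF _ lim]) (intro tendsto_intros y)
  have "inner (x - y) z = 0" if z: "z \<in> M" for z
  proof (cases "z = 0")
    case False
    define t where "t = inner (x - y) z / inner z z"
    have zz: "inner z z > 0" using False by simp
    have "y + t *\<^sub>R z \<in> M" by (intro complex_vector.subspace_add csubspace_scaleR M yM z)
    from dle[OF this] have "d\<^sup>2 \<le> (norm (x - (y + t *\<^sub>R z)))\<^sup>2" using d0 by (intro power_mono) auto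
    also have "\<dots> = d\<^sup>2 - 2 * t * inner (x - y) z + t\<^sup>2 * inner z z"
      unfolding nd[symmetric] power2_norm_eq_inner
      by (simp add: inner_simps inner_commute algebra_simps power2_eq_square)
    also have "\<dots> = d\<^sup>2 - (inner (x - y) z)\<^sup>2 / inner z z"
      using zz by (simp add: t_def power2_eq_square field_simps)
    finally have "(inner (x - y) z)\<^sup>2 / inner z z \<le> 0" by simp
    then show ?thesis using zz by (simp add: divide_le_0_iff)
  qed simp
  then show ?thesis using yM orthocomplement_inner[OF M(1)] by blast
qed

lemma orthocomplement_Int: "x \<in> M \<Longrightarrow> x \<in> orthocomplement M \<Longrightarrow> x = (0::'a::complex_hilbert)"
  by (auto simp: orthocomplement_def cinner_self)

lemma projection_unique:
  fixes M :: "'a::complex_hilbert set"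
  assumes "complex_vector.subspace M" "y \<in> M" "x - y \<in> orthocomplement M"
  shows "projection_onto M x = y"
  unfolding projection_onto_def
proof (rule the_equality)
  fix z assume z: "z \<in> M \<and> x - z \<in> orthocomplement M"
  have "z - y \<in> M" using assms z complex_vector.subspace_diff by blast
  moreover have "(x - y) - (x - z) \<in> orthocomplement M"
    using assms z complex_vector.subspace_diff[OF csubspace_orthocomplement] by blast
  ultimately show "z = y" using orthocomplement_Int[of "z - y"] by simp
qed (use assms in auto)

lemma projection_onto:
  fixes M :: "'a::complex_hilbert set"
  assumes "complex_vector.subspace M" "closed M"
  shows "projection_onto M x \<in> M" "x - projection_onto M x \<in> orthocomplement M"
  using closed_subspace_decomposition[OF assms, of x] projection_unique[OF assms(1)] by metis+

text \<open>For a functional that does not vanish, the representing vector is found in the orthogonal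
  complement of its kernel, which is one-dimensional.\<close>

theorem Riesz_representation:
  fixes f :: "'a::complex_hilbert \<Rightarrow> complex"
  assumes add: "\<And>x y. f (x + y) = f x + f y" and sc: "\<And>a x. f (a *\<^sub>C x) = cnj a * f x"
    and bd: "\<And>x. cmod (f x) \<le> C * norm x"
  shows "\<exists>z. \<forall>y. f y = cinner z y"
proof -
  have f0: "f 0 = 0" using add[of 0 0] by simp
  have fd: "f (x - y) = f x - f y" for x y using add[of "x - y" y] by simp
  define M where "M = {x. f x = 0}"
  have M: "complex_vector.subspace M" 
    by (auto simp: M_def complex_vector.subspace_def add sc f0)
  have "bounded_linear f"
    by (rule bounded_linear_intro[of _ C])
      (use add sc[of "complex_of_real _"] bd in \<open>auto simp: scaleC_of_real scaleR_conv_of_real mult.commute\<close>)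
  then have "continuous_on UNIV f" by (simp add: linear_continuous_on)
  then have cl: "closed M" unfolding M_def by (intro closed_Collect_eq) auto
  show ?thesis
  proof (cases "\<exists>x. f x \<noteq> 0")
    case True
    then obtain x where x: "f x \<noteq> 0" by blast
    define w where "w = x - projection_onto M x"
    have w: "w \<in> orthocomplement M" unfolding w_def by (rule projection_onto[OF M cl])
    have fw: "f w \<noteq> 0" using projection_onto(1)[OF M cl, of x] x by (simp add: w_def fd M_def)
    then have w0: "w \<noteq> 0" using f0 by auto
    have "f y = cinner ((f w / cinner w w) *\<^sub>C w) y" for y
    proof -
      have "y - cnj (f y / f w) *\<^sub>C w \<in> M" using fw by (simp add: M_def fd sc)
      then have "cinner w (y - cnj (f y / f w) *\<^sub>C w) = 0"
        using w by (auto simp: orthocomplement_def)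
      then have "cinner w y = f y / f w * cinner w w" by (simp add: cinner_simps)
      then show ?thesis using fw w0 by (simp add: cinner_simps cinner_self)
    qed
    then show ?thesis by blast
  qed (auto intro: exI[of _ 0] simp: cinner.zero_left)
qed

section \<open>Bounded selfadjoint operators\<close>

definition hermitian :: "('a::complex_hilbert \<Rightarrow> 'a) \<Rightarrow> bool" where
  "hermitian T \<longleftrightarrow> clinear_map T \<and> bounded_linear T \<and> (\<forall>x y. cinner (T x) y = cinner x (T y))"

definition positive_op :: "('a::complex_hilbert \<Rightarrow> 'a) \<Rightarrow> bool" where
  "positive_op T \<longleftrightarrow> hermitian T \<and> (\<forall>x. 0 \<le> inner (T x) x)"

lemma
  assumes "hermitian T"
  shows hermitian_clinear: "clinear_map T" and hermitian_bounded: "bounded_linear T"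
    and hermitian_cinner: "cinner (T x) y = cinner x (T y)"
    and hermitian_inner: "inner (T x) y = inner x (T y)"
    and hermitian_add: "T (x + y) = T x + T y" and hermitian_scaleC: "T (a *\<^sub>C x) = a *\<^sub>C T x"
    and hermitian_diff: "T (x - y) = T x - T y" and hermitian_zero: "T 0 = 0"
    and hermitian_scaleR: "T (r *\<^sub>R x) = r *\<^sub>R T x" and hermitian_minus: "T (- x) = - T x"
  using assms unfolding hermitian_def clinear_map_def
  by (auto simp: inner_eq_Re_cinner bounded_linear.linear linear_diff linear_0 linear_cmul linear_neg)

lemma hermitian_cinner_real: "hermitian T \<Longrightarrow> cinner (T x) x = complex_of_real (inner (T x) x)"
  by (metis cinner_commute complex_cnj_cancel_iff complex_eq_iff hermitian_cinner
      inner_eq_Re_cinner Reals_cnj_iff of_real_Re)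

lemma scaleR_scaleC: "r *\<^sub>R (a *\<^sub>C x) = a *\<^sub>C (r *\<^sub>R (x::'a::complex_hilbert))"
  by (simp add: scaleC_of_real[symmetric] scaleC_scaleC mult.commute)

lemma hermitian_const: "hermitian (\<lambda>x. r *\<^sub>R x)"
  by (auto simp: hermitian_def clinear_map_def cinner_scaleR_left cinner_scaleR_right
      bounded_linear_scaleR_right scaleR_right_distrib scaleR_scaleC)

lemma hermitian_id: "hermitian (\<lambda>x. x)"
  using hermitian_const[of 1] by simp

lemma hermitian_zero_op: "hermitian (\<lambda>x. 0)"
  using hermitian_const[of 0] by simp

lemma hermitian_add_op: "hermitian S \<Longrightarrow> hermitian T \<Longrightarrow> hermitian (\<lambda>x. S x + T x)"
  by (auto simp: hermitian_def clinear_map_def cinner_simps bounded_linear_add scaleC_add_right)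

lemma hermitian_diff_op: "hermitian S \<Longrightarrow> hermitian T \<Longrightarrow> hermitian (\<lambda>x. S x - T x)"
  by (auto simp: hermitian_def clinear_map_def cinner_simps bounded_linear_sub scaleC_diff_right)

lemma hermitian_minus_op: "hermitian T \<Longrightarrow> hermitian (\<lambda>x. - T x)"
  by (auto simp: hermitian_def clinear_map_def cinner_simps bounded_linear_minus scaleC_minus_right)

lemma hermitian_scaleR_op: "hermitian T \<Longrightarrow> hermitian (\<lambda>x. r *\<^sub>R T x)"
  by (auto simp: hermitian_def clinear_map_def cinner_scaleR_left cinner_scaleR_right
      bounded_linear_const_scaleR scaleR_right_distrib scaleR_scaleC)

lemma hermitian_comp: "hermitian S \<Longrightarrow> hermitian T \<Longrightarrow> (\<And>x. S (T x) = T (S x)) \<Longrightarrow> hermitian (\<lambda>x. S (T x))"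
  by (auto simp: hermitian_def clinear_map_def intro: bounded_linear_compose)

lemma hermitian_sandwich: "hermitian S \<Longrightarrow> hermitian T \<Longrightarrow> hermitian (\<lambda>x. S (T (S x)))"
  by (auto simp: hermitian_def clinear_map_def intro: bounded_linear_compose)

lemma positive_hermitian: "positive_op T \<Longrightarrow> hermitian T"
  and positive_inner: "positive_op T \<Longrightarrow> 0 \<le> inner (T x) x"
  by (auto simp: positive_op_def)

text \<open>The quadratic polynomial \<open>t \<mapsto> \<langle>T (x + t y)|x + t y\<rangle>\<close> is nonnegative, so its discriminant is not
  positive. The subspace \<open>M\<close> is there for operators that are positive only on a spectral subspace.\<close>

lemma positive_Cauchy_Schwarz:
  assumes T: "hermitian T" and M: "complex_vector.subspace M"
    and pos: "\<And>x. x \<in> M \<Longrightarrow> 0 \<le> inner (T x) x" and x: "x \<in> M" and y: "y \<in> M"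
  shows "(inner (T x) y)\<^sup>2 \<le> inner (T x) x * inner (T y) y"
proof -
  have q: "0 \<le> inner (T x) x + 2 * t * inner (T x) y + t\<^sup>2 * inner (T y) y" for t
  proof -
    have "x + t *\<^sub>R y \<in> M" by (intro complex_vector.subspace_add csubspace_scaleR M x y)
    moreover have "inner (T y) x = inner (T x) y" using hermitian_inner[OF T, of y x] by (simp add: inner_commute)
    ultimately show ?thesis using pos[of "x + t *\<^sub>R y"]
      by (simp add: hermitian_add[OF T] hermitian_scaleR[OF T] inner_simps power2_eq_square algebra_simps)
  qed
  show ?thesis
  proof (cases "inner (T y) y = 0")
    case True
    have "inner (T x) y = 0"
    proof (rule ccontr)
      assume ne: "inner (T x) y \<noteq> 0"
      show False using q[of "- (inner (T x) x + 1) / (2 * inner (T x) y)"] True ne by (simp add: field_simps)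
    qed
    then show ?thesis using True by simp
  next
    case False
    then have p: "inner (T y) y > 0" using pos[OF y] by linarith
    show ?thesis using q[of "- inner (T x) y / inner (T y) y"] p
      by (simp add: field_simps power2_eq_square)
  qed
qed

text \<open>The case \<open>y = T x\<close> of the preceding inequality.\<close>

lemma positive_norm_bound:
  assumes T: "hermitian T" and M: "complex_vector.subspace M" and inv: "\<And>x. x \<in> M \<Longrightarrow> T x \<in> M"
    and pos: "\<And>x. x \<in> M \<Longrightarrow> 0 \<le> inner (T x) x"
    and le: "\<And>x. x \<in> M \<Longrightarrow> inner (T x) x \<le> c * (norm x)\<^sup>2" and c: "0 \<le> c" and x: "x \<in> M"
  shows "(norm (T x))\<^sup>2 \<le> c * inner (T x) x" "norm (T x) \<le> c * norm x"
proof -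
  show 1: "(norm (T x))\<^sup>2 \<le> c * inner (T x) x"
  proof (cases "T x = 0")
    case False
    have "(inner (T x) (T x))\<^sup>2 \<le> inner (T x) x * inner (T (T x)) (T x)"
      by (rule positive_Cauchy_Schwarz[OF T M pos x inv[OF x]])
    also have "\<dots> \<le> inner (T x) x * (c * (norm (T x))\<^sup>2)"
      by (rule mult_left_mono[OF le[OF inv[OF x]] pos[OF x]])
    finally have "(norm (T x))\<^sup>2 * (norm (T x))\<^sup>2 \<le> c * inner (T x) x * (norm (T x))\<^sup>2"
      unfolding power2_norm_eq_inner[symmetric] by (simp add: power2_eq_square[of "(norm (T x))\<^sup>2"] mult_ac)
    from mult_right_le_imp_le[OF this] False show ?thesis by simp
  qed (use c pos[OF x] in simp)
  have "c * inner (T x) x \<le> c * (c * (norm x)\<^sup>2)" by (rule mult_left_mono[OF le[OF x] c])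
  then have "(norm (T x))\<^sup>2 \<le> (c * norm x)\<^sup>2" using 1 by (simp add: power2_eq_square mult_ac)
  then show "norm (T x) \<le> c * norm x" using c by (simp add: power2_le_iff_abs_le)
qed

lemma hermitian_inner_bound:
  assumes "hermitian T"
  obtains c where "c > 0" "\<And>x. \<bar>inner (T x) x\<bar> \<le> c * (norm x)\<^sup>2" "\<And>x. norm (T x) \<le> c * norm x"
proof -
  obtain c where c: "c > 0" "\<And>x. norm (T x) \<le> norm x * c"
    using bounded_linear.pos_bounded[OF hermitian_bounded[OF assms]] by blast
  have "\<bar>inner (T x) x\<bar> \<le> c * (norm x)\<^sup>2" for x
  proof -
    have "\<bar>inner (T x) x\<bar> \<le> norm (T x) * norm x" by (rule Cauchy_Schwarz_ineq2)
    also have "\<dots> \<le> (norm x * c) * norm x" by (rule mult_right_mono[OF c(2)]) simp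
    finally show ?thesis by (simp add: power2_eq_square mult_ac)
  qed
  then show ?thesis using c by (intro that[of c]) (auto simp: mult.commute)
qed

lemma positive_inner_eq_0:
  assumes T: "positive_op T" and "inner (T x) x = 0"
  shows "T x = 0"
proof -
  obtain c where c: "c > 0" "\<And>x. \<bar>inner (T x) x\<bar> \<le> c * (norm x)\<^sup>2"
    using hermitian_inner_bound[OF positive_hermitian[OF T]] by metis
  have "(norm (T x))\<^sup>2 \<le> c * inner (T x) x"
    using c positive_inner[OF T]
    by (intro positive_norm_bound(1)[OF positive_hermitian[OF T], of UNIV]) (auto simp: abs_le_iff)
  then show ?thesis using assms(2) by simp
qed

text \<open>For small \<open>t > 0\<close> the map \<open>x \<mapsto> x - t (B x - y)\<close> is a contraction, because
  \<open>1 - t B\<close> lies between \<open>0\<close> and \<open>1 - t d\<close>.\<close>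

theorem coercive_invertible:
  assumes B: "hermitian (B :: 'a::complex_hilbert \<Rightarrow> 'a)" and d: "d > 0"
    and co: "\<And>x. d * (norm x)\<^sup>2 \<le> inner (B x) x"
  obtains R where "positive_op R" "\<And>x. B (R x) = x" "\<And>x. R (B x) = x"
proof -
  obtain c where c: "c > 0" "\<And>x. \<bar>inner (B x) x\<bar> \<le> c * (norm x)\<^sup>2"
    using hermitian_inner_bound[OF B] by metis
  define t where "t = 1 / (c + d)"
  have t: "t > 0" "t * c \<le> 1" "t * d < 1" using c d by (auto simp: t_def field_simps)
  have D: "hermitian (\<lambda>x. x - t *\<^sub>R B x)" by (intro hermitian_diff_op hermitian_id hermitian_scaleR_op B)
  have nD: "norm (x - t *\<^sub>R B x) \<le> (1 - t * d) * norm x" for x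
  proof (rule positive_norm_bound(2)[OF D, of UNIV])
    fix x :: 'a
    have "t * inner (B x) x \<le> t * (c * (norm x)\<^sup>2)"
      using t c(2)[of x] by (intro mult_left_mono) (auto simp: abs_le_iff)
    also have "\<dots> \<le> 1 * (norm x)\<^sup>2" unfolding mult.assoc[symmetric] using t by (intro mult_right_mono) auto
    finally show "0 \<le> inner (x - t *\<^sub>R B x) x" by (simp add: inner_simps power2_norm_eq_inner)
    show "inner (x - t *\<^sub>R B x) x \<le> (1 - t * d) * (norm x)\<^sup>2"
      using mult_left_mono[OF co[of x], of t] t by (simp add: inner_simps power2_norm_eq_inner algebra_simps)
  qed (use t in auto)
  have ex: "\<exists>!x. B x = y" for y
  proof -
    have "\<exists>!x\<in>UNIV. x - t *\<^sub>R (B x - y) = x"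
    proof (rule Banach_fix[of _ "1 - t * d"])
      show "dist (x - t *\<^sub>R (B x - y)) (z - t *\<^sub>R (B z - y)) \<le> (1 - t * d) * dist x z" for x z
      proof -
        have "(x - t *\<^sub>R (B x - y)) - (z - t *\<^sub>R (B z - y)) = (x - z) - t *\<^sub>R B (x - z)"
          by (simp add: hermitian_diff[OF B] algebra_simps)
        then show "dist (x - t *\<^sub>R (B x - y)) (z - t *\<^sub>R (B z - y)) \<le> (1 - t * d) * dist x z"
          using nD[of "x - z"] by (metis dist_norm)
      qed
    qed (use t d in \<open>auto simp: complete_UNIV\<close>)
    then show ?thesis using t by auto
  qed
  define R where "R y = (THE x. B x = y)" for y
  have BR: "B (R y) = y" for y unfolding R_def by (rule theI'[OF ex])
  have RB: "R (B x) = x" for x unfolding R_def using ex by blast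
  have lb: "d * norm x \<le> norm (B x)" for x
  proof (cases "x = 0")
    case False
    have "d * norm x * norm x \<le> norm (B x) * norm x"
      using co[of x] norm_cauchy_schwarz[of "B x" x] by (simp add: power2_eq_square mult.assoc)
    then show ?thesis using False by simp
  qed simp
  have add: "R (x + y) = R x + R y" for x y by (metis BR RB hermitian_add[OF B])
  have sc: "R (a *\<^sub>C x) = a *\<^sub>C R x" for a x by (metis BR RB hermitian_scaleC[OF B])
  have "bounded_linear R"
  proof (rule bounded_linear_intro[of _ "1/d"])
    show "R (r *\<^sub>R x) = r *\<^sub>R R x" for r x by (metis sc scaleC_of_real)
    show "norm (R x) \<le> norm x * (1 / d)" for x using lb[of "R x"] d by (simp add: BR field_simps)
  qed (rule add)
  moreover have "cinner (R x) y = cinner x (R y)" for x y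
    by (metis BR hermitian_cinner[OF B])
  ultimately have "hermitian R" by (simp add: hermitian_def clinear_map_def add sc)
  moreover have "0 \<le> inner (R x) x" for x
  proof -
    have "0 \<le> d * (norm (R x))\<^sup>2" using d by simp
    then have "0 \<le> inner (B (R x)) (R x)" using co[of "R x"] by linarith
    then show ?thesis by (simp add: BR inner_commute)
  qed
  ultimately show ?thesis using that[of R] BR RB by (simp add: positive_op_def)
qed

section \<open>Square roots of positive operators\<close>

lemma hermitian_limit:
  assumes herm: "\<And>n::nat. hermitian (Y n)" and lim: "\<And>x. (\<lambda>n. Y n x) \<longlonglongrightarrow> L x"
    and bd: "\<And>x. norm (L x) \<le> K * norm (x::'a::complex_hilbert)"
  shows "hermitian L"
proof -
  have add: "L (x + y) = L x + L y" for x y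
    by (rule LIMSEQ_unique[OF lim]) (simp add: hermitian_add[OF herm] tendsto_add lim)
  have sc: "L (a *\<^sub>C x) = a *\<^sub>C L x" for a x
    by (rule LIMSEQ_unique[OF lim])
      (simp add: hermitian_scaleC[OF herm] bounded_linear.tendsto[OF bounded_linear_scaleC lim])
  have "bounded_linear L"
    by (rule bounded_linear_intro[of _ K])
      (use add sc[of "complex_of_real _"] bd in \<open>auto simp: scaleC_of_real mult.commute\<close>)
  moreover have "cinner (L x) y = cinner x (L y)" for x y
    by (rule LIMSEQ_unique[OF cinner.tendsto[OF lim tendsto_const]])
      (simp add: hermitian_cinner[OF herm] cinner.tendsto lim)
  ultimately show ?thesis by (simp add: hermitian_def clinear_map_def add sc)
qed

text \<open>Scaled so that \<open>0 \<le> A \<le> 1\<close>, put \<open>B = 1 - A\<close> and iterate \<open>Y \<mapsto> (B + Y\<^sup>2) / 2\<close> from \<open>0\<close>.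
  The scalar iteration for \<open>B = 1\<close> increases and dominates the operator iteration in norm, increments
  included, so the operators converge in norm to a fixed point \<open>L\<close>, and \<open>(1 - L)\<^sup>2 = 1 - B = A\<close>.
  All iterates are polynomials in \<open>A\<close>, hence the statement on commutation.\<close>

theorem positive_sqrt_exists:
  assumes A: "positive_op (A :: 'a::complex_hilbert \<Rightarrow> 'a)"
  shows "\<exists>X. positive_op X \<and> (\<forall>x. X (X x) = A x) \<and>
    (\<forall>C. bounded_linear C \<longrightarrow> (\<forall>x. C (A x) = A (C x)) \<longrightarrow> (\<forall>x. C (X x) = X (C x)))"
proof -
  note hA = positive_hermitian[OF A]
  obtain c where c: "c > 0" "\<And>x. \<bar>inner (A x) x\<bar> \<le> c * (norm x)\<^sup>2"
    using hermitian_inner_bound[OF hA] by metis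
  define B where "B x = x - (1/c) *\<^sub>R A x" for x
  have hB: "hermitian B"
    unfolding B_def by (intro hermitian_diff_op hermitian_id hermitian_scaleR_op hA)
  have nB: "norm (B x) \<le> norm x" for x
  proof -
    have "norm (B x) \<le> 1 * norm x"
    proof (rule positive_norm_bound(2)[OF hB, of UNIV])
      fix x :: 'a
      show "0 \<le> inner (B x) x" using c(1) c(2)[of x]
        by (simp add: B_def inner_simps power2_norm_eq_inner abs_le_iff field_simps)
      show "inner (B x) x \<le> 1 * (norm x)\<^sup>2" using c(1) positive_inner[OF A, of x]
        by (simp add: B_def inner_simps power2_norm_eq_inner)
    qed auto
    then show ?thesis by simp
  qed
  define Y where "Y = rec_nat (\<lambda>x. 0) (\<lambda>_ Y x. (1/2) *\<^sub>R (B x + Y (Y x)))"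
  have Y0: "Y 0 = (\<lambda>x. 0)" and YS: "Y (Suc n) = (\<lambda>x. (1/2) *\<^sub>R (B x + Y n (Y n x)))" for n
    by (auto simp: Y_def)
  define y :: "nat \<Rightarrow> real" where "y = rec_nat 0 (\<lambda>_ y. (1 + y\<^sup>2) / 2)"
  have y0: "y 0 = 0" and yS: "y (Suc n) = (1 + (y n)\<^sup>2) / 2" for n by (auto simp: y_def)
  have y01: "0 \<le> y n \<and> y n \<le> 1" for n
    by (induction n) (auto simp: y0 yS power_le_one add_nonneg_nonneg)
  have hY: "hermitian (Y n)" for n
  proof (induction n)
    case (Suc n)
    show ?case unfolding YS
      by (intro hermitian_scaleR_op hermitian_add_op hB hermitian_comp[OF Suc Suc] refl)
  qed (simp add: Y0 hermitian_zero_op)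
  have nY: "norm (Y n x) \<le> y n * norm x" for n x
  proof (induction n arbitrary: x)
    case (Suc n)
    have "norm (Y n (Y n x)) \<le> y n * (y n * norm x)"
      using Suc[of "Y n x"] mult_left_mono[OF Suc[of x], of "y n"] y01[of n] by linarith
    moreover have "norm (Y (Suc n) x) = (1/2) * norm (B x + Y n (Y n x))"
      unfolding YS by simp
    ultimately show ?case using norm_triangle_ineq[of "B x" "Y n (Y n x)"] nB[of x]
      by (simp add: yS power2_eq_square field_simps)
  qed (simp add: Y0 y0)
  have dY: "norm (Y (Suc n) x - Y n x) \<le> (y (Suc n) - y n) * norm x \<and> y n \<le> y (Suc n)" for n x
  proof (induction n arbitrary: x)
    case 0
    show ?case using nB[of x] by (simp add: Y0 YS y0 yS)
  next
    case (Suc n)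
    let ?d = "y (Suc n) - y n"
    have d0: "0 \<le> ?d" using Suc[of x] by simp
    have eq: "Y (Suc (Suc n)) x - Y (Suc n) x
        = (1/2) *\<^sub>R (Y (Suc n) (Y (Suc n) x - Y n x) + (Y (Suc n) (Y n x) - Y n (Y n x)))"
    proof -
      have B: "B x = 2 *\<^sub>R Y (Suc n) x - Y n (Y n x)"
        unfolding fun_cong[OF YS[of n], of x] by simp
      show ?thesis
        unfolding fun_cong[OF YS[of "Suc n"]] hermitian_diff[OF hY] B scaleR_right_diff_distrib scaleR_add_right
        by simp
    qed
    have 1: "norm (Y (Suc n) (Y (Suc n) x - Y n x)) \<le> y (Suc n) * (?d * norm x)"
      using nY[of "Suc n" "Y (Suc n) x - Y n x"] mult_left_mono[of _ _ "y (Suc n)"] Suc[of x] y01[of "Suc n"]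
      by (meson order_trans)
    have 2: "norm (Y (Suc n) (Y n x) - Y n (Y n x)) \<le> ?d * (y n * norm x)"
      using Suc[of "Y n x"] mult_left_mono[OF nY[of n x] d0] by linarith
    have "2 * norm (Y (Suc (Suc n)) x - Y (Suc n) x) \<le> y (Suc n) * (?d * norm x) + ?d * (y n * norm x)"
      unfolding eq using norm_triangle_mono[OF 1 2] by simp
    moreover have "2 * (y (Suc (Suc n)) - y (Suc n)) = (y (Suc n))\<^sup>2 - (y n)\<^sup>2"
    proof -
      have "2 * y (Suc k) = 1 + (y k)\<^sup>2" for k using yS[of k] by simp
      then show ?thesis by (simp only: right_diff_distrib)
    qed
    ultimately have "2 * norm (Y (Suc (Suc n)) x - Y (Suc n) x) \<le> 2 * (y (Suc (Suc n)) - y (Suc n)) * norm x"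
      by (simp only: power2_eq_square) (simp add: algebra_simps)
    moreover have "y (Suc n) \<le> y (Suc (Suc n))"
      using power_mono[of "y n" "y (Suc n)" 2] y01[of n] d0 by (simp add: yS[of "Suc n"] yS[of n])
    ultimately show ?case by (simp add: algebra_simps)
  qed
  have dYk: "norm (Y (n + k) x - Y n x) \<le> (y (n + k) - y n) * norm x" for n k x
  proof (induction k)
    case (Suc k)
    then show ?case using norm_triangle_ineq[of "Y (n + Suc k) x - Y (n + k) x" "Y (n + k) x - Y n x"]
        dY[of "n + k" x] by (simp add: algebra_simps)
  qed simp
  have dYm: "norm (Y m x - Y n x) \<le> (y m - y n) * norm x" if "n \<le> m" for m n x
    using dYk[of n "m - n" x] that by simp
  have "incseq y" using dY by (auto intro: incseq_SucI)
  then obtain l where l: "y \<longlonglongrightarrow> l" "\<And>n. y n \<le> l"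
    using incseq_convergent[of y 1] y01 by blast
  have "convergent (\<lambda>n. Y n x)" for x
    unfolding Cauchy_convergent_iff[symmetric]
  proof (rule metric_CauchyI)
    fix e :: real assume e: "0 < e"
    have "0 < e / (norm x + 1)" using e by (simp add: add_nonneg_pos)
    from LIMSEQ_D[OF l(1) this] obtain N where
      N: "\<And>n. n \<ge> N \<Longrightarrow> \<bar>y n - l\<bar> < e / (norm x + 1)" by auto
    have *: "dist (Y m x) (Y n x) < e" if "n \<ge> N" "m \<ge> n" for m n
    proof -
      have "y m - y n \<le> e / (norm x + 1)" using N[OF that(1)] l(2)[of m] l(2)[of n] by linarith
      then have "(y m - y n) * norm x \<le> e / (norm x + 1) * norm x" by (intro mult_right_mono) auto
      also have "\<dots> < e" using e by (simp add: field_simps add_pos_nonneg)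
      finally show ?thesis using dYm[OF that(2), of x] by (simp add: dist_norm)
    qed
    show "\<exists>N. \<forall>m\<ge>N. \<forall>n\<ge>N. dist (Y m x) (Y n x) < e"
      using * by (metis dist_commute nle_le)
  qed
  then obtain L where L: "\<And>x. (\<lambda>n. Y n x) \<longlonglongrightarrow> L x" unfolding convergent_def by metis
  have nL: "norm (L x) \<le> 1 * norm x" for x
  proof (rule LIMSEQ_le_const2[OF tendsto_norm[OF L]])
    have "norm (Y n x) \<le> 1 * norm x" for n
      by (rule order_trans[OF nY mult_right_mono]) (use y01 in auto)
    then show "\<exists>N. \<forall>n\<ge>N. norm (Y n x) \<le> 1 * norm x" by blast
  qed
  have hL: "hermitian L" by (rule hermitian_limit[OF hY L nL])
  have YY: "(\<lambda>n. Y n (Y n x)) \<longlonglongrightarrow> L (L x)" for x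
  proof -
    have "(\<lambda>n. Y n (Y n x - L x)) \<longlonglongrightarrow> 0"
    proof (rule Lim_null_comparison)
      show "(\<lambda>n. norm (Y n x - L x)) \<longlonglongrightarrow> 0"
        using tendsto_norm[OF tendsto_diff[OF L[of x] tendsto_const[of "L x"]]] by simp
      have "norm (Y n (Y n x - L x)) \<le> norm (Y n x - L x)" for n
        using nY[of n "Y n x - L x"] mult_right_mono[of "y n" 1 "norm (Y n x - L x)"] y01[of n] by simp
      then show "\<forall>\<^sub>F n in sequentially. norm (Y n (Y n x - L x)) \<le> norm (Y n x - L x)" by simp
    qed
    from tendsto_add[OF this L[of "L x"]] show ?thesis by (simp add: hermitian_diff[OF hY])
  qed
  have fix_L: "2 *\<^sub>R L x = B x + L (L x)" for x
  proof (rule LIMSEQ_unique)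
    show "(\<lambda>n. 2 *\<^sub>R Y (Suc n) x) \<longlonglongrightarrow> 2 *\<^sub>R L x"
      by (intro tendsto_intros LIMSEQ_Suc L)
    show "(\<lambda>n. 2 *\<^sub>R Y (Suc n) x) \<longlonglongrightarrow> B x + L (L x)"
      unfolding YS by (simp add: tendsto_add YY)
  qed
  define X where "X x = sqrt c *\<^sub>R (x - L x)" for x
  have hX: "hermitian X" unfolding X_def
    by (intro hermitian_diff_op hermitian_id hermitian_scaleR_op hL)
  have "0 \<le> inner (X x) x" for x
  proof -
    have "inner (L x) x \<le> norm x * norm x"
      using norm_cauchy_schwarz[of "L x" x] mult_right_mono[OF nL[of x], of "norm x"] by simp
    then show ?thesis using c(1) by (simp add: X_def inner_simps power2_norm_eq_inner[symmetric] power2_eq_square)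
  qed
  then have pX: "positive_op X" using hX by (simp add: positive_op_def)
  have XX: "X (X x) = A x" for x
  proof -
    have "X (X x) = c *\<^sub>R (x - L x - (L x - L (L x)))"
      using c(1) unfolding X_def hermitian_scaleR[OF hL] hermitian_diff[OF hL]
      by (simp add: scaleR_diff_right[symmetric] flip: real_sqrt_mult)
    also have "x - L x - (L x - L (L x)) = (1/c) *\<^sub>R A x"
      using fix_L[of x] by (simp add: B_def scaleR_2 algebra_simps)
    finally show ?thesis using c(1) by simp
  qed
  have com: "C (X x) = X (C x)" if C: "bounded_linear C" and CA: "\<And>x. C (A x) = A (C x)" for C x
  proof -
    interpret C: bounded_linear C by (rule C)
    have CB: "C (B x) = B (C x)" for x by (simp add: B_def C.diff C.scaleR CA)
    have CY: "C (Y n x) = Y n (C x)" for n x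
      by (induction n arbitrary: x) (simp_all add: Y0 YS C.zero C.scaleR C.add CB)
    have "C (L x) = L (C x)"
      by (rule LIMSEQ_unique[OF C.tendsto[OF L]]) (simp add: CY L)
    then show ?thesis by (simp add: X_def C.scaleR C.diff)
  qed
  show ?thesis using pX XX com by blast
qed

definition psqrt :: "('a::complex_hilbert \<Rightarrow> 'a) \<Rightarrow> 'a \<Rightarrow> 'a" where
  "psqrt A = (SOME X. positive_op X \<and> (\<forall>x. X (X x) = A x) \<and>
    (\<forall>C. bounded_linear C \<longrightarrow> (\<forall>x. C (A x) = A (C x)) \<longrightarrow> (\<forall>x. C (X x) = X (C x))))"

lemma psqrt:
  assumes "positive_op A"
  shows psqrt_positive: "positive_op (psqrt A)" and psqrt_square: "psqrt A (psqrt A x) = A x"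
    and psqrt_commute: "bounded_linear C \<Longrightarrow> (\<And>x. C (A x) = A (C x)) \<Longrightarrow> C (psqrt A x) = psqrt A (C x)"
proof -
  note * = someI_ex[OF positive_sqrt_exists[OF assms], folded psqrt_def]
  show "positive_op (psqrt A)" by (rule *[THEN conjunct1])
  show "psqrt A (psqrt A x) = A x" by (rule *[THEN conjunct2, THEN conjunct1, THEN spec])
  show "bounded_linear C \<Longrightarrow> (\<And>x. C (A x) = A (C x)) \<Longrightarrow> C (psqrt A x) = psqrt A (C x)"
    by (rule *[THEN conjunct2, THEN conjunct2, rule_format])
qed

text \<open>A second root \<open>X\<close> commutes with its square, hence with \<open>psqrt A\<close>; for
  \<open>z = X x - psqrt A x\<close> this gives \<open>X z = - psqrt A z\<close>, and positivity annihilates both sides.\<close>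

lemma psqrt_unique:
  assumes X: "positive_op X" and XX: "\<And>x. X (X x) = A x" and A: "positive_op A"
  shows "X = psqrt A"
proof
  fix x
  let ?S = "psqrt A"
  note hX = positive_hermitian[OF X] and hS = positive_hermitian[OF psqrt_positive[OF A]]
  have com: "X (?S v) = ?S (X v)" for v
    by (rule psqrt_commute[OF A hermitian_bounded[OF hX]]) (simp flip: XX)
  define z where "z = X x - ?S x"
  have "X z + ?S z = 0"
    by (simp add: z_def hermitian_diff[OF hX] hermitian_diff[OF hS] XX psqrt_square[OF A] com)
  then have "inner (X z) z + inner (?S z) z = 0" by (metis inner_add_left inner_zero_left)
  then have "inner (X z) z = 0" "inner (?S z) z = 0"
    using positive_inner[OF X, of z] positive_inner[OF psqrt_positive[OF A], of z] by linarith+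
  then have "X z = 0" "?S z = 0"
    using positive_inner_eq_0 X psqrt_positive[OF A] by blast+
  then have "inner z z = 0"
    using hermitian_inner[OF hX, of z x] hermitian_inner[OF hS, of z x]
      inner_diff_right[of z "X x" "?S x", folded z_def] by simp
  then show "X x = ?S x" by (simp add: z_def)
qed

text \<open>\<open>A B = B\<^sup>1\<^sup>/\<^sup>2 A B\<^sup>1\<^sup>/\<^sup>2\<close>, because \<open>A\<close> commutes with the square root of \<open>B\<close> as well.\<close>

lemma positive_comp:
  assumes A: "positive_op A" and B: "positive_op B" and com: "\<And>x. A (B x) = B (A x)"
  shows "positive_op (\<lambda>x. A (B x))"
proof -
  have c: "A (psqrt B x) = psqrt B (A x)" for x
    by (rule psqrt_commute[OF B hermitian_bounded[OF positive_hermitian[OF A]] com])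
  have "0 \<le> inner (A (B x)) x" for x
  proof -
    have "inner (A (B x)) x = inner (psqrt B (A (psqrt B x))) x"
      by (simp flip: c add: psqrt_square[OF B])
    also have "\<dots> = inner (A (psqrt B x)) (psqrt B x)"
      by (rule hermitian_inner[OF positive_hermitian[OF psqrt_positive[OF B]]])
    finally show ?thesis using positive_inner[OF A] by simp
  qed
  then show ?thesis using assms by (auto simp: positive_op_def intro: hermitian_comp)
qed

section \<open>Selfadjoint relations and their square roots\<close>

lemma graph_of_iff: "(x, y) \<in> graph_of T \<longleftrightarrow> y = T x"
  by (auto simp: graph_of_def)

lemma op_adjoint_iff: "(y, z) \<in> op_adjoint A \<longleftrightarrow> (\<forall>x w. (x, w) \<in> A \<longrightarrow> cinner w y = cinner x z)"
  by (auto simp: op_adjoint_def)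

lemma op_adjoint_converse: "op_adjoint (A\<inverse>) = (op_adjoint (A::'a::complex_hilbert operator))\<inverse>"
proof -
  have "(y, z) \<in> op_adjoint (A\<inverse>) \<longleftrightarrow> (y, z) \<in> (op_adjoint A)\<inverse>" for y z
  proof -
    have "(y, z) \<in> op_adjoint (A\<inverse>) \<longleftrightarrow> (\<forall>x w. (w, x) \<in> A \<longrightarrow> cinner w y = cinner x z)"
      by (simp only: op_adjoint_iff converse_iff)
    also have "\<dots> \<longleftrightarrow> (\<forall>x w. (x, w) \<in> A \<longrightarrow> cinner w z = cinner x y)"
      by (subst all_comm) (intro iff_allI imp_cong refl eq_commute)
    also have "\<dots> \<longleftrightarrow> (y, z) \<in> (op_adjoint A)\<inverse>"
      by (simp only: op_adjoint_iff converse_iff)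
    finally show ?thesis .
  qed
  then show ?thesis by (intro subset_antisym subrelI) blast+
qed

lemma selfadjoint_symmetric: 
  assumes "selfadjoint A" "(x, w) \<in> A" "(y, z) \<in> A" shows "cinner w y = cinner x z"
proof -
  have "(y, z) \<in> op_adjoint A" using assms by (simp add: selfadjoint_def)
  then show ?thesis using assms(2) unfolding op_adjoint_iff by blast
qed

lemma op_adjoint_graph: 
  assumes "hermitian T" shows "op_adjoint (graph_of T) = graph_of T"
proof -
  have "(y, z) \<in> op_adjoint (graph_of T) \<longleftrightarrow> (y, z) \<in> graph_of T" for y z
    by (auto simp: op_adjoint_iff graph_of_iff hermitian_cinner[OF assms])
      (metis cinner_commute cinner_eqI)
  then show ?thesis by auto
qed

lemma selfadjoint_graph: 
  assumes "hermitian T" shows "selfadjoint (graph_of T)"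
proof -
  have "is_operator (graph_of T)"
    by (simp add: is_operator_def graph_of_iff single_valued_def hermitian_zero[OF assms]
        hermitian_add[OF assms] hermitian_scaleC[OF assms])
  moreover have "Domain (graph_of T) = UNIV" by (auto simp: graph_of_def)
  ultimately show ?thesis by (simp add: selfadjoint_def op_adjoint_graph[OF assms])
qed

lemma op_nonneg_graph: "positive_op T \<Longrightarrow> op_nonneg (graph_of T)"
  by (auto simp: op_nonneg_def graph_of_def positive_op_def inner_eq_Re_cinner)

text \<open>Symmetry together with a domain that is everything forces such a relation to be the graph of
  a linear map, and the bound \<open>\<parallel>X x\<parallel>\<^sup>2 = \<langle>A x|x\<rangle>\<close> makes it continuous.\<close>

lemma root_relation_unique:
  assumes A: "positive_op A" and dom: "Domain U = UNIV"
    and sym: "\<And>x w y z. (x, w) \<in> U \<Longrightarrow> (y, z) \<in> U \<Longrightarrow> cinner w y = cinner x z"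
    and nonneg: "op_nonneg U" and sq: "U O U = graph_of A"
  shows "U = graph_of (psqrt A)"
proof -
  have "\<forall>x. \<exists>w. (x, w) \<in> U" using dom by blast
  then obtain X where X: "\<And>x. (x, X x) \<in> U" by metis
  have sX: "cinner (X x) y = cinner x (X y)" for x y using sym X by blast
  have U: "w = X x" if "(x, w) \<in> U" for x w
    using sym[OF that X] sX by (metis cinner_eqI)
  have XX: "X (X x) = A x" for x
    using sq X[of x] X[of "X x"] by (metis graph_of_iff relcomp.relcompI)
  have add: "X (x + y) = X x + X y" for x y by (rule cinner_eqI) (simp add: sX cinner_simps)
  have sc: "X (a *\<^sub>C x) = a *\<^sub>C X x" for a x by (rule cinner_eqI) (simp add: sX cinner_simps)
  obtain c where c: "c > 0" "\<And>x. \<bar>inner (A x) x\<bar> \<le> c * (norm x)\<^sup>2"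
    using hermitian_inner_bound[OF positive_hermitian[OF A]] by metis
  have "(norm (X x))\<^sup>2 \<le> c * (norm x)\<^sup>2" for x
  proof -
    have "complex_of_real ((norm (X x))\<^sup>2) = cinner (A x) x"
      unfolding cinner_self[symmetric] XX[symmetric] by (simp only: sX)
    then have "(norm (X x))\<^sup>2 = inner (A x) x" by (metis Re_complex_of_real inner_eq_Re_cinner)
    then show ?thesis using c(2)[of x] by simp
  qed
  then have bd: "norm (X x) \<le> norm x * sqrt c" for x
    using c(1) by (metis mult.commute norm_ge_zero real_le_rsqrt real_sqrt_abs real_sqrt_mult abs_norm_cancel)
  have "bounded_linear X"
    by (rule bounded_linear_intro[of _ "sqrt c"])
      (use add sc[of "complex_of_real _"] bd in \<open>auto simp: scaleC_of_real\<close>)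
  then have "hermitian X" using add sc sX by (simp add: hermitian_def clinear_map_def)
  moreover have "0 \<le> inner (X x) x" for x
    using nonneg X[of x] by (auto simp: op_nonneg_def inner_eq_Re_cinner)
  ultimately have "positive_op X" by (simp add: positive_op_def)
  then have "X = psqrt A" by (rule psqrt_unique[OF _ XX A])
  moreover have "U = graph_of X" using U X by (auto simp: graph_of_iff)
  ultimately show ?thesis by simp
qed

text \<open>The description of \<open>op_sqrt\<close> as some root becomes usable by uniqueness: every root has full domain
  because its square has.\<close>

lemma op_sqrt_graph:
  assumes A: "positive_op A"
  shows "op_sqrt (graph_of A) = graph_of (psqrt A)"
proof -
  have "selfadjoint (graph_of (psqrt A)) \<and> op_nonneg (graph_of (psqrt A)) \<and>
      graph_of (psqrt A) O graph_of (psqrt A) = graph_of A"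
    using psqrt_positive[OF A] 
    by (auto simp: selfadjoint_graph positive_hermitian op_nonneg_graph graph_of_iff psqrt_square[OF A])
  then have *: "selfadjoint (op_sqrt (graph_of A)) \<and> op_nonneg (op_sqrt (graph_of A)) \<and>
      op_sqrt (graph_of A) O op_sqrt (graph_of A) = graph_of A"
    unfolding op_sqrt_def by (rule someI)
  have "Domain (op_sqrt (graph_of A)) = UNIV"
  proof -
    have "(x, A x) \<in> op_sqrt (graph_of A) O op_sqrt (graph_of A)" for x
      using * by (simp add: graph_of_iff)
    then show ?thesis by blast
  qed
  then show ?thesis using * by (intro root_relation_unique[OF A] selfadjoint_symmetric) auto
qed

lemma csubspace_range: "clinear_map T \<Longrightarrow> complex_vector.subspace (range (T :: 'a::complex_hilbert \<Rightarrow> 'a))"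
  unfolding clinear_map_def complex_vector.subspace_def
  by (auto simp: image_iff) (metis complex_vector.scale_zero_left, metis, metis)

lemma csubspace_closure:
  assumes M: "complex_vector.subspace (M :: 'a::complex_hilbert set)"
  shows "complex_vector.subspace (closure M)"
proof -
  have "0 \<in> closure M" using complex_vector.subspace_0[OF M] closure_subset by blast
  moreover have "x + y \<in> closure M" if xy: "x \<in> closure M" "y \<in> closure M" for x y
  proof -
    obtain u v where u: "\<And>n. u n \<in> M" "u \<longlonglongrightarrow> x" and v: "\<And>n. v n \<in> M" "v \<longlonglongrightarrow> y"
      using xy unfolding closure_sequential by blast
    have "\<forall>n. u n + v n \<in> M" using u(1) v(1) complex_vector.subspace_add[OF M] by blast
    moreover have "(\<lambda>n. u n + v n) \<longlonglongrightarrow> x + y" by (rule tendsto_add[OF u(2) v(2)])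
    ultimately show ?thesis unfolding closure_sequential by (intro exI[of _ "\<lambda>n. u n + v n"]) simp
  qed
  moreover have "a *\<^sub>C x \<in> closure M" if x: "x \<in> closure M" for a x
  proof -
    obtain u where u: "\<And>n. u n \<in> M" "u \<longlonglongrightarrow> x" using x unfolding closure_sequential by blast
    have "\<forall>n. a *\<^sub>C u n \<in> M" using u(1) complex_vector.subspace_scale[OF M] by blast
    moreover have "(\<lambda>n. a *\<^sub>C u n) \<longlonglongrightarrow> a *\<^sub>C x"
      by (rule bounded_linear.tendsto[OF bounded_linear_scaleC u(2)])
    ultimately show ?thesis unfolding closure_sequential by (intro exI[of _ "\<lambda>n. a *\<^sub>C u n"]) simp
  qed
  ultimately show ?thesis by (simp add: complex_vector.subspace_def)
qed

text \<open>The orthogonal complement of the range is the kernel.\<close>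

lemma hermitian_range_dense:
  assumes T: "hermitian T" and inj: "\<And>x. T x = 0 \<Longrightarrow> x = 0"
  shows "closure (range T) = UNIV"
proof -
  note sub = csubspace_closure[OF csubspace_range[OF hermitian_clinear[OF T]]]
  have "x \<in> closure (range T)" for x
  proof -
    obtain y where y: "y \<in> closure (range T)" "x - y \<in> orthocomplement (closure (range T))"
      using closed_subspace_decomposition[OF sub closed_closure] by blast
    have orth: "cinner (x - y) (T z) = 0" for z
    proof -
      have "T z \<in> closure (range T)" by (rule subsetD[OF closure_subset]) simp
      then show ?thesis using y(2) unfolding orthocomplement_def by blast
    qed
    have "T (x - y) = 0"
      by (rule cinner_eqI) (simp only: hermitian_cinner[OF T] cinner.zero_left orth)
    then have "x - y = 0" by (rule inj)
    then show ?thesis using y(1) by simp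
  qed
  then show ?thesis by auto
qed

lemma selfadjoint_converse_graph:
  assumes T: "hermitian T" and inj: "\<And>x. T x = 0 \<Longrightarrow> x = 0"
  shows "selfadjoint ((graph_of T)\<inverse>)"
proof -
  have "x = y" if "T x = T y" for x y
    using inj[of "x - y"] that by (simp add: hermitian_diff[OF T])
  then have "is_operator ((graph_of T)\<inverse>)"
    unfolding is_operator_def
    by (auto simp: graph_of_iff single_valued_def hermitian_zero[OF T] hermitian_add[OF T] hermitian_scaleC[OF T])
  moreover have "Domain ((graph_of T)\<inverse>) = range T" by (auto simp: graph_of_def)
  ultimately show ?thesis
    using hermitian_range_dense[OF assms] by (simp add: selfadjoint_def op_adjoint_converse op_adjoint_graph[OF T])
qed

text \<open>Taking converses exchanges the roots of \<open>T\<^sup>-\<^sup>1\<close> with those of \<open>T\<close>, and the adjoint of a converse is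
  the converse of the adjoint; so the root of an unbounded operator is found without unbounded
  functional calculus.\<close>

lemma op_sqrt_converse_graph:
  assumes T: "positive_op T" and inj: "\<And>x. T x = 0 \<Longrightarrow> x = 0"
  shows "op_sqrt ((graph_of T)\<inverse>) = (graph_of (psqrt T))\<inverse>"
proof -
  let ?X = "psqrt T" and ?A = "(graph_of T)\<inverse>"
  have X: "positive_op ?X" by (rule psqrt_positive[OF T])
  have injX: "x = 0" if "?X x = 0" for x
    using inj[of x] that psqrt_square[OF T, of x] hermitian_zero[OF positive_hermitian[OF X]] by simp
  have "op_nonneg ((graph_of ?X)\<inverse>)"
    using X by (auto simp: op_nonneg_def graph_of_def positive_op_def inner_eq_Re_cinner[symmetric] inner_commute)
  moreover have "(graph_of ?X)\<inverse> O (graph_of ?X)\<inverse> = ?A"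
    by (auto simp: graph_of_iff psqrt_square[OF T] relcomp_unfold)
  ultimately have "selfadjoint ((graph_of ?X)\<inverse>) \<and> op_nonneg ((graph_of ?X)\<inverse>) \<and> (graph_of ?X)\<inverse> O (graph_of ?X)\<inverse> = ?A"
    using selfadjoint_converse_graph[OF positive_hermitian[OF X] injX] by blast
  then have *: "selfadjoint (op_sqrt ?A) \<and> op_nonneg (op_sqrt ?A) \<and> op_sqrt ?A O op_sqrt ?A = ?A"
    unfolding op_sqrt_def by (rule someI)
  have "(op_sqrt ?A)\<inverse> = graph_of ?X"
  proof (rule root_relation_unique[OF T])
    show sq: "(op_sqrt ?A)\<inverse> O (op_sqrt ?A)\<inverse> = graph_of T"
      using * by (metis converse_converse converse_relcomp)
    have "(x, T x) \<in> (op_sqrt ?A)\<inverse> O (op_sqrt ?A)\<inverse>" for x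
      using sq by (simp add: graph_of_iff)
    then show "Domain ((op_sqrt ?A)\<inverse>) = UNIV" by blast
    show "op_nonneg ((op_sqrt ?A)\<inverse>)"
      using * by (auto simp: op_nonneg_def inner_eq_Re_cinner[symmetric] inner_commute)
    show "cinner w y = cinner x z" if "(x, w) \<in> (op_sqrt ?A)\<inverse>" "(y, z) \<in> (op_sqrt ?A)\<inverse>" for x w y z
      using selfadjoint_symmetric[of "op_sqrt ?A" w x z y] that * by simp
  qed
  then show ?thesis by (metis converse_converse)
qed

section \<open>Orthogonal projections\<close>

lemma
  assumes P: "orthogonal_projection P"
  shows projection_hermitian: "hermitian P" and projection_idem: "P (P x) = P x"
    and projection_form: "inner (P x) x = (norm (P x))\<^sup>2"
    and projection_norm_le: "norm (P x) \<le> norm x"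
proof -
  have idem: "P (P x) = P x" and sym: "cinner (P x) y = cinner x (P y)" for x y
    using P by (auto simp: orthogonal_projection_def)
  have cf: "cinner (P x) x = complex_of_real ((norm (P x))\<^sup>2)" for x
    by (metis cinner_self idem sym)
  then have nf: "inner (P x) x = (norm (P x))\<^sup>2" for x by (simp add: inner_eq_Re_cinner)
  have le: "norm (P x) \<le> norm x" for x
  proof (cases "P x = 0")
    case False
    have "norm (P x) * norm (P x) \<le> norm (P x) * norm x"
      using nf[of x] norm_cauchy_schwarz[of "P x" x] by (simp add: power2_eq_square)
    then show ?thesis using False by simp
  qed simp
  have cl: "clinear_map P" using P by (simp add: orthogonal_projection_def)
  have "bounded_linear P"
    by (rule bounded_linear_intro[of _ 1])
      (use cl le in \<open>auto simp: clinear_map_def simp flip: scaleC_of_real\<close>)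
  then show "hermitian P" using cl sym by (simp add: hermitian_def)
  show "P (P x) = P x" "inner (P x) x = (norm (P x))\<^sup>2" "norm (P x) \<le> norm x"
    using idem nf le cf by auto
qed

lemma orthogonal_projectionI: "hermitian P \<Longrightarrow> (\<And>x. P (P x) = P x) \<Longrightarrow> orthogonal_projection P"
  by (auto simp: orthogonal_projection_def hermitian_def)

lemma projection_complement: 
  assumes "orthogonal_projection P" shows "orthogonal_projection (\<lambda>x. x - P x)"
proof (rule orthogonal_projectionI)
  show "hermitian (\<lambda>x. x - P x)"
    by (rule hermitian_diff_op[OF hermitian_id projection_hermitian[OF assms]])
  show "x - P x - P (x - P x) = x - P x" for x
    by (simp add: hermitian_diff[OF projection_hermitian[OF assms]] projection_idem[OF assms])
qed

lemma projection_pythagoras: 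
  assumes "orthogonal_projection P" shows "(norm (x - P x))\<^sup>2 = (norm x)\<^sup>2 - (norm (P x))\<^sup>2"
  using projection_form[OF assms, of x]
  by (simp add: power2_norm_eq_inner inner_simps inner_commute)

text \<open>The norms \<open>\<parallel>P x\<parallel>\<close> determine the range of \<open>P\<close>, as those \<open>x\<close> with \<open>\<parallel>P x\<parallel> = \<parallel>x\<parallel>\<close>, and its
  kernel.\<close>

lemma projection_eqI:
  assumes P: "orthogonal_projection P" and Q: "orthogonal_projection Q"
    and eq: "\<And>x. norm (P x) = norm (Q x)"
  shows "P = Q"
proof
  fix x
  have "norm (P x - Q (P x)) = 0"
    using projection_pythagoras[OF Q, of "P x"] eq[of "P x"] projection_idem[OF P] by simp
  moreover have "Q (x - P x) = 0" 
    using eq[of "x - P x"] by (simp add: hermitian_diff[OF projection_hermitian[OF P]] projection_idem[OF P])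
  ultimately show "P x = Q x" by (simp add: hermitian_diff[OF projection_hermitian[OF Q]])
qed

lemma projection_onto_orthogonal:
  assumes M: "complex_vector.subspace (M::'a::complex_hilbert set)" "closed M"
  shows "orthogonal_projection (projection_onto M)"
proof -
  let ?P = "projection_onto M"
  note p = projection_onto[OF M]
  have add: "?P (x + y) = ?P x + ?P y" for x y
  proof (rule projection_unique[OF M(1)])
    show "?P x + ?P y \<in> M" by (intro complex_vector.subspace_add M p)
    have "(x - ?P x) + (y - ?P y) \<in> orthocomplement M"
      by (intro complex_vector.subspace_add csubspace_orthocomplement p)
    then show "x + y - (?P x + ?P y) \<in> orthocomplement M" by (simp add: algebra_simps)
  qed
  have sc: "?P (a *\<^sub>C x) = a *\<^sub>C ?P x" for a x
  proof (rule projection_unique[OF M(1)])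
    show "a *\<^sub>C ?P x \<in> M" by (intro complex_vector.subspace_scale M p)
    show "a *\<^sub>C x - a *\<^sub>C ?P x \<in> orthocomplement M"
      unfolding scaleC_diff_right[symmetric] by (intro complex_vector.subspace_scale csubspace_orthocomplement p)
  qed
  have idem: "?P (?P x) = ?P x" for x
    by (rule projection_unique[OF M(1)]) (use p complex_vector.subspace_0[OF csubspace_orthocomplement] in auto)
  have "cinner (?P x) y = cinner x (?P y)" for x y
  proof -
    have "cinner (x - ?P x) (?P y) = 0" "cinner (y - ?P y) (?P x) = 0"
      using p by (auto simp: orthocomplement_def)
    then have "cinner x (?P y) = cinner (?P x) (?P y)" "cinner (?P x) y = cinner (?P x) (?P y)"
      by (simp_all add: cinner_simps) (metis cinner_commute)
    then show ?thesis by simp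
  qed
  then show ?thesis using add sc idem by (auto simp: orthogonal_projection_def clinear_map_def)
qed

lemma projection_onto_fixed:
  assumes M: "complex_vector.subspace (M::'a::complex_hilbert set)" "closed M"
  shows "projection_onto M x = x \<longleftrightarrow> x \<in> M" "projection_onto M x = 0 \<longleftrightarrow> x \<in> orthocomplement M"
proof -
  show "projection_onto M x = x \<longleftrightarrow> x \<in> M"
    using projection_onto(1)[OF M, of x] projection_unique[OF M(1), of x x]
      complex_vector.subspace_0[OF csubspace_orthocomplement] by auto
  show "projection_onto M x = 0 \<longleftrightarrow> x \<in> orthocomplement M"
    using projection_onto(2)[OF M, of x] projection_unique[OF M(1), of 0 x]
      complex_vector.subspace_0[OF M(1)] by auto
qed

lemma projection_onto_commute:
  assumes M: "complex_vector.subspace (M::'a::complex_hilbert set)" "closed M"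
    and S: "hermitian S" and inv: "\<And>x. x \<in> M \<Longrightarrow> S x \<in> M"
  shows "projection_onto M (S x) = S (projection_onto M x)"
proof (rule projection_unique[OF M(1)])
  show "S (projection_onto M x) \<in> M" by (intro inv projection_onto M)
  have "cinner (S (x - projection_onto M x)) y = 0" if "y \<in> M" for y
    using projection_onto(2)[OF M, of x] inv[OF that] unfolding hermitian_cinner[OF S] orthocomplement_def by blast
  then show "S x - S (projection_onto M x) \<in> orthocomplement M"
    by (simp add: orthocomplement_def hermitian_diff[OF S])
qed

lemma csubspace_kernel: 
  assumes "clinear_map T" shows "complex_vector.subspace {x. T x = (0::'a::complex_hilbert)}"
proof -
  have "T (0 *\<^sub>C 0) = 0 *\<^sub>C T 0" using assms unfolding clinear_map_def by blast
  then have "T 0 = 0" by simp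
  then show ?thesis using assms by (simp add: clinear_map_def complex_vector.subspace_def)
qed


section \<open>Spectral subspaces of a bounded selfadjoint operator\<close>

definition shifted :: "('a::complex_hilbert \<Rightarrow> 'a) \<Rightarrow> real \<Rightarrow> 'a \<Rightarrow> 'a" where
  "shifted T r x = T x - r *\<^sub>R x"

definition modulus :: "('a::complex_hilbert \<Rightarrow> 'a) \<Rightarrow> 'a \<Rightarrow> 'a" where
  "modulus C = psqrt (\<lambda>x. C (C x))"

text \<open>The subspace on which \<open>\<bar>T - r\<bar> = T - r\<close>, that is, the range of the spectral projection of \<open>T\<close>
  for \<open>[r, \<infinity>)\<close>.\<close>

definition upper_subspace :: "('a::complex_hilbert \<Rightarrow> 'a) \<Rightarrow> real \<Rightarrow> 'a set" where
  "upper_subspace T r = {x. modulus (shifted T r) x = shifted T r x}"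

lemma hermitian_shifted: "hermitian T \<Longrightarrow> hermitian (shifted T r)"
  unfolding shifted_def by (intro hermitian_diff_op hermitian_const)

lemma hermitian_square_positive: "hermitian C \<Longrightarrow> positive_op (\<lambda>x. C (C x))"
  unfolding positive_op_def
  by (intro conjI allI hermitian_comp[of C C] refl) (simp_all add: hermitian_inner[of C "C _"])

lemma
  assumes T: "hermitian T"
  shows modulus_positive: "positive_op (modulus (shifted T r))"
    and modulus_hermitian: "hermitian (modulus (shifted T r))"
    and modulus_square: "modulus (shifted T r) (modulus (shifted T r) x) = shifted T r (shifted T r x)"
    and modulus_commute: "bounded_linear S \<Longrightarrow> (\<And>x. S (T x) = T (S x)) \<Longrightarrow>
      S (modulus (shifted T r) x) = modulus (shifted T r) (S x)"
proof -
  note sq = hermitian_square_positive[OF hermitian_shifted[OF T, of r]]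
  show "positive_op (modulus (shifted T r))" unfolding modulus_def by (rule psqrt_positive[OF sq])
  then show "hermitian (modulus (shifted T r))" by (rule positive_hermitian)
  show "modulus (shifted T r) (modulus (shifted T r) x) = shifted T r (shifted T r x)"
    unfolding modulus_def by (rule psqrt_square[OF sq])
  assume S: "bounded_linear S" and com: "\<And>x. S (T x) = T (S x)"
  have "S (shifted T r x) = shifted T r (S x)" for x
    by (simp add: shifted_def com linear_diff linear_cmul bounded_linear.linear[OF S])
  then show "S (modulus (shifted T r) x) = modulus (shifted T r) (S x)"
    unfolding modulus_def by (intro psqrt_commute[OF sq S]) simp
qed

lemma
  assumes T: "hermitian T"
  shows upper_subspace_csubspace: "complex_vector.subspace (upper_subspace T r)"
    and upper_subspace_closed: "closed (upper_subspace T r)"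
    and upper_subspace_invariant: "hermitian S \<Longrightarrow> (\<And>x. S (T x) = T (S x)) \<Longrightarrow>
      x \<in> upper_subspace T r \<Longrightarrow> S x \<in> upper_subspace T r"
    and upper_subspace_ge: "x \<in> upper_subspace T r \<Longrightarrow> r * (norm x)\<^sup>2 \<le> inner (T x) x"
proof -
  let ?C = "shifted T r" and ?D = "modulus (shifted T r)"
  note hC = hermitian_shifted[OF T, of r] and hD = modulus_hermitian[OF T, of r]
  have eq: "upper_subspace T r = {x. ?D x - ?C x = 0}" by (simp add: upper_subspace_def)
  show "complex_vector.subspace (upper_subspace T r)"
    unfolding eq by (intro csubspace_kernel hermitian_clinear hermitian_diff_op hC hD)
  show "closed (upper_subspace T r)"
    unfolding upper_subspace_def
    by (intro closed_Collect_eq linear_continuous_on hermitian_bounded hC hD)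
  show "S x \<in> upper_subspace T r" if S: "hermitian S" and com: "\<And>x. S (T x) = T (S x)"
    and x: "x \<in> upper_subspace T r"
  proof -
    have "S (?C x) = ?C (S x)"
      by (simp add: shifted_def com hermitian_diff[OF S] hermitian_scaleR[OF S])
    moreover have "S (?D x) = ?D (S x)"
      by (rule modulus_commute[OF T hermitian_bounded[OF S] com])
    ultimately show ?thesis using x by (simp add: upper_subspace_def)
  qed
  show "r * (norm x)\<^sup>2 \<le> inner (T x) x" if "x \<in> upper_subspace T r"
  proof -
    have "0 \<le> inner (?C x) x"
      using that positive_inner[OF modulus_positive[OF T, of r], of x] by (simp add: upper_subspace_def)
    then show ?thesis by (simp add: shifted_def inner_simps power2_norm_eq_inner)
  qed
qed

text \<open>\<open>\<bar>T - r\<bar> + (T - r)\<close> maps into the upper subspace, since \<open>\<bar>T - r\<bar> - (T - r)\<close> annihilates its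
  range. It therefore vanishes on the orthogonal complement, where \<open>\<bar>T - r\<bar> = r - T\<close>.\<close>

lemma upper_subspace_orth_le:
  assumes T: "hermitian T" and x: "x \<in> orthocomplement (upper_subspace T r)"
  shows "inner (T x) x \<le> r * (norm x)\<^sup>2"
proof -
  let ?C = "shifted T r" and ?D = "modulus (shifted T r)"
  note hC = hermitian_shifted[OF T, of r] and hD = modulus_hermitian[OF T, of r]
  have TC: "T (?C x) = ?C (T x)" for x by (simp add: shifted_def hermitian_diff[OF T] hermitian_scaleR[OF T])
  then have CD: "?C (?D x) = ?D (?C x)" for x 
    by (intro modulus_commute[OF T hermitian_bounded[OF hC]]) simp
  have DT: "?D (T x) = T (?D x)" for x
    using modulus_commute[OF T hermitian_bounded[OF T], of r x] by simp
  define y where "y = ?D x + ?C x"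
  have "?D y = ?C y"
    by (simp add: y_def hermitian_add[OF hC] hermitian_add[OF hD] modulus_square[OF T] CD)
  then have yM: "y \<in> upper_subspace T r" by (simp add: upper_subspace_def)
  have "?D y \<in> upper_subspace T r" "?C y \<in> upper_subspace T r"
    using upper_subspace_invariant[OF T hD DT yM] upper_subspace_invariant[OF T hC TC[symmetric] yM] by auto
  then have "cinner x (?D y) = 0" "cinner x (?C y) = 0" using x by (auto simp: orthocomplement_def)
  then have "cinner y y = 0"
    unfolding cinner_add_left[of "?D x" "?C x" y, folded y_def]
    by (simp add: hermitian_cinner[OF hC, of x] hermitian_cinner[OF hD, of x])
  then have "?C x = - ?D x" by (simp add: cinner_self y_def eq_neg_iff_add_eq_0 add.commute)
  then have "inner (?C x) x \<le> 0" using positive_inner[OF modulus_positive[OF T, of r], of x] by simp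
  then show ?thesis by (simp add: shifted_def inner_simps power2_norm_eq_inner)
qed

text \<open>For \<open>x\<close> in \<open>M\<close> put \<open>z = \<bar>T - r\<bar> x - (T - r) x\<close>. Then \<open>\<bar>T - r\<bar> z = - (T - r) z\<close>, while
  \<open>z \<in> M\<close> forces \<open>\<langle>(T - r) z|z\<rangle> \<ge> 0\<close>; so both terms annihilate \<open>z\<close>, and \<open>z = 0\<close>.\<close>

lemma upper_subspace_maximal:
  assumes T: "hermitian T" and M: "complex_vector.subspace M"
    and inv: "\<And>S x. hermitian S \<Longrightarrow> (\<And>x. S (T x) = T (S x)) \<Longrightarrow> x \<in> M \<Longrightarrow> S x \<in> M"
    and ge: "\<And>x. x \<in> M \<Longrightarrow> r * (norm x)\<^sup>2 \<le> inner (T x) x"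
  shows "M \<subseteq> upper_subspace T r"
proof
  fix x assume x: "x \<in> M"
  let ?C = "shifted T r" and ?D = "modulus (shifted T r)"
  note hC = hermitian_shifted[OF T, of r] and hD = modulus_hermitian[OF T, of r]
  have TC: "?C (T x) = T (?C x)" for x by (simp add: shifted_def hermitian_diff[OF T] hermitian_scaleR[OF T])
  have CD: "?C (?D x) = ?D (?C x)" for x 
    by (intro modulus_commute[OF T hermitian_bounded[OF hC]] TC)
  have DT: "?D (T x) = T (?D x)" for x
    using modulus_commute[OF T hermitian_bounded[OF T], of r x] by simp
  define z where "z = ?D x - ?C x"
  have z: "z \<in> M" unfolding z_def
    by (rule complex_vector.subspace_diff[OF M inv[OF hD DT x] inv[OF hC TC x]])
  have neg: "?D z = - ?C z"
    by (simp add: z_def hermitian_diff[OF hC] hermitian_diff[OF hD] modulus_square[OF T] CD)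
  have "0 \<le> inner (?C z) z" using ge[OF z] by (simp add: shifted_def inner_simps power2_norm_eq_inner)
  then have "inner (?D z) z = 0"
    using neg positive_inner[OF modulus_positive[OF T, of r], of z] by simp
  then have "?D z = 0" by (rule positive_inner_eq_0[OF modulus_positive[OF T]])
  then have "inner (?D z - ?C z) x = 0" using neg by simp
  then have "inner z z = 0"
    unfolding inner_diff_left hermitian_inner[OF hD, of z] hermitian_inner[OF hC, of z]
      inner_diff_right[of z "?D x" "?C x", folded z_def] .
  then show "x \<in> upper_subspace T r" by (simp add: z_def upper_subspace_def)
qed

lemma upper_subspace_antimono:
  assumes T: "hermitian T" and "r \<le> s" shows "upper_subspace T s \<subseteq> upper_subspace T r"
proof (rule upper_subspace_maximal[OF T upper_subspace_csubspace[OF T]])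
  fix x assume "x \<in> upper_subspace T s"
  then show "r * (norm x)\<^sup>2 \<le> inner (T x) x"
    using upper_subspace_ge[OF T, of x s] mult_right_mono[OF assms(2), of "(norm x)\<^sup>2"] by simp
qed (rule upper_subspace_invariant[OF T])

text \<open>The intersection of the subspaces for all \<open>s < r\<close> satisfies the hypotheses of maximality for \<open>r\<close>.
  This becomes right continuity of the resolution of the identity of \<open>T\<^sup>-\<^sup>1\<close>.\<close>

lemma upper_subspace_left_continuous:
  assumes T: "hermitian T" and "a < r" and x: "\<And>s. a < s \<Longrightarrow> s < r \<Longrightarrow> x \<in> upper_subspace T s"
  shows "x \<in> upper_subspace T r"
proof -
  define M where "M = (\<Inter>s\<in>{a<..<r}. upper_subspace T s)"
  have "M \<subseteq> upper_subspace T r"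
  proof (rule upper_subspace_maximal[OF T])
    show "complex_vector.subspace M" unfolding M_def
      by (rule complex_vector.subspace_Inter) (use upper_subspace_csubspace[OF T] in auto)
    show "S x \<in> M" if "hermitian S" "\<And>x. S (T x) = T (S x)" "x \<in> M" for S x
      using upper_subspace_invariant[OF T that(1,2)] that(3) by (auto simp: M_def)
    show "r * (norm x)\<^sup>2 \<le> inner (T x) x" if "x \<in> M" for x
    proof (rule tendsto_upperbound)
      show "((\<lambda>s. s * (norm x)\<^sup>2) \<longlongrightarrow> r * (norm x)\<^sup>2) (at_left r)" by (intro tendsto_intros)
      show "\<forall>\<^sub>F s in at_left r. s * (norm x)\<^sup>2 \<le> inner (T x) x"
        using eventually_at_left_real[OF \<open>a < r\<close>]
        by eventually_elim (use that upper_subspace_ge[OF T] in \<open>auto simp: M_def\<close>)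
    qed simp
  qed
  then show ?thesis using x by (auto simp: M_def)
qed

section \<open>Limits of projections\<close>

lemma projection_nested_norm:
  assumes P: "orthogonal_projection P" and "P (Q x) = P x"
  shows "(norm (Q x - P x))\<^sup>2 = (norm (Q x))\<^sup>2 - (norm (P x))\<^sup>2"
  using projection_pythagoras[OF P, of "Q x"] assms(2) by simp

text \<open>By Pythagoras the squared distances are differences of the increasing bounded sequence
  \<open>\<parallel>u n\<parallel>\<^sup>2\<close>.\<close>

lemma nested_vectors_converge:
  assumes S: "\<And>n::nat. orthogonal_projection (S n)"
    and nested: "\<And>m n. m \<le> n \<Longrightarrow> S m (u n) = (u m :: 'a::complex_hilbert)"
    and bd: "\<And>n. (norm (u n))\<^sup>2 \<le> C"
  shows "convergent u"
  unfolding Cauchy_convergent_iff[symmetric]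
proof (rule metric_CauchyI)
  fix e :: real assume e: "0 < e"
  have d: "(norm (u n - u m))\<^sup>2 = (norm (u n))\<^sup>2 - (norm (u m))\<^sup>2" if "m \<le> n" for m n
    using projection_pythagoras[OF S[of m], of "u n"] nested[OF that] by simp
  have "(norm (u m))\<^sup>2 \<le> (norm (u n))\<^sup>2" if "m \<le> n" for m n
    using d[OF that] zero_le_power2[of "norm (u n - u m)"] by linarith
  then have inc: "incseq (\<lambda>n. (norm (u n))\<^sup>2)" unfolding incseq_def by blast
  obtain l where l: "(\<lambda>n. (norm (u n))\<^sup>2) \<longlonglongrightarrow> l" "\<forall>n. (norm (u n))\<^sup>2 \<le> l"
    using incseq_convergent[OF inc] bd by blast
  from LIMSEQ_D[OF l(1), of "e\<^sup>2"] e obtain N where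
    N: "\<And>n. n \<ge> N \<Longrightarrow> \<bar>(norm (u n))\<^sup>2 - l\<bar> < e\<^sup>2" by auto
  have *: "dist (u n) (u m) < e" if "N \<le> m" "m \<le> n" for m n
  proof -
    have "(norm (u n - u m))\<^sup>2 < e\<^sup>2"
      using N[OF that(1)] l(2)[rule_format, of n] d[OF that(2)] by linarith
    then show ?thesis using e by (simp add: dist_norm power2_less_imp_less)
  qed
  show "\<exists>N. \<forall>m\<ge>N. \<forall>n\<ge>N. dist (u m) (u n) < e"
    using * by (metis dist_commute nle_le)
qed

lemma increasing_projections_converge:
  assumes S: "\<And>n::nat. orthogonal_projection (S n)"
    and nested: "\<And>m n x. m \<le> n \<Longrightarrow> S m (S n x) = S m (x::'a::complex_hilbert)"
  obtains Q where "orthogonal_projection Q" "\<And>x. (\<lambda>n. S n x) \<longlonglongrightarrow> Q x" "\<And>n x. S n (Q x) = S n x"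
proof -
  have "convergent (\<lambda>n. S n x)" for x
    by (rule nested_vectors_converge[of S _ "(norm x)\<^sup>2", OF S nested])
      (assumption, rule power_mono[OF projection_norm_le[OF S] norm_ge_zero])
  then obtain Q where Q: "\<And>x. (\<lambda>n. S n x) \<longlonglongrightarrow> Q x" unfolding convergent_def by metis
  have nQ: "norm (Q x) \<le> 1 * norm x" for x
    by (rule LIMSEQ_le_const2[OF tendsto_norm[OF Q]]) (use projection_norm_le[OF S] in auto)
  have hQ: "hermitian Q" by (rule hermitian_limit[OF projection_hermitian[OF S] Q nQ])
  have SQ: "S n (Q x) = S n x" for n x
  proof (rule LIMSEQ_unique)
    show "(\<lambda>m. S n (S m x)) \<longlonglongrightarrow> S n (Q x)"
      by (rule bounded_linear.tendsto[OF hermitian_bounded[OF projection_hermitian[OF S]] Q])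
    show "(\<lambda>m. S n (S m x)) \<longlonglongrightarrow> S n x"
      by (rule tendsto_eventually) (use nested in \<open>auto simp: eventually_sequentially\<close>)
  qed
  have "Q (Q x) = Q x" for x
    by (rule LIMSEQ_unique[OF Q]) (simp add: SQ Q)
  then show ?thesis using that[of Q] hQ Q SQ orthogonal_projectionI by blast
qed

text \<open>The norm inequality at a vector of the range of \<open>P n\<close> leaves no room for the other \<open>P m\<close>.\<close>

lemma projections_orthogonal:
  assumes P: "\<And>n::nat. orthogonal_projection (P n)"
    and le: "\<And>x N. (\<Sum>n<N. (norm (P n x))\<^sup>2) \<le> (norm (x::'a::complex_hilbert))\<^sup>2"
    and ne: "m \<noteq> n"
  shows "P m (P n x) = 0"
proof -
  let ?y = "P n x"
  have "(\<Sum>k\<in>{m,n}. (norm (P k ?y))\<^sup>2) \<le> (\<Sum>k<Suc (max m n). (norm (P k ?y))\<^sup>2)"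
    by (rule sum_mono2) auto
  also have "\<dots> \<le> (norm ?y)\<^sup>2" by (rule le)
  finally show ?thesis using ne by (simp add: projection_idem[OF P])
qed

text \<open>The partial sums are increasing projections because their summands are orthogonal to each other.\<close>

lemma orthogonal_projections_sum:
  assumes P: "\<And>n::nat. orthogonal_projection (P n)"
    and le: "\<And>x N. (\<Sum>n<N. (norm (P n x))\<^sup>2) \<le> (norm (x::'a::complex_hilbert))\<^sup>2"
  obtains Q where "orthogonal_projection Q" "\<And>x. (\<lambda>n. P n x) sums Q x"
    "\<And>x. (\<lambda>n. (norm (P n x))\<^sup>2) sums (norm (Q x))\<^sup>2"
proof -
  define S where "S N x = (\<Sum>n<N. P n x)" for N x
  note hP = projection_hermitian[OF P]
  have hS: "hermitian (S N)" for N
    by (induction N) (auto simp: S_def hermitian_zero_op intro!: hermitian_add_op hP)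
  have PS: "P m (S N x) = (if m < N then P m x else 0)" for m N x
  proof -
    have "P m (S N x) = (\<Sum>n<N. P m (P n x))"
      unfolding S_def by (rule linear_sum) (rule bounded_linear.linear[OF hermitian_bounded[OF hP]])
    also have "\<dots> = (\<Sum>n<N. if n = m then P m x else 0)"
      by (rule sum.cong) (auto simp: projections_orthogonal[OF P le] projection_idem[OF P])
    finally show ?thesis by simp
  qed
  have nested: "S m (S n x) = S m x" if "m \<le> n" for m n x
    using that unfolding S_def[of m] PS by (intro sum.cong) auto
  have pS: "orthogonal_projection (S N)" for N
    by (rule orthogonal_projectionI[OF hS nested]) simp
  obtain Q where Q: "orthogonal_projection Q" "\<And>x. (\<lambda>n. S n x) \<longlonglongrightarrow> Q x" "\<And>n x. S n (Q x) = S n x"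
    using increasing_projections_converge[of S, OF pS nested] by blast
  have "(norm (S N x))\<^sup>2 = (\<Sum>n<N. (norm (P n x))\<^sup>2)" for N x
    using projection_form[OF pS, of N x] by (simp add: S_def inner_sum_left projection_form[OF P])
  then have "(\<lambda>n. (norm (P n x))\<^sup>2) sums (norm (Q x))\<^sup>2" for x
    using tendsto_power[OF tendsto_norm[OF Q(2)[of x]], of 2] by (simp add: sums_def)
  then show ?thesis using that[of Q] Q by (simp add: S_def sums_def)
qed

section \<open>From a resolution of the identity to a projection-valued measure\<close>

text \<open>An increasing, right continuous family of projections, as of \<open>1\<^bsub>(-\<infinity>, t]\<^esub>(A)\<close>. Only operators
  bounded from below occur, so the family is required to vanish at and below some \<open>bottom\<close>.\<close>

locale resolution_of_identity =
  fixes E :: "real \<Rightarrow> 'a::complex_hilbert \<Rightarrow> 'a" and bottom :: real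
  assumes proj: "orthogonal_projection (E t)"
    and nested: "s \<le> t \<Longrightarrow> E t (E s x) = E s x"
    and right_cont: "(\<And>t. s < t \<Longrightarrow> E t x = x) \<Longrightarrow> E s x = x"
    and below: "t \<le> bottom \<Longrightarrow> E t x = 0"
    and top: "(\<And>t. E t x = 0) \<Longrightarrow> x = 0"
begin

lemmas herm = projection_hermitian[OF proj] and idem = projection_idem[OF proj]

lemma nested': "s \<le> t \<Longrightarrow> E s (E t x) = E s x"
  by (rule cinner_eqI) (simp only: hermitian_cinner[OF herm] nested)

definition mass :: "'a \<Rightarrow> real \<Rightarrow> real" where
  "mass x t = (norm (E t x))\<^sup>2"

lemma mass_mono: "s \<le> t \<Longrightarrow> mass x s \<le> mass x t"
  using projection_nested_norm[of "E s" "E t" x, OF proj nested'] zero_le_power2[of "norm (E t x - E s x)"]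
  unfolding mass_def by linarith

lemma mass_right_cont: "continuous (at_right a) (mass x)"
  unfolding continuous_within
proof (rule tendsto_at_right_sequentially[of a "a + 1"])
  fix S :: "nat \<Rightarrow> real" assume S: "\<And>n. a < S n" "decseq S" "S \<longlonglongrightarrow> a"
  obtain Q where Q: "\<And>x. (\<lambda>n. x - E (S n) x) \<longlonglongrightarrow> Q x"
  proof (rule increasing_projections_converge[of "\<lambda>n x. x - E (S n) x"])
    show "orthogonal_projection (\<lambda>x. x - E (S n) x)" for n by (rule projection_complement[OF proj])
    show "x - E (S n) x - E (S m) (x - E (S n) x) = x - E (S m) x" if "m \<le> n" for m n x
      using nested[OF decseqD[OF S(2) that]] by (simp add: hermitian_diff[OF herm])
  qed auto
  define y where "y = x - Q x"
  have lim: "(\<lambda>n. E (S n) x) \<longlonglongrightarrow> y"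
    using tendsto_diff[OF tendsto_const[of x] Q[of x]] by (simp add: y_def)
  have "E t y = y" if "a < t" for t
  proof (rule LIMSEQ_unique[OF _ lim])
    have "(\<lambda>n. E t (E (S n) x)) \<longlonglongrightarrow> E t y"
      by (rule bounded_linear.tendsto[OF hermitian_bounded[OF herm] lim])
    moreover have "\<forall>\<^sub>F n in sequentially. E t (E (S n) x) = E (S n) x"
      using order_tendstoD(2)[OF S(3) that] by eventually_elim (simp add: nested)
    ultimately show "(\<lambda>n. E (S n) x) \<longlonglongrightarrow> E t y" by (rule Lim_transform_eventually)
  qed
  then have "E a y = y" by (rule right_cont)
  moreover have "E a y = E a x"
  proof (rule LIMSEQ_unique)
    show "(\<lambda>n. E a (E (S n) x)) \<longlonglongrightarrow> E a y"
      by (rule bounded_linear.tendsto[OF hermitian_bounded[OF herm] lim])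
    show "(\<lambda>n. E a (E (S n) x)) \<longlonglongrightarrow> E a x"
      using S(1) by (simp add: nested' less_imp_le)
  qed
  ultimately show "(\<lambda>n. mass x (S n)) \<longlonglongrightarrow> mass x a"
    unfolding mass_def by (intro tendsto_intros) (use lim in simp)
qed simp

lemma limit_top: "(\<lambda>n. E (b + real n) x) \<longlonglongrightarrow> x"
proof -
  obtain Q where Q: "\<And>x. (\<lambda>n. E (b + real n) x) \<longlonglongrightarrow> Q x" "\<And>n x. E (b + real n) (Q x) = E (b + real n) x"
    by (rule increasing_projections_converge[of "\<lambda>n. E (b + real n)", OF proj nested'])
      (simp, rule that)
  have "E t (x - Q x) = 0" for t
  proof -
    obtain n :: nat where "t - b \<le> n" using real_arch_simple by blast
    then have "t \<le> b + n" by simp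
    then have "E t (x - Q x) = E t (E (b + n) (x - Q x))" by (simp add: nested')
    then show ?thesis by (simp add: hermitian_diff[OF herm] Q hermitian_zero[OF herm])
  qed
  then have "x - Q x = 0" by (rule top)
  then show ?thesis using Q(1)[of x] by simp
qed

lemma mass_at_top: "(mass x \<longlongrightarrow> (norm x)\<^sup>2) at_top"
proof (rule increasing_tendsto)
  show "\<forall>\<^sub>F t in at_top. mass x t \<le> (norm x)\<^sup>2"
    by (simp add: mass_def power_mono projection_norm_le[OF proj])
  fix c assume "c < (norm x)\<^sup>2"
  moreover have "(\<lambda>n. mass x (real n)) \<longlonglongrightarrow> (norm x)\<^sup>2"
    unfolding mass_def using tendsto_power[OF tendsto_norm[OF limit_top[of 0 x]], of 2] by simp
  ultimately obtain n :: nat where "c < mass x n"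
    using order_tendstoD(1) eventually_happens by (metis trivial_limit_sequentially)
  then show "\<forall>\<^sub>F t in at_top. c < mass x t"
    unfolding eventually_at_top_linorder by (meson less_le_trans mass_mono)
qed

lemma mass_at_bot: "(mass x \<longlongrightarrow> 0) at_bot"
  by (rule tendsto_eventually) (auto simp: eventually_at_bot_linorder mass_def intro!: exI[of _ bottom] below)

abbreviation mu :: "'a \<Rightarrow> real measure" where "mu x \<equiv> interval_measure (mass x)"

lemma finite_mu: "finite_measure (mu x)"
  using finite_borel_measure_interval_measure[OF mass_mono mass_right_cont mass_at_bot mass_at_top]
  by (simp add: finite_borel_measure_def)

lemma mu_UNIV: "measure (mu x) UNIV = (norm x)\<^sup>2"
  using interval_measure_UNIV[OF mass_mono mass_right_cont mass_at_bot mass_at_top] by (simp add: measure_def)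

lemma mu_Iic: "measure (mu x) {..t} = mass x t"
  by (rule measure_interval_measure_Iic[OF mass_mono mass_right_cont mass_at_bot])

text \<open>The operator \<open>P\<close> is the value at \<open>B\<close> of the projection-valued measure under construction. It
  is determined by the Stieltjes measures of the functions \<open>mass x\<close>, since the numbers
  \<open>\<parallel>P x\<parallel>\<close> determine a projection.\<close>

definition represents :: "('a \<Rightarrow> 'a) \<Rightarrow> real set \<Rightarrow> bool" where
  "represents P B \<longleftrightarrow> orthogonal_projection P \<and> (\<forall>x. measure (mu x) B = (norm (P x))\<^sup>2)"

lemma represents_unique: "represents P B \<Longrightarrow> represents Q B \<Longrightarrow> P = Q"
  by (rule projection_eqI) (auto simp: represents_def)

text \<open>The projections of disjoint sets satisfy \<open>\<Sum> \<parallel>P n x\<parallel>\<^sup>2 \<le> \<parallel>x\<parallel>\<^sup>2\<close>, as the total mass of the measure of \<open>x\<close>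
  is \<open>\<parallel>x\<parallel>\<^sup>2\<close>; this makes them orthogonal and summable.\<close>

lemma represents_union:
  assumes A: "\<And>n::nat. represents (P n) (A n)" and d: "disjoint_family A" and s: "range A \<subseteq> sets borel"
  obtains Q where "represents Q (\<Union>n. A n)" "\<And>x. (\<lambda>n. P n x) sums Q x"
proof -
  have P: "orthogonal_projection (P n)" and m: "measure (mu x) (A n) = (norm (P n x))\<^sup>2" for n x
    using A by (auto simp: represents_def)
  have sums: "(\<lambda>n. measure (mu x) (A n)) sums measure (mu x) (\<Union>n. A n)" for x
  proof -
    interpret finite_measure "mu x" by (rule finite_mu)
    show ?thesis by (rule finite_measure_UNION) (use d s in auto)
  qed
  have le: "(\<Sum>n<N. (norm (P n x))\<^sup>2) \<le> (norm x)\<^sup>2" for N x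
  proof -
    interpret finite_measure "mu x" by (rule finite_mu)
    have "(\<Sum>n<N. measure (mu x) (A n)) \<le> (\<Sum>n. measure (mu x) (A n))"
      by (rule sum_le_suminf[OF sums_summable[OF sums]]) auto
    also have "\<dots> = measure (mu x) (\<Union>n. A n)" using sums by (simp add: sums_iff)
    also have "\<dots> \<le> measure (mu x) UNIV" using bounded_measure[of "\<Union>n. A n"] by simp
    finally show ?thesis by (simp add: m mu_UNIV)
  qed
  obtain Q where Q: "orthogonal_projection Q" "\<And>x. (\<lambda>n. P n x) sums Q x"
    "\<And>x. (\<lambda>n. (norm (P n x))\<^sup>2) sums (norm (Q x))\<^sup>2"
    by (rule orthogonal_projections_sum[OF P le]) (rule that)
  have "represents Q (\<Union>n. A n)"
    using Q(1,3) sums by (auto simp: represents_def m intro: sums_unique2)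
  then show ?thesis using that Q(2) by blast
qed

text \<open>The sets represented by a projection form a Dynkin system that contains the half-lines. No
  commutation has to be known for this: disjoint sets automatically have orthogonal projections.\<close>

lemma represents_exists:
  assumes "B \<in> sets borel" shows "\<exists>P. represents P B"
proof -
  let ?G = "range (\<lambda>t::real. {..t})"
  have "Int_stable ?G" by (auto simp: Int_stable_def)
  moreover have "?G \<subseteq> Pow UNIV" by simp
  moreover have "B \<in> sigma_sets UNIV ?G" using assms by (simp add: borel_eq_atMost)
  ultimately show ?thesis
  proof (induction rule: sigma_sets_induct_disjoint)
    case (basic A)
    then show ?case using proj mu_Iic by (auto simp: represents_def mass_def)
  next
    case empty
    show ?case
      by (rule exI[of _ "\<lambda>x. 0"]) (simp add: represents_def orthogonal_projectionI hermitian_zero_op)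
  next
    case (compl A)
    then obtain P where P: "represents P A" by blast
    have A: "A \<in> sets borel" using compl by (simp add: borel_eq_atMost)
    have "measure (mu x) (UNIV - A) = (norm (x - P x))\<^sup>2" for x
    proof -
      interpret finite_measure "mu x" by (rule finite_mu)
      have "measure (mu x) (UNIV - A) = measure (mu x) UNIV - measure (mu x) A"
        using finite_measure_compl[of A] A by simp
      then show ?thesis using P by (simp add: represents_def mu_UNIV projection_pythagoras)
    qed
    then show ?case using P projection_complement by (auto simp: represents_def)
  next
    case (union A)
    then obtain P where "\<And>n. represents (P n) (A n)" by metis
    moreover have "range A \<subseteq> sets borel" using union by (simp add: borel_eq_atMost)
    ultimately obtain Q where "represents Q (\<Union>n. A n)"
      using union(1) by (rule_tac represents_union)
    then show ?case by blast
  qed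
qed

theorem projection_valued_measure_exists:
  obtains F where "projection_valued_measure F" "\<And>t. F {..t} = E t"
proof -
  define F where "F B = (SOME P. represents P B)" for B
  have F: "represents (F B) B" if "B \<in> sets borel" for B
    unfolding F_def by (rule someI_ex[OF represents_exists[OF that]])
  have "represents id UNIV"
    using orthogonal_projectionI[OF hermitian_id] by (simp add: represents_def mu_UNIV id_def)
  then have "F UNIV = id" using represents_unique F[of UNIV] by simp
  moreover have "(\<lambda>n. F (B n) x) sums F (\<Union>n. B n) x"
    if B: "range B \<subseteq> sets borel" "disjoint_family B" for B :: "nat \<Rightarrow> real set" and x
  proof -
    obtain Q where Q: "represents Q (\<Union>n. B n)" "\<And>x. (\<lambda>n. F (B n) x) sums Q x"
      by (rule represents_union[of "\<lambda>n. F (B n)" B]) (use F B in auto)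
    have "(\<Union>n. B n) \<in> sets borel" using B(1) by blast
    then show ?thesis using Q represents_unique[OF Q(1) F] by simp
  qed
  ultimately have "projection_valued_measure F"
    using F by (auto simp: projection_valued_measure_def represents_def)
  moreover have "represents (E t) {..t}" for t using proj mu_Iic by (auto simp: represents_def mass_def)
  then have "F {..t} = E t" for t using F represents_unique by (metis atMost_borel)
  ultimately show ?thesis using that by blast
qed

end

section \<open>Calculus of projection-valued measures\<close>

locale projection_measure =
  fixes F :: "real set \<Rightarrow> 'a::complex_hilbert \<Rightarrow> 'a"
  assumes pvm: "projection_valued_measure F"
begin

lemma proj: "B \<in> sets borel \<Longrightarrow> orthogonal_projection (F B)"
  and UNIV: "F UNIV x = x"
  and sums: "range A \<subseteq> sets borel \<Longrightarrow> disjoint_family A \<Longrightarrow> (\<lambda>n::nat. F (A n) x) sums F (\<Union>n. A n) x"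
  using pvm by (auto simp: projection_valued_measure_def)

lemmas herm = projection_hermitian[OF proj] and idem = projection_idem[OF proj]

lemma empty: "F {} x = 0"
proof -
  have "(\<lambda>n::nat. F {} x) sums F (\<Union>n::nat. {}) x"
    by (rule sums) (auto simp: disjoint_family_on_def)
  then have "summable (\<lambda>n::nat. F {} x)" by (rule sums_summable)
  then show ?thesis using summable_const_iff by blast
qed

lemma additive:
  assumes "A \<in> sets borel" "B \<in> sets borel" "A \<inter> B = {}"
  shows "F (A \<union> B) x = F A x + F B x"
proof -
  have "(\<lambda>n. F (binaryset A B n) x) sums F (\<Union>n. binaryset A B n) x"
    by (rule sums) (use assms in \<open>auto simp: range_binaryset_eq disjoint_family_on_def binaryset_def\<close>)
  moreover have "(\<lambda>n. F (binaryset A B n) x) sums (F A x + F B x)"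
    using binaryset_sums[of "\<lambda>B. F B x" A B] by (simp add: empty)
  ultimately show ?thesis by (simp add: UN_binaryset_eq sums_unique2)
qed

lemma compl: "B \<in> sets borel \<Longrightarrow> F (- B) x = x - F B x"
  using additive[of B "- B" x] UNIV[of x] by (simp add: algebra_simps)

lemma orthogonal:
  assumes A: "A \<in> sets borel" and B: "B \<in> sets borel" and d: "A \<inter> B = {}"
  shows "F A (F B x) = 0"
proof -
  let ?y = "F B x"
  have "inner (F (A \<union> B) ?y) ?y = (norm (F A ?y))\<^sup>2 + (norm ?y)\<^sup>2"
    using A B unfolding additive[OF assms] inner_add_left
    by (simp add: projection_form proj idem power2_norm_eq_inner)
  moreover have "inner (F (A \<union> B) ?y) ?y \<le> (norm ?y)\<^sup>2"
    using A B by (simp add: projection_form proj power_mono projection_norm_le)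
  ultimately show ?thesis by simp
qed

lemma mult:
  assumes A: "A \<in> sets borel" and B: "B \<in> sets borel"
  shows "F A (F B x) = F (A \<inter> B) x"
proof -
  have "(A \<inter> B) \<union> (B - A) = B" by blast
  then have "F B x = F (A \<inter> B) x + F (B - A) x"
    using additive[of "A \<inter> B" "B - A" x] A B by auto
  moreover have "(A \<inter> B) \<union> (A - B) = A" by blast
  then have "F A (F (A \<inter> B) x) = F (A \<inter> B) (F (A \<inter> B) x) + F (A - B) (F (A \<inter> B) x)"
    using additive[of "A \<inter> B" "A - B" "F (A \<inter> B) x"] A B by auto
  moreover have "F (A - B) (F (A \<inter> B) x) = 0" "F A (F (B - A) x) = 0"
    using A B by (auto intro!: orthogonal)
  ultimately show ?thesis using A B by (simp add: hermitian_add[OF herm] idem)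
qed

lemma
  shows sets_scalar [simp, measurable_cong]: "sets (scalar_measure F x) = sets borel"
    and space_scalar [simp]: "space (scalar_measure F x) = UNIV"
    and emeasure_scalar: "B \<in> sets borel \<Longrightarrow> emeasure (scalar_measure F x) B = ennreal ((norm (F B x))\<^sup>2)"
proof -
  have sp: "sigma_algebra UNIV (sets (borel :: real measure))"
    using sets.sigma_algebra_axioms[of "borel :: real measure"] by simp
  show "sets (scalar_measure F x) = sets borel" "space (scalar_measure F x) = UNIV"
    unfolding scalar_measure_def by (simp_all add: sigma_algebra.sets_measure_of_eq[OF sp] space_measure_of_conv)
  have Re: "Re (cinner (F B x) x) = (norm (F B x))\<^sup>2" if "B \<in> sets borel" for B
    using projection_form[OF proj[OF that]] by (simp add: inner_eq_Re_cinner)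
  assume B: "B \<in> sets borel"
  have "emeasure (scalar_measure F x) B = ennreal (Re (cinner (F B x) x))"
    unfolding scalar_measure_def
  proof (rule emeasure_measure_of_sigma[OF sp _ _ B])
    show "positive (sets borel) (\<lambda>B. ennreal (Re (cinner (F B x) x)))"
      by (simp add: positive_def empty cinner.zero_left)
    show "countably_additive (sets borel) (\<lambda>B. ennreal (Re (cinner (F B x) x)))"
      unfolding countably_additive_def
    proof (intro allI impI)
      fix A :: "nat \<Rightarrow> real set" assume A: "range A \<subseteq> sets borel" "disjoint_family A" "(\<Union>n. A n) \<in> sets borel"
      have "(\<lambda>n. Re (cinner (F (A n) x) x)) sums Re (cinner (F (\<Union>n. A n) x) x)"
        by (intro sums_Re bounded_linear.sums[OF cinner.bounded_linear_left] sums A)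
      then show "(\<Sum>n. ennreal (Re (cinner (F (A n) x) x))) = ennreal (Re (cinner (F (\<Union>n. A n) x) x))"
        using A by (intro suminf_ennreal_eq) (auto simp: Re)
    qed
  qed
  then show "emeasure (scalar_measure F x) B = ennreal ((norm (F B x))\<^sup>2)" using Re[OF B] by simp
qed

lemma measure_scalar: "B \<in> sets borel \<Longrightarrow> measure (scalar_measure F x) B = (norm (F B x))\<^sup>2"
  by (simp add: measure_def emeasure_scalar)

lemma finite_scalar: "finite_measure (scalar_measure F x)"
  by (rule finite_measureI) (simp add: emeasure_scalar)

lemma AE_scalar:
  assumes "B \<in> sets borel" and "F B x = x" shows "AE t in scalar_measure F x. t \<in> B"
proof (rule AE_I[of _ _ "- B"])
  show "emeasure (scalar_measure F x) (- B) = 0"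
    using assms by (simp add: emeasure_scalar compl)
qed (use assms in auto)

text \<open>The projection onto the range of \<open>F B\<close> restricts the spectral measure of a vector to \<open>B\<close>; forms
  on spectral subspaces thereby become integrals over \<open>B\<close>.\<close>

lemma scalar_measure_range:
  assumes B: "B \<in> sets borel"
  shows "scalar_measure F (F B x) = density (scalar_measure F x) (indicator B)"
proof (rule measure_eqI)
  fix A assume A: "A \<in> sets (scalar_measure F (F B x))"
  have "emeasure (density (scalar_measure F x) (indicator B)) A = emeasure (scalar_measure F x) (B \<inter> A)"
    using A B by (subst emeasure_density) (auto simp: indicator_inter_arith[symmetric])
  then show "emeasure (scalar_measure F (F B x)) A = emeasure (density (scalar_measure F x) (indicator B)) A"
    using A B by (simp add: emeasure_scalar mult Int_commute)
qed simp

lemma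
  fixes f :: "real \<Rightarrow> real"
  assumes B: "B \<in> sets borel" and f: "f \<in> borel_measurable borel"
  shows integrable_range: "integrable (scalar_measure F (F B x)) f \<longleftrightarrow>
      integrable (scalar_measure F x) (\<lambda>t. indicator B t * f t)"
    and integral_range: "(\<integral>t. f t \<partial>scalar_measure F (F B x)) = (\<integral>t. indicator B t * f t \<partial>scalar_measure F x)"
proof -
  have eq: "scalar_measure F (F B x) = density (scalar_measure F x) (\<lambda>t. ennreal (indicator B t))"
    unfolding scalar_measure_range[OF B] by (simp add: ennreal_indicator)
  show "integrable (scalar_measure F (F B x)) f \<longleftrightarrow>
      integrable (scalar_measure F x) (\<lambda>t. indicator B t * f t)"
    unfolding eq using B f by (subst integrable_density) auto
  show "(\<integral>t. f t \<partial>scalar_measure F (F B x)) = (\<integral>t. indicator B t * f t \<partial>scalar_measure F x)"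
    unfolding eq using B f by (subst integral_density) auto
qed

end

section \<open>The spectral theorem for selfadjoint operators bounded from below\<close>

text \<open>Bisecting \<open>(p, q]\<close> improves the bound on the defect \<open>G - \<integral> f dM\<close> by a factor of two at every
  step.\<close>

lemma additive_interval_function_eq_integral:
  fixes f :: "real \<Rightarrow> real" and G :: "real \<Rightarrow> real \<Rightarrow> real"
  assumes M: "finite_measure M" "sets M = sets borel"
    and f: "f \<in> borel_measurable borel"
    and add: "\<And>a b d. p \<le> a \<Longrightarrow> a \<le> b \<Longrightarrow> b \<le> d \<Longrightarrow> d \<le> q \<Longrightarrow> G a d = G a b + G b d"
    and lip: "\<And>a t. p \<le> a \<Longrightarrow> a \<le> t \<Longrightarrow> t \<le> q \<Longrightarrow> \<bar>f t - f a\<bar> \<le> K * (t - a)"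
    and G: "\<And>a b. p \<le> a \<Longrightarrow> a \<le> b \<Longrightarrow> b \<le> q \<Longrightarrow>
      \<bar>G a b - f a * measure M {a<..b}\<bar> \<le> K * (b - a) * measure M {a<..b}"
    and pq: "p \<le> q" and K: "0 \<le> K"
  shows "integrable M (\<lambda>t. indicator {p<..q} t * f t)"
    and "(\<integral>t. indicator {p<..q} t * f t \<partial>M) = G p q"
proof -
  interpret finite_measure M by (rule M(1))
  have [measurable_cong]: "sets M = sets borel" by (rule M(2))
  have [measurable]: "f \<in> borel_measurable M" using f by (simp cong: measurable_cong_sets)
  have int: "integrable M (\<lambda>t. indicator {a<..b} t * f t)" if "p \<le> a" "b \<le> q" for a b
  proof (rule integrable_const_bound[of _ "\<bar>f p\<bar> + K * (q - p)"])
    have "\<bar>indicator {a<..b} t * f t\<bar> \<le> \<bar>f p\<bar> + K * (q - p)" for t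
    proof (cases "t \<in> {a<..b}")
      case True
      then have "\<bar>f t - f p\<bar> \<le> K * (t - p)" using lip[of p t] that by auto
      also have "\<dots> \<le> K * (q - p)" using True that K by (intro mult_left_mono) auto
      finally show ?thesis using True by simp
    qed (use K pq in simp)
    then show "AE t in M. norm (indicator {a<..b} t * f t) \<le> \<bar>f p\<bar> + K * (q - p)" by simp
  qed measurable
  show "integrable M (\<lambda>t. indicator {p<..q} t * f t)" by (rule int) auto
  define I where "I a b = (\<integral>t. indicator {a<..b} t * f t \<partial>M)" for a b
  have Iadd: "I a d = I a b + I b d" if "p \<le> a" "a \<le> b" "b \<le> d" "d \<le> q" for a b d
  proof -
    have "I a b + I b d = (\<integral>t. indicator {a<..b} t * f t + indicator {b<..d} t * f t \<partial>M)"
      unfolding I_def using that by (intro Bochner_Integration.integral_add[symmetric] int) auto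
    also have "\<dots> = I a d" unfolding I_def
      by (rule Bochner_Integration.integral_cong) (use that in \<open>auto simp: indicator_def\<close>)
    finally show ?thesis ..
  qed
  have madd: "measure M {a<..d} = measure M {a<..b} + measure M {b<..d}" if "a \<le> b" "b \<le> d" for a b d
  proof -
    have "{a<..d} = {a<..b} \<union> {b<..d}" using that by auto
    then show ?thesis using finite_measure_Union[of "{a<..b}" "{b<..d}"] by auto
  qed
  have Ibd: "\<bar>I a b - f a * measure M {a<..b}\<bar> \<le> K * (b - a) * measure M {a<..b}"
    if "p \<le> a" "a \<le> b" "b \<le> q" for a b
  proof -
    have i1: "integrable M (\<lambda>t. indicator {a<..b} t * f a)" for a b by (simp add: emeasure_eq_measure)
    have "I a b - f a * measure M {a<..b} = (\<integral>t. indicator {a<..b} t * f t - indicator {a<..b} t * f a \<partial>M)"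
      unfolding I_def using that int i1 by (subst Bochner_Integration.integral_diff) auto
    also have "\<bar>\<dots>\<bar> \<le> (\<integral>t. indicator {a<..b} t * (K * (b - a)) \<partial>M)"
    proof (rule integral_abs_bound[THEN order_trans], rule integral_mono)
      show "integrable M (\<lambda>t. \<bar>indicator {a<..b} t * f t - indicator {a<..b} t * f a\<bar>)"
        using that int i1 by (intro integrable_abs Bochner_Integration.integrable_diff) auto
      show "integrable M (\<lambda>t. indicator {a<..b} t * (K * (b - a)))" by (simp add: emeasure_eq_measure)
      fix t
      show "\<bar>indicator {a<..b} t * f t - indicator {a<..b} t * f a\<bar> \<le> indicator {a<..b} t * (K * (b - a))"
      proof (cases "t \<in> {a<..b}")
        case True
        have "K * (t - a) \<le> K * (b - a)" using True K by (intro mult_left_mono) auto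
        then show ?thesis using lip[of a t] True that by auto
      qed simp
    qed
    also have "\<dots> = K * (b - a) * measure M {a<..b}" by simp
    finally show ?thesis .
  qed
  have main: "\<bar>G a b - I a b\<bar> \<le> 2 * K * (b - a) * measure M {a<..b} / 2 ^ n"
    if "p \<le> a" "a \<le> b" "b \<le> q" for a b and n :: nat
    using that
  proof (induction n arbitrary: a b)
    case 0
    then show ?case using G[OF 0] Ibd[OF 0] by simp
  next
    case (Suc n)
    define d where "d = (a + b) / 2"
    have d: "a \<le> d" "d \<le> b" using Suc.prems by (auto simp: d_def)
    have "\<bar>G a b - I a b\<bar> \<le> \<bar>G a d - I a d\<bar> + \<bar>G d b - I d b\<bar>"
      using add[of a d b] Iadd[of a d b] Suc.prems d by simp
    also have "\<dots> \<le> 2 * K * (d - a) * measure M {a<..d} / 2 ^ n + 2 * K * (b - d) * measure M {d<..b} / 2 ^ n"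
      using Suc.prems d by (intro add_mono Suc.IH) auto
    also have "\<dots> = 2 * K * (b - a) * (measure M {a<..d} + measure M {d<..b}) / 2 ^ Suc n"
      by (simp add: d_def field_simps)
    finally show ?case unfolding madd[OF d] .
  qed
  define m where "m = 2 * K * (q - p) * measure M {p<..q}"
  have "(\<lambda>n. m * (1/2) ^ n) \<longlonglongrightarrow> m * 0"
    by (intro tendsto_mult tendsto_const LIMSEQ_power_zero) simp
  moreover have "\<bar>G p q - I p q\<bar> \<le> m * (1/2) ^ n" for n
    using main[of p q n] pq by (simp add: m_def power_one_over)
  ultimately have "\<bar>G p q - I p q\<bar> \<le> m * 0"
    by (intro LIMSEQ_le_const) auto
  then show "(\<integral>t. indicator {p<..q} t * f t \<partial>M) = G p q" by (simp add: I_def)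
qed

text \<open>The operator \<open>T\<^sup>-\<^sup>1 - c\<close>, with domain the range of \<open>T\<close>.\<close>

definition shifted_inverse :: "('a::complex_hilbert \<Rightarrow> 'a) \<Rightarrow> real \<Rightarrow> 'a operator" where
  "shifted_inverse T c = {(T z, z - c *\<^sub>R T z) | z. True}"

locale inverse_of_positive =
  fixes T :: "'a::complex_hilbert \<Rightarrow> 'a" and c :: real
  assumes pos: "positive_op T" and inj: "T x = 0 \<Longrightarrow> x = 0"
begin

lemmas hT = positive_hermitian[OF pos]

definition theta :: real where
  "theta = (SOME th. 0 < th \<and> (\<forall>x. inner (T x) x \<le> th * (norm x)\<^sup>2))"

lemma theta: "0 < theta" "inner (T x) x \<le> theta * (norm x)\<^sup>2"
proof -
  have "\<exists>th. 0 < th \<and> (\<forall>x. inner (T x) x \<le> th * (norm x)\<^sup>2)"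
    using hermitian_inner_bound[OF hT] by (metis abs_le_iff)
  from someI_ex[OF this, folded theta_def] show "0 < theta" "inner (T x) x \<le> theta * (norm x)\<^sup>2" by auto
qed

text \<open>The factor \<open>2\<close> keeps \<open>1 / (t + c)\<close> strictly above the form bound \<open>theta\<close> of \<open>T\<close> for all
  \<open>t \<le> bottom\<close> with \<open>t + c > 0\<close>, so that the upper subspaces are trivial there.\<close>

definition bottom :: real where "bottom = 1 / (2 * theta) - c"

text \<open>The condition \<open>T\<^sup>-\<^sup>1 - c \<le> t\<close> on a vector amounts to \<open>T \<ge> 1 / (t + c)\<close>.\<close>

definition E :: "real \<Rightarrow> 'a \<Rightarrow> 'a" where
  "E t = (if 0 < t + c then projection_onto (upper_subspace T (1 / (t + c))) else (\<lambda>x. 0))"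

lemmas sub = upper_subspace_csubspace[OF hT] and cl = upper_subspace_closed[OF hT]

lemma bottom_pos: "bottom \<le> t \<Longrightarrow> 0 < t + c"
proof -
  assume "bottom \<le> t"
  moreover have "0 < 1 / (2 * theta)" using theta(1) by simp
  ultimately show ?thesis unfolding bottom_def by linarith
qed

lemma E_proj: "orthogonal_projection (E t)"
  using projection_onto_orthogonal[OF sub cl, of "1 / (t + c)"] orthogonal_projectionI[OF hermitian_zero_op refl]
  by (cases "0 < t + c") (simp_all add: E_def)

lemma E_below: "t \<le> bottom \<Longrightarrow> E t x = 0"
proof (cases "0 < t + c")
  case True
  assume t: "t \<le> bottom"
  let ?r = "1 / (t + c)"
  have "(t + c) * (2 * theta) \<le> 1" using t theta(1) by (simp add: bottom_def field_simps)
  then have "2 * theta \<le> ?r" using True by (simp add: field_simps)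
  then have r: "theta < ?r" using theta(1) by linarith
  have y: "E t x \<in> upper_subspace T ?r" using True projection_onto(1)[OF sub cl] by (simp add: E_def)
  have "(?r - theta) * (norm (E t x))\<^sup>2 \<le> 0"
    using upper_subspace_ge[OF hT y] theta(2)[of "E t x"] by (simp add: algebra_simps)
  then show ?thesis using r by (simp add: mult_le_0_iff)
qed (simp add: E_def)

lemma E_fixed: "0 < t + c \<Longrightarrow> E t x = x \<longleftrightarrow> x \<in> upper_subspace T (1 / (t + c))"
  and E_zero: "0 < t + c \<Longrightarrow> E t x = 0 \<longleftrightarrow> x \<in> orthocomplement (upper_subspace T (1 / (t + c)))"
  by (simp_all add: E_def projection_onto_fixed[OF sub cl])

lemma E_commute: "T (E t x) = E t (T x)"
  using projection_onto_commute[OF sub cl hT upper_subspace_invariant[OF hT hT refl]]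
  by (simp add: E_def hermitian_zero[OF hT])

sublocale res: resolution_of_identity E bottom
proof
  show "orthogonal_projection (E t)" for t by (rule E_proj)
  show "t \<le> bottom \<Longrightarrow> E t x = 0" for t x by (rule E_below)
  show "E t (E s x) = E s x" if "s \<le> t" for s t x
  proof (cases "0 < s + c")
    case True
    then have t: "0 < t + c" using that by simp
    have "1 / (t + c) \<le> 1 / (s + c)" using True that by (intro divide_left_mono) auto
    from upper_subspace_antimono[OF hT this] True show ?thesis
      unfolding E_fixed[OF t] using projection_onto(1)[OF sub cl] by (auto simp: E_def)
  next
    case False
    then show ?thesis using hermitian_zero[OF projection_hermitian[OF E_proj]] by (simp add: E_def[of s])
  qed
  show "E s x = x" if *: "\<And>t. s < t \<Longrightarrow> E t x = x" for s x
  proof (cases "0 < s + c")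
    case True
    have "x \<in> upper_subspace T (1 / (s + c))"
    proof (rule upper_subspace_left_continuous[OF hT])
      show "0 < 1 / (s + c)" using True by simp
      fix r assume r: "0 < r" "r < 1 / (s + c)"
      define t where "t = 1 / r - c"
      have "s < t" using r True by (simp add: t_def field_simps)
      then show "x \<in> upper_subspace T r" using *[of t] E_fixed[of t x] r by (simp add: t_def)
    qed
    then show ?thesis using E_fixed[OF True] by simp
  next
    case False
    then have "s < bottom" using bottom_pos[of s] by (meson not_le)
    then have "x = 0" using *[of bottom] E_below[of bottom x] by simp
    then show ?thesis using hermitian_zero[OF projection_hermitian[OF E_proj]] by simp
  qed
  show "x = 0" if *: "\<And>t. E t x = 0" for x
  proof -
    have "inner (T x) x \<le> r * (norm x)\<^sup>2" if "0 < r" for r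
      using *[of "1/r - c"] E_zero[of "1/r - c" x] upper_subspace_orth_le[OF hT] that by simp
    then have "inner (T x) x \<le> 0"
      by (intro tendsto_lowerbound[of "\<lambda>r. r * (norm x)\<^sup>2" _ "at_right (0::real)"])
        (auto simp: eventually_at_right_less intro!: tendsto_eq_intros eventually_at_rightI[of 0 1])
    then have "inner (T x) x = 0" using positive_inner[OF pos, of x] by simp
    then have "T x = 0" by (rule positive_inner_eq_0[OF pos])
    then show ?thesis by (rule inj)
  qed
qed

text \<open>On the range of \<open>P = E b - E a\<close> the operator \<open>T\<close> lies between \<open>1 / (b + c)\<close> and
  \<open>1 / (a + c)\<close>; so it can be inverted there, and \<open>T\<^sup>-\<^sup>1 - c\<close> differs from \<open>a\<close> by at most \<open>b - a\<close>.\<close>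

lemma inverse_on_interval:
  assumes ab: "bottom \<le> a" "a \<le> b" and y: "E b y = y" "E a y = 0"
  obtains z where "T z = y" "E b z = z" "norm (z - (a + c) *\<^sub>R y) \<le> (b - a) * norm y"
proof -
  define M where "M = upper_subspace T (1 / (b + c)) \<inter> orthocomplement (upper_subspace T (1 / (a + c)))"
  define s where "s = a + c"
  define u where "u = b + c"
  have su: "0 < s" "s \<le> u" using bottom_pos[of a] ab by (auto simp: s_def u_def)
  have M: "x \<in> M \<longleftrightarrow> E b x = x \<and> E a x = 0" for x
    using E_fixed[of b x] E_zero[of a x] su by (simp add: M_def s_def u_def)
  have subM: "complex_vector.subspace M"
    unfolding M_def by (intro complex_vector.subspace_inter sub csubspace_orthocomplement)
  have TM: "T x \<in> M" if "x \<in> M" for x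
    using that by (simp add: M flip: E_commute) (simp add: hermitian_zero[OF hT])
  have ge: "(1/u) * (norm x)\<^sup>2 \<le> inner (T x) x" and le: "inner (T x) x \<le> (1/s) * (norm x)\<^sup>2" if "x \<in> M" for x
    using that upper_subspace_ge[OF hT, of x "1 / (b + c)"] upper_subspace_orth_le[OF hT, of x "1 / (a + c)"]
    by (auto simp: M_def s_def u_def)
  define P where "P x = E b x - E a x" for x
  have hP: "hermitian P" unfolding P_def by (intro hermitian_diff_op res.herm)
  have PM: "P x \<in> M" for x
    using ab by (simp add: M P_def hermitian_diff[OF res.herm] res.nested res.nested' res.idem)
  have PP: "P x = x \<longleftrightarrow> x \<in> M" for x using PM[of x] by (auto simp: M P_def)
  have TP: "T (P x) = P (T x)" for x by (simp add: P_def hermitian_diff[OF hT] E_commute)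
  \<comment> \<open>This agrees with \<open>T\<close> on \<open>M\<close> and is coercive on the whole space.\<close>
  define B where "B x = T (P x) + (1/u) *\<^sub>R (x - P x)" for x
  have hB: "hermitian B" unfolding B_def
    by (rule hermitian_add_op[OF hermitian_comp[OF hT hP TP]
          hermitian_scaleR_op[OF hermitian_diff_op[OF hermitian_id hP]]])
  have co: "(1/u) * (norm x)\<^sup>2 \<le> inner (B x) x" for x
  proof -
    have oP: "orthogonal_projection P" using hP PM PP by (intro orthogonal_projectionI) auto
    have "inner (T (P x)) x = inner (T (P x)) (P x)"
      using hermitian_inner[OF hP, of "T (P x)" x] TP[of "P x"] projection_idem[OF oP] by simp
    moreover have "inner (x - P x) x = (norm x)\<^sup>2 - (norm (P x))\<^sup>2"
      using projection_form[OF oP, of x] by (simp add: inner_diff_left power2_norm_eq_inner)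
    ultimately have "inner (B x) x = inner (T (P x)) (P x) + (1/u) * ((norm x)\<^sup>2 - (norm (P x))\<^sup>2)"
      unfolding B_def inner_add_left inner_scaleR_left by (simp only:)
    then show ?thesis using ge[OF PM[of x]] by (simp add: right_diff_distrib)
  qed
  obtain R where R: "\<And>x. B (R x) = x"
    using coercive_invertible[OF hB _ co] su by (metis divide_pos_pos zero_less_one less_le_trans)
  define z where "z = R y"
  have "y \<in> M" using y by (simp add: M)
  have "T (P z) + (1/u) *\<^sub>R (z - P z) = y" using R[of y] by (simp only: B_def z_def)
  then have "(1/u) *\<^sub>R (z - P z) = y - T (P z)" by (metis add_diff_cancel_left')
  moreover have "z - P z = u *\<^sub>R ((1/u) *\<^sub>R (z - P z))" using su by simp
  ultimately have z: "z - P z = u *\<^sub>R (y - T (P z))" by simp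
  have "y - T (P z) \<in> M" by (intro complex_vector.subspace_diff[OF subM] \<open>y \<in> M\<close> TM PM)
  then have "z - P z \<in> M" unfolding z by (rule csubspace_scaleR[OF subM])
  then have zM: "z \<in> M" using complex_vector.subspace_add[OF subM _ PM[of z], of "z - P z"] by simp
  then have Pz: "P z = z" using PP by simp
  then have Tz: "T z = y" using R[of y] by (simp add: B_def z_def[symmetric])
  have "norm z * norm z \<le> u * (norm y * norm z)"
  proof -
    have "(1/u) * (norm z)\<^sup>2 \<le> norm y * norm z"
      using ge[OF zM] norm_cauchy_schwarz[of y z] Tz by simp
    then show ?thesis using su by (simp add: field_simps power2_eq_square)
  qed
  then have nz: "norm z \<le> u * norm y" using su by (cases "z = 0") auto
  define C where "C x = x - s *\<^sub>R T x" for x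
  have hC: "hermitian C" unfolding C_def by (rule hermitian_diff_op[OF hermitian_id hermitian_scaleR_op[OF hT]])
  have "norm (C z) \<le> (1 - s/u) * norm z"
  proof (rule positive_norm_bound(2)[OF hC subM _ _ _ _ zM])
    show "C x \<in> M" if "x \<in> M" for x
      unfolding C_def by (intro complex_vector.subspace_diff[OF subM] csubspace_scaleR[OF subM] TM that)
    show "0 \<le> inner (C x) x" if "x \<in> M" for x
      using le[OF that] su by (simp add: C_def inner_simps power2_norm_eq_inner field_simps)
    show "inner (C x) x \<le> (1 - s/u) * (norm x)\<^sup>2" if "x \<in> M" for x
      using mult_left_mono[OF ge[OF that], of s] su by (simp add: C_def inner_simps power2_norm_eq_inner algebra_simps)
  qed (use su in simp)
  also have "\<dots> \<le> (1 - s/u) * (u * norm y)" using su nz by (intro mult_left_mono) auto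
  also have "\<dots> = (b - a) * norm y" using su by (simp add: field_simps s_def u_def)
  finally show ?thesis using that[of z] Tz zM by (simp add: C_def s_def M)
qed

text \<open>With \<open>x\<^sub>n = E (L n) x\<close> and \<open>w n x = (T\<^sup>-\<^sup>1 - c) x\<^sub>n\<close>, the functions \<open>\<langle>F (a, b] w|F (a, b] x\<rangle>\<close> and
  \<open>\<parallel>F (a, b] w\<parallel>\<^sup>2\<close> of an interval are additive and close to \<open>a\<close> and \<open>a\<^sup>2\<close> times its measure, so they are
  the truncated first and second moments. Letting \<open>n\<close> grow, the second moments \<open>\<parallel>w n x\<parallel>\<^sup>2\<close> stay bounded
  exactly if \<open>w n x\<close> converges, that is, exactly if \<open>x\<close> is in the range of \<open>T\<close>.\<close>

theorem spectral_measure_exists: "\<exists>F. spectral_measure_of (shifted_inverse T c) F"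
proof -
  obtain F where F: "projection_valued_measure F" and FE: "\<And>t. F {..t} = E t"
    using res.projection_valued_measure_exists by blast
  interpret F: projection_measure F by standard (rule F)
  have Fab: "F {a<..b} x = E b x - E a x" if "a \<le> b" for a b x
  proof -
    have "{..a} \<union> {a<..b} = {..b}" "{..a} \<inter> {a<..b} = {}" using that by auto
    then have "F {..b} x = F {..a} x + F {a<..b} x" using F.additive[of "{..a}" "{a<..b}" x] by simp
    then show ?thesis by (simp add: FE)
  qed
  define L where "L n = bottom + real n" for n :: nat
  have L: "bottom \<le> L n" for n by (simp add: L_def)
  have Lmono: "m \<le> n \<Longrightarrow> L m \<le> L n" for m n by (simp add: L_def)
  have Flim: "(\<lambda>n. E (L n) x) \<longlonglongrightarrow> x" for x
    unfolding L_def by (rule res.limit_top)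
  have "\<exists>z. T z = E (L n) x \<and> E (L n) z = z" for n x
    using inverse_on_interval[OF order_refl L, of n "E (L n) x"] L
    by (metis E_below order_refl res.idem res.nested')
  then obtain z where z: "\<And>n x. T (z n x) = E (L n) x" "\<And>n x. E (L n) (z n x) = z n x" by metis
  define w where "w n x = z n x - c *\<^sub>R E (L n) x" for n x
  have w: "E (L n) (w n x) = w n x" for n x
    by (simp add: w_def hermitian_diff[OF res.herm] hermitian_scaleR[OF res.herm] res.idem z)
  have zT: "z n (T x) = E (L n) x" for n x
  proof -
    have "T (z n (T x) - E (L n) x) = 0" by (simp add: hermitian_diff[OF hT] z E_commute)
    then show ?thesis using inj by fastforce
  qed
  have loc: "norm (F {a<..b} (w n x) - a *\<^sub>R F {a<..b} (E (L n) x)) \<le> (b - a) * norm (F {a<..b} (E (L n) x))"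
    if ab: "bottom \<le> a" "a \<le> b" "b \<le> L n" for a b n x
  proof -
    let ?y = "F {a<..b} (E (L n) x)" and ?P = "F {a<..b}"
    have P: "?P = (\<lambda>x. E b x - E a x)" by (rule ext) (rule Fab[OF ab(2)])
    have y: "E b ?y = ?y" "E a ?y = 0"
      using ab by (simp_all add: P hermitian_diff[OF res.herm] res.nested res.nested' res.idem)
    obtain v where v: "T v = ?y" "norm (v - (a + c) *\<^sub>R ?y) \<le> (b - a) * norm ?y"
      using inverse_on_interval[OF ab(1,2) y] by metis
    have "T (?P (z n x)) = ?y" by (simp add: P hermitian_diff[OF hT] E_commute z)
    then have "T (?P (z n x) - v) = 0" by (simp add: hermitian_diff[OF hT] v)
    then have "v = ?P (z n x)" using inj by fastforce
    moreover have "?P (w n x) - a *\<^sub>R ?y = ?P (z n x) - (a + c) *\<^sub>R ?y"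
      by (simp add: w_def P hermitian_diff[OF res.herm] hermitian_scaleR[OF res.herm] algebra_simps)
    ultimately show ?thesis using v(2) by simp
  qed
  have FL: "F {bottom<..L n} x = E (L n) x" for n x
    using Fab[OF L] E_below[of bottom] by simp
  let ?m = "\<lambda>x. scalar_measure F x"
  have mE: "measure (?m (E (L n) x)) {a<..b} = (norm (F {a<..b} (E (L n) x)))\<^sup>2" for n x a b
    by (rule F.measure_scalar) simp
  have Fadd: "F {a<..d} x = F {a<..b} x + F {b<..d} x" if "a \<le> b" "b \<le> d" for a b d x
    using that Fab by simp
  have orth: "inner (F {a<..b} x) (F {b<..d} y) = 0" for a b d x y
  proof -
    have "inner (F {a<..b} x) (F {b<..d} y) = inner x (F {a<..b} (F {b<..d} y))"
      by (rule hermitian_inner[OF F.herm]) simp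
    also have "F {a<..b} (F {b<..d} y) = 0" by (rule F.orthogonal) auto
    finally show ?thesis by simp
  qed
  have first: "(\<integral>t. indicator {bottom<..L n} t * t \<partial>?m (E (L n) x)) = inner (w n x) (E (L n) x)"
    and second: "(\<integral>t. indicator {bottom<..L n} t * t\<^sup>2 \<partial>?m (E (L n) x)) = (norm (w n x))\<^sup>2" 
    and second_int: "integrable (?m (E (L n) x)) (\<lambda>t. indicator {bottom<..L n} t * t\<^sup>2)" for n x
  proof -
    let ?v = "E (L n) x" and ?w = "w n x"
    define K where "K = \<bar>bottom\<bar> + \<bar>L n\<bar>"
    have K: "\<bar>a\<bar> \<le> K" if "bottom \<le> a" "a \<le> L n" for a using that by (auto simp: K_def)
    have Fw: "F {bottom<..L n} ?w = ?w" "F {bottom<..L n} ?v = ?v" by (simp_all add: FL w res.idem)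
    let ?G1 = "\<lambda>a b. inner (F {a<..b} ?w) (F {a<..b} ?v)"
    have "(\<integral>t. indicator {bottom<..L n} t * t \<partial>?m ?v) = ?G1 bottom (L n)"
    proof (rule additive_interval_function_eq_integral(2)[where K = 1 and f = "\<lambda>t. t" and G = ?G1])
      fix a b assume ab: "bottom \<le> a" "a \<le> b" "b \<le> L n"
      let ?e = "F {a<..b} ?w - a *\<^sub>R F {a<..b} ?v"
      have "?G1 a b - a * measure (?m ?v) {a<..b} = inner ?e (F {a<..b} ?v)"
        by (simp add: mE inner_diff_left power2_norm_eq_inner)
      also have "\<bar>\<dots>\<bar> \<le> norm ?e * norm (F {a<..b} ?v)" by (rule Cauchy_Schwarz_ineq2)
      also have "\<dots> \<le> ((b - a) * norm (F {a<..b} ?v)) * norm (F {a<..b} ?v)"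
        by (rule mult_right_mono[OF loc[OF ab]]) simp
      finally show "\<bar>?G1 a b - a * measure (?m ?v) {a<..b}\<bar> \<le> 1 * (b - a) * measure (?m ?v) {a<..b}"
        by (simp add: mE power2_eq_square mult.assoc)
    next
      fix a b d assume "bottom \<le> a" "a \<le> b" "b \<le> d" "d \<le> L n"
      then show "?G1 a d = ?G1 a b + ?G1 b d"
        using orth[of a b ?w d ?v] orth[of a b ?v d ?w] by (simp add: Fadd[of a b d] inner_add_left inner_add_right inner_commute)
    qed (use F.finite_scalar L in auto)
    then show "(\<integral>t. indicator {bottom<..L n} t * t \<partial>?m ?v) = inner ?w ?v" unfolding Fw .
    let ?G2 = "\<lambda>a b. (norm (F {a<..b} ?w))\<^sup>2"
    have bound: "\<bar>?G2 a b - a\<^sup>2 * measure (?m ?v) {a<..b}\<bar> \<le> 4 * K * (b - a) * measure (?m ?v) {a<..b}"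
      if ab: "bottom \<le> a" "a \<le> b" "b \<le> L n" for a b
    proof -
      let ?e = "F {a<..b} ?w - a *\<^sub>R F {a<..b} ?v" and ?y = "F {a<..b} ?v"
      have ba: "b - a \<le> 2 * K" "\<bar>a\<bar> \<le> K" using K[of a] K[of b] ab by auto
      have "?G2 a b - a\<^sup>2 * (norm ?y)\<^sup>2 = 2 * a * inner ?e ?y + (norm ?e)\<^sup>2"
        unfolding power2_norm_eq_inner by (simp add: inner_simps inner_commute algebra_simps power2_eq_square)
      then have "\<bar>?G2 a b - a\<^sup>2 * (norm ?y)\<^sup>2\<bar> \<le> 2 * \<bar>a\<bar> * \<bar>inner ?e ?y\<bar> + (norm ?e)\<^sup>2"
        by (simp add: abs_mult flip: abs_mult) (metis abs_triangle_ineq abs_mult abs_power2 abs_numeral)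
      also have "\<dots> \<le> 2 * K * ((b - a) * (norm ?y)\<^sup>2) + 2 * K * ((b - a) * (norm ?y)\<^sup>2)"
      proof (rule add_mono)
        have "\<bar>inner ?e ?y\<bar> \<le> ((b - a) * norm ?y) * norm ?y"
          using Cauchy_Schwarz_ineq2[of ?e ?y] mult_right_mono[OF loc[OF ab, of x], of "norm ?y"] by simp
        then show "2 * \<bar>a\<bar> * \<bar>inner ?e ?y\<bar> \<le> 2 * K * ((b - a) * (norm ?y)\<^sup>2)"
          using ba by (intro mult_mono) (auto simp: power2_eq_square mult.assoc)
        have "(norm ?e)\<^sup>2 \<le> ((b - a) * norm ?y)\<^sup>2" by (rule power_mono[OF loc[OF ab]]) simp
        also have "\<dots> = (b - a) * ((b - a) * (norm ?y)\<^sup>2)" by (simp add: power2_eq_square)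
        also have "\<dots> \<le> 2 * K * ((b - a) * (norm ?y)\<^sup>2)" using ba ab by (intro mult_right_mono) auto
        finally show "(norm ?e)\<^sup>2 \<le> 2 * K * ((b - a) * (norm ?y)\<^sup>2)" .
      qed
      finally show ?thesis
        by (simp add: mE)
    qed
    have add: "?G2 a d = ?G2 a b + ?G2 b d" if "bottom \<le> a" "a \<le> b" "b \<le> d" "d \<le> L n" for a b d
    proof -
      show ?thesis
        using that orth[of a b ?w d ?w] unfolding power2_norm_eq_inner
        by (simp add: Fadd[of a b d] inner_add_left inner_add_right inner_commute)
    qed
    have lip: "\<bar>t\<^sup>2 - a\<^sup>2\<bar> \<le> 4 * K * (t - a)" if at: "bottom \<le> a" "a \<le> t" "t \<le> L n" for a t
    proof -
      have "t\<^sup>2 - a\<^sup>2 = (t + a) * (t - a)" by (simp add: power2_eq_square algebra_simps)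
      then have "\<bar>t\<^sup>2 - a\<^sup>2\<bar> = \<bar>t + a\<bar> * (t - a)" using at by (simp add: abs_mult)
      also have "\<dots> \<le> 4 * K * (t - a)" using K[of a] K[of t] at by (intro mult_right_mono) auto
      finally show ?thesis .
    qed
    have "0 \<le> 4 * K" by (simp add: K_def)
    note * = additive_interval_function_eq_integral[OF F.finite_scalar F.sets_scalar _ add lip bound L this]
    have "integrable (?m ?v) (\<lambda>t. indicator {bottom<..L n} t * t\<^sup>2) \<and>
        (\<integral>t. indicator {bottom<..L n} t * t\<^sup>2 \<partial>?m ?v) = ?G2 bottom (L n)"
      by (intro conjI *) auto
    then show "(\<integral>t. indicator {bottom<..L n} t * t\<^sup>2 \<partial>?m ?v) = (norm ?w)\<^sup>2"
      "integrable (?m ?v) (\<lambda>t. indicator {bottom<..L n} t * t\<^sup>2)"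
      unfolding Fw by blast+
  qed
  let ?I = "\<lambda>n. indicator {bottom<..L n} :: real \<Rightarrow> real"
  have ii: "?I n t * (?I n t * s) = ?I n t * s" for n t s by (simp add: indicator_def)
  have trunc: "(\<integral>t. ?I n t * t \<partial>?m x) = inner (w n x) (E (L n) x)"
    "(\<integral>t. ?I n t * t\<^sup>2 \<partial>?m x) = (norm (w n x))\<^sup>2" "integrable (?m x) (\<lambda>t. ?I n t * t\<^sup>2)" for n x
    using first[of n x] second[of n x] second_int[of n x]
      F.integral_range[of "{bottom<..L n}" "\<lambda>t. ?I n t * t" x]
      F.integral_range[of "{bottom<..L n}" "\<lambda>t. ?I n t * t\<^sup>2" x]
      F.integrable_range[of "{bottom<..L n}" "\<lambda>t. ?I n t * t\<^sup>2" x]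
    by (simp_all add: FL ii)
  have Ilim: "AE t in ?m x. (\<lambda>n. ?I n t * s t) \<longlonglongrightarrow> s t" for x and s :: "real \<Rightarrow> real"
  proof -
    have "F {bottom<..} x = x"
      using F.compl[of "{..bottom}" x] E_below[of bottom x] by (simp add: FE)
    then have "AE t in ?m x. t \<in> {bottom<..}" by (intro F.AE_scalar) auto
    then show ?thesis
    proof eventually_elim
      fix t :: real assume t: "t \<in> {bottom<..}"
      obtain N :: nat where "t - bottom \<le> N" using real_arch_simple by blast
      then have "\<forall>n\<ge>N. ?I n t * s t = s t" using t by (auto simp: L_def)
      then show "(\<lambda>n. ?I n t * s t) \<longlonglongrightarrow> s t"
        by (intro tendsto_eventually) (auto simp: eventually_sequentially)
    qed
  qed
  have dom1: "integrable (?m (T v)) (\<lambda>t. t\<^sup>2)" and form_value: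
    "cinner (v - c *\<^sub>R T v) (T v) = complex_of_real (\<integral>t. t \<partial>?m (T v))" for v
  proof -
    let ?x = "T v" and ?y = "v - c *\<^sub>R T v"
    have wy: "w n ?x = E (L n) ?y" for n
      by (simp add: w_def zT hermitian_diff[OF res.herm] hermitian_scaleR[OF res.herm])
    show i2: "integrable (?m ?x) (\<lambda>t. t\<^sup>2)"
    proof (rule integrable_monotone_convergence)
      show "integrable (?m ?x) (\<lambda>t. ?I n t * t\<^sup>2)" for n by (rule trunc)
      show "AE t in ?m ?x. mono (\<lambda>n. ?I n t * t\<^sup>2)"
        by (auto simp: mono_def indicator_def intro!: AE_I2 dest: Lmono)
      show "(\<lambda>n. \<integral>t. ?I n t * t\<^sup>2 \<partial>?m ?x) \<longlonglongrightarrow> (norm ?y)\<^sup>2"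
        unfolding trunc wy by (intro tendsto_intros Flim)
    qed (use Ilim in auto)
    interpret m: finite_measure "?m ?x" by (rule F.finite_scalar)
    have "(\<lambda>n. \<integral>t. ?I n t * t \<partial>?m ?x) \<longlonglongrightarrow> (\<integral>t. t \<partial>?m ?x)"
    proof (rule integral_dominated_convergence[where w = "\<lambda>t. 1 + t\<^sup>2"])
      show "integrable (?m ?x) (\<lambda>t. 1 + t\<^sup>2)" using i2 by simp
      have "\<bar>t\<bar> \<le> 1 + t\<^sup>2" for t :: real
        using zero_le_power2[of "\<bar>t\<bar> - 1"] by (simp add: power2_eq_square algebra_simps)
      then show "AE t in ?m ?x. norm (?I n t * t) \<le> 1 + t\<^sup>2" for n
        by (intro AE_I2) (auto simp: indicator_def add_nonneg_nonneg)
    qed (use Ilim[of "\<lambda>t. t"] in auto)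
    moreover have "(\<lambda>n. \<integral>t. ?I n t * t \<partial>?m ?x) \<longlonglongrightarrow> inner ?y ?x"
      unfolding trunc wy by (intro tendsto_intros Flim)
    ultimately have "inner ?y ?x = (\<integral>t. t \<partial>?m ?x)" by (rule LIMSEQ_unique[OF _ _, THEN sym])
    moreover have "cinner ?y ?x = complex_of_real (inner ?y ?x)"
    proof -
      have "hermitian (\<lambda>v. T v - c *\<^sub>R T (T v))"
        by (rule hermitian_diff_op[OF hT hermitian_scaleR_op[OF hermitian_comp[OF hT hT refl]]])
      moreover have "T ?y = T v - c *\<^sub>R T (T v)" by (simp add: hermitian_diff[OF hT] hermitian_scaleR[OF hT])
      ultimately have "cinner (T ?y) v = complex_of_real (inner (T ?y) v)"
        using hermitian_cinner_real[of _ v] by fastforce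
      then show ?thesis by (simp only: hermitian_cinner[OF hT] hermitian_inner[OF hT])
    qed
    ultimately show "cinner ?y ?x = complex_of_real (\<integral>t. t \<partial>?m ?x)" by simp
  qed
  have dom2: "\<exists>v. x = T v" if int: "integrable (?m x) (\<lambda>t. t\<^sup>2)" for x
  proof -
    have "convergent (\<lambda>n. w n x)"
    proof (rule nested_vectors_converge[of "\<lambda>n. E (L n)"])
      show "orthogonal_projection (E (L n))" for n by (rule E_proj)
      show "(norm (w n x))\<^sup>2 \<le> (\<integral>t. t\<^sup>2 \<partial>?m x)" for n
        unfolding trunc(2)[symmetric] by (rule integral_mono[OF trunc(3) int]) (simp add: indicator_def)
      show "E (L m) (w n x) = w m x" if "m \<le> n" for m n
      proof -
        have "T (E (L m) (z n x)) = E (L m) x"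
          by (simp add: E_commute z res.nested'[OF Lmono[OF that]])
        then have "T (E (L m) (z n x) - z m x) = 0" by (simp add: hermitian_diff[OF hT] z)
        then have "E (L m) (z n x) = z m x" using inj by fastforce
        then show ?thesis
          by (simp add: w_def hermitian_diff[OF res.herm] hermitian_scaleR[OF res.herm] res.nested'[OF Lmono[OF that]])
      qed
    qed
    then obtain y where y: "(\<lambda>n. w n x) \<longlonglongrightarrow> y" by (auto simp: convergent_def)
    have "(\<lambda>n. w n x + c *\<^sub>R E (L n) x) \<longlonglongrightarrow> y + c *\<^sub>R x" by (intro tendsto_intros y Flim)
    then have "(\<lambda>n. T (z n x)) \<longlonglongrightarrow> T (y + c *\<^sub>R x)"
      using bounded_linear.tendsto[OF hermitian_bounded[OF hT]] by (simp add: w_def)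
    then have "x = T (y + c *\<^sub>R x)" unfolding z using Flim LIMSEQ_unique by blast
    then show ?thesis ..
  qed
  have "Domain (shifted_inverse T c) = range T" by (auto simp: shifted_inverse_def)
  also have "\<dots> = {x. integrable (?m x) (\<lambda>t. t\<^sup>2)}"
  proof (intro subset_antisym subsetI CollectI)
    fix x assume "x \<in> range T"
    then show "integrable (?m x) (\<lambda>t. t\<^sup>2)" using dom1 by (elim rangeE) simp
  next
    fix x assume "x \<in> {x. integrable (?m x) (\<lambda>t. t\<^sup>2)}"
    then obtain v where "x = T v" using dom2 by blast
    then show "x \<in> range T" by simp
  qed
  finally have "Domain (shifted_inverse T c) = {x. integrable (?m x) (\<lambda>t. t\<^sup>2)}" .
  moreover have "\<forall>(x, y)\<in>shifted_inverse T c. cinner y x = complex_of_real (\<integral>t. t \<partial>?m x)"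
  proof (rule ballI, rule case_prodI2)
    fix p x y assume "p \<in> shifted_inverse T c" "p = (x, y)"
    then obtain v where "x = T v" "y = v - c *\<^sub>R T v" by (auto simp: shifted_inverse_def)
    then show "cinner y x = complex_of_real (\<integral>t. t \<partial>?m x)" using form_value[of v] by simp
  qed
  ultimately have "spectral_measure_of (shifted_inverse T c) F"
    using F unfolding spectral_measure_of_def by blast
  then show ?thesis by (intro exI)
qed

end

section \<open>Quadratic forms on spectral subspaces\<close>

text \<open>The defining property of \<open>spectral_projection\<close> is that of an arbitrary spectral measure; so the
  consequences are drawn for an arbitrary one.\<close>

locale spectral_operator = projection_measure F
  for F :: "real set \<Rightarrow> 'a::complex_hilbert \<Rightarrow> 'a" +
  fixes A :: "'a operator"
  assumes spec: "spectral_measure_of A F"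
begin

lemma Domain_iff_integrable: "x \<in> Domain A \<longleftrightarrow> integrable (scalar_measure F x) (\<lambda>t. t\<^sup>2)"
  using spec unfolding spectral_measure_of_def by blast

lemma form_eq_integral:
  assumes "(x, y) \<in> A"
  shows "inner y x = (\<integral>t. t \<partial>scalar_measure F x)" "integrable (scalar_measure F x) (\<lambda>t. t)"
proof -
  have "cinner y x = complex_of_real (\<integral>t. t \<partial>scalar_measure F x)"
    using spec assms by (auto simp: spectral_measure_of_def)
  then show "inner y x = (\<integral>t. t \<partial>scalar_measure F x)" by (simp add: inner_eq_Re_cinner)
  interpret finite_measure "scalar_measure F x" by (rule finite_scalar)
  have "integrable (scalar_measure F x) (\<lambda>t. t\<^sup>2)" using assms Domain_iff_integrable by blast
  then have i: "integrable (scalar_measure F x) (\<lambda>t. 1 + t\<^sup>2)" by simp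
  show "integrable (scalar_measure F x) (\<lambda>t. t)"
  proof (rule Bochner_Integration.integrable_bound[OF i])
    have "\<bar>t\<bar> \<le> \<bar>1 + t\<^sup>2\<bar>" for t :: real
      using zero_le_power2[of "\<bar>t\<bar> - 1"] by (simp add: power2_eq_square algebra_simps)
    then show "AE t in scalar_measure F x. norm t \<le> norm (1 + t\<^sup>2)" by simp
  qed simp
qed

lemma scalar_const: "(\<integral>t. l \<partial>scalar_measure F x) = l * (norm x)\<^sup>2"
  using measure_scalar[of UNIV x] by (simp add: UNIV)

lemma
  assumes B: "B \<in> sets borel" "F B x = x" and xy: "(x, y) \<in> A"
  shows form_le: "(\<And>t. t \<in> B \<Longrightarrow> t \<le> l) \<Longrightarrow> inner y x \<le> l * (norm x)\<^sup>2"
    and form_ge: "(\<And>t. t \<in> B \<Longrightarrow> l \<le> t) \<Longrightarrow> l * (norm x)\<^sup>2 \<le> inner y x"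
    and form_less: "(\<And>t. t \<in> B \<Longrightarrow> t < l) \<Longrightarrow> x \<noteq> 0 \<Longrightarrow> inner y x < l * (norm x)\<^sup>2"
    and form_greater: "(\<And>t. t \<in> B \<Longrightarrow> l < t) \<Longrightarrow> x \<noteq> 0 \<Longrightarrow> l * (norm x)\<^sup>2 < inner y x"
proof -
  interpret finite_measure "scalar_measure F x" by (rule finite_scalar)
  note i = form_eq_integral[OF xy] and ae = AE_scalar[OF B]
  have c: "integrable (scalar_measure F x) (\<lambda>t. l)" by simp
  have mass: "emeasure (scalar_measure F x) UNIV \<noteq> 0" if "x \<noteq> 0"
    using that by (simp add: emeasure_scalar UNIV)
  show "inner y x \<le> l * (norm x)\<^sup>2" if "\<And>t. t \<in> B \<Longrightarrow> t \<le> l"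
    unfolding i(1) scalar_const[symmetric]
    by (rule integral_mono_AE[OF i(2) c]) (use ae that in auto)
  show "l * (norm x)\<^sup>2 \<le> inner y x" if "\<And>t. t \<in> B \<Longrightarrow> l \<le> t"
    unfolding i(1) scalar_const[symmetric]
    by (rule integral_mono_AE[OF c i(2)]) (use ae that in auto)
  show "inner y x < l * (norm x)\<^sup>2" if "\<And>t. t \<in> B \<Longrightarrow> t < l" "x \<noteq> 0"
    unfolding i(1) scalar_const[symmetric]
  proof (rule integral_less_AE[OF i(2) c mass[OF that(2)]])
    show "AE t in scalar_measure F x. t \<in> UNIV \<longrightarrow> t \<noteq> l" using ae by eventually_elim (use that(1) in force)
    show "AE t in scalar_measure F x. t \<le> l" using ae by eventually_elim (use that(1) in force)
  qed simp
  show "l * (norm x)\<^sup>2 < inner y x" if "\<And>t. t \<in> B \<Longrightarrow> l < t" "x \<noteq> 0"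
    unfolding i(1) scalar_const[symmetric]
  proof (rule integral_less_AE[OF c i(2) mass[OF that(2)]])
    show "AE t in scalar_measure F x. t \<in> UNIV \<longrightarrow> l \<noteq> t" using ae by eventually_elim (use that(1) in force)
    show "AE t in scalar_measure F x. l \<le> t" using ae by eventually_elim (use that(1) in force)
  qed simp
qed

lemma bounded_range_Domain:
  assumes B: "B \<in> sets borel" "F B x = x" and bd: "\<And>t. t \<in> B \<Longrightarrow> \<bar>t\<bar> \<le> k"
  shows "x \<in> Domain A"
  unfolding Domain_iff_integrable
proof (rule finite_measure.integrable_const_bound[OF finite_scalar, of _ "k\<^sup>2"])
  show "AE t in scalar_measure F x. norm (t\<^sup>2) \<le> k\<^sup>2"
    using AE_scalar[OF B] by eventually_elim (use bd abs_le_square_iff in \<open>force simp: power2_le_iff_abs_le\<close>)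
qed simp

lemma range_Domain: 
  assumes "x \<in> Domain A" and B: "B \<in> sets borel" shows "F B x \<in> Domain A"
proof -
  have "integrable (scalar_measure F x) (\<lambda>t. indicator B t * t\<^sup>2)"
    using integrable_real_mult_indicator[of B "scalar_measure F x" "\<lambda>t. t\<^sup>2"] assms
    by (simp add: Domain_iff_integrable mult.commute)
  then show ?thesis unfolding Domain_iff_integrable by (subst integrable_range[OF B]) auto
qed

lemma form_split:
  assumes xy: "(x, y) \<in> A" and B: "B \<in> sets borel"
    and u: "(F B x, u) \<in> A" and w: "(x - F B x, w) \<in> A"
  shows "inner y x = inner u (F B x) + inner w (x - F B x)"
proof -
  have i: "integrable (scalar_measure F x) (\<lambda>t. indicator C t * t)" if "C \<in> sets borel" for C
    using integrable_real_mult_indicator[of C "scalar_measure F x" "\<lambda>t. t"] form_eq_integral(2)[OF xy] that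
    by (simp add: mult.commute)
  have w': "(F (- B) x, w) \<in> A" using w compl[OF B, of x] by simp
  have "inner u (F B x) + inner w (x - F B x) =
      (\<integral>t. indicator B t * t \<partial>scalar_measure F x) + (\<integral>t. indicator (- B) t * t \<partial>scalar_measure F x)"
    using form_eq_integral(1)[OF u] form_eq_integral(1)[OF w'] compl[OF B, of x]
      integral_range[of B "\<lambda>t. t" x] integral_range[of "- B" "\<lambda>t. t" x] B by simp
  also have "\<dots> = (\<integral>t. indicator B t * t + indicator (- B) t * t \<partial>scalar_measure F x)"
    by (rule Bochner_Integration.integral_add[symmetric]) (use B in \<open>auto intro: i\<close>)
  also have "\<dots> = (\<integral>t. t \<partial>scalar_measure F x)"
    by (rule Bochner_Integration.integral_cong) (auto simp: indicator_def)
  finally show ?thesis using form_eq_integral(1)[OF xy] by simp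
qed

lemma limit_atMost: "(\<lambda>n. F {..real n} x) \<longlonglongrightarrow> x"
proof -
  interpret finite_measure "scalar_measure F x" by (rule finite_scalar)
  have "(\<lambda>n. measure (scalar_measure F x) {real n<..}) \<longlonglongrightarrow> measure (scalar_measure F x) (\<Inter>n. {real n<..})"
    by (rule finite_Lim_measure_decseq) (auto simp: decseq_def)
  moreover have "(\<Inter>n. {real n<..}) = {}" using reals_Archimedean2 by (auto, meson less_asym)
  moreover have "measure (scalar_measure F x) {real n<..} = (norm (F {..real n} x - x))\<^sup>2" for n
    using compl[of "{..real n}" x] by (simp add: measure_scalar norm_minus_commute)
  ultimately have "(\<lambda>n. (norm (F {..real n} x - x))\<^sup>2) \<longlonglongrightarrow> 0" by simp
  then have "(\<lambda>n. norm (F {..real n} x - x)) \<longlonglongrightarrow> 0"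
    using tendsto_real_sqrt[of "\<lambda>n. (norm (F {..real n} x - x))\<^sup>2" 0] by simp
  then have "(\<lambda>n. F {..real n} x - x) \<longlonglongrightarrow> 0" by (rule tendsto_norm_zero_cancel)
  then show ?thesis by (rule LIM_zero_cancel)
qed

end

locale semibounded_spectral_operator = spectral_operator F A
  for F :: "real set \<Rightarrow> 'a::complex_hilbert \<Rightarrow> 'a" and A +
  fixes m :: real
  assumes symmetric: "(x, y) \<in> A \<Longrightarrow> (x', y') \<in> A \<Longrightarrow> inner y x' = inner x y'"
    and add: "(x, y) \<in> A \<Longrightarrow> (x', y') \<in> A \<Longrightarrow> (x + x', y + y') \<in> A"
    and single: "(x, y) \<in> A \<Longrightarrow> (x, y') \<in> A \<Longrightarrow> y = y'"
    and semibounded: "(x, y) \<in> A \<Longrightarrow> - m * (norm x)\<^sup>2 \<le> inner y x"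
begin

text \<open>Both pieces of \<open>x\<close> contribute their own integral to \<open>\<langle>A x|x\<rangle>\<close>, which leaves nothing for the two
  mixed terms; these are equal by symmetry.\<close>

lemma form_cross:
  assumes x: "x \<in> Domain A" and B: "B \<in> sets borel" and u: "(F B x, u) \<in> A"
  shows "inner u (x - F B x) = 0"
proof -
  obtain w where w: "(x - F B x, w) \<in> A"
    using range_Domain[OF x, of "- B"] B by (auto simp: compl)
  obtain y where y: "(x, y) \<in> A" using x by blast
  have "y = u + w" using single[OF y] add[OF u w] by simp
  moreover have "inner w (F B x) = inner u (x - F B x)"
    using symmetric[OF w u] by (simp add: inner_commute)
  ultimately have "inner y x = inner u (F B x) + inner w (x - F B x) + 2 * inner u (x - F B x)"
    by (simp add: inner_add_left inner_diff_right)
  then show ?thesis using form_split[OF y B u w] by simp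
qed

text \<open>On the bounded pieces \<open>[-k, -m)\<close> the form would be smaller than semiboundedness allows.\<close>

lemma below_zero: "F {..<- m} x = 0"
proof -
  have "F {- real k..<- m} x = 0" for k
  proof (rule ccontr)
    let ?B = "{- real k..<- m}"
    assume ne: "F ?B x \<noteq> 0"
    have fix_B: "F ?B (F ?B x) = F ?B x" by (rule idem) simp
    have "F ?B x \<in> Domain A"
      by (rule bounded_range_Domain[OF _ fix_B, of "real k + \<bar>m\<bar>"]) auto
    then obtain y where y: "(F ?B x, y) \<in> A" by blast
    have "inner y (F ?B x) < - m * (norm (F ?B x))\<^sup>2"
      by (rule form_less[OF _ fix_B y]) (use ne in auto)
    then show False using semibounded[OF y] by simp
  qed
  then have "{- real k..<- m} \<in> null_sets (scalar_measure F x)" for k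
    by (auto simp: null_sets_def emeasure_scalar)
  then have "(\<Union>k. {- real k..<- m}) \<in> null_sets (scalar_measure F x)" by (rule null_sets_UN)
  moreover have "(\<Union>k. {- real k..<- m}) = {..<- m}"
  proof -
    have "\<exists>k. - real k \<le> t" for t
    proof -
      obtain k where "- t \<le> real k" using real_arch_simple by blast
      then have "- real k \<le> t" by linarith
      then show ?thesis ..
    qed
    then show ?thesis by auto
  qed
  ultimately show ?thesis by (simp add: null_sets_def emeasure_scalar)
qed

lemma lower_range_Domain:
  assumes "F {..<l} x = x" shows "x \<in> Domain A"
proof -
  have "F ({..<- m} \<union> {- m..<l}) x = F {..<- m} x + F {- m..<l} x" by (rule additive) auto
  also have "F {..<- m} x = 0" by (rule below_zero)
  finally have eq: "F ({..<- m} \<union> {- m..<l}) x = F {- m..<l} x" by simp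
  have "({..<- m} \<union> {- m..<l}) \<inter> {..<l} = {..<l}" by auto
  then have "F {- m..<l} x = x"
    using mult[of "{..<- m} \<union> {- m..<l}" "{..<l}" x] eq assms by simp
  then show ?thesis by (rule bounded_range_Domain[of "{- m..<l}" x "\<bar>m\<bar> + \<bar>l\<bar>", rotated]) auto
qed

text \<open>A vector \<open>x\<close> of the form domain need not be in the domain of \<open>A\<close>. It is approximated by
  \<open>v = F {..n} x\<close>, for which \<open>q(v,x) = q(v,v) \<ge> 0\<close>; hence \<open>q(x,x) \<ge> q(x-v,x-v)\<close>, and semiboundedness
  of \<open>q\<close> is enough to pass to the limit.\<close>

lemma form_nonneg:
  fixes q :: "'a \<Rightarrow> 'a \<Rightarrow> real"
  assumes dom: "Domain A \<subseteq> D" and qA: "\<And>v u x. (v, u) \<in> A \<Longrightarrow> x \<in> D \<Longrightarrow> q v x = inner u x"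
    and q: "\<And>x v. x \<in> D \<Longrightarrow> v \<in> D \<Longrightarrow> q (x - v) (x - v) = q x x - 2 * q v x + q v v"
    and semi: "\<And>x v. x \<in> D \<Longrightarrow> v \<in> D \<Longrightarrow> - m * (norm (x - v))\<^sup>2 \<le> q (x - v) (x - v)"
    and x: "x \<in> D" "F {..<0} x = 0"
  shows "0 \<le> q x x"
proof -
  define v where "v n = F {..real n} x" for n
  have lim: "v \<longlonglongrightarrow> x" unfolding v_def by (rule limit_atMost)
  have v0: "F {0..} (v n) = v n" "F {0..real n} (v n) = v n" for n
  proof -
    have "F {0..} x = x" using compl[of "{..<0}" x] x(2) by simp
    moreover have "{0..} \<inter> {..real n} = {0..real n}" "{..real n} \<inter> {0..} = {0..real n}"
      "{0..} \<inter> {0..real n} = {0..real n}" by auto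
    ultimately have eq: "v n = F {0..real n} x" unfolding v_def
      using mult[of "{..real n}" "{0..}" x] by simp
    show "F {0..} (v n) = v n" "F {0..real n} (v n) = v n"
      unfolding eq using mult[of "{0..}" "{0..real n}" x] \<open>{0..} \<inter> {0..real n} = {0..real n}\<close> by (simp_all add: idem)
  qed
  have vD: "v n \<in> Domain A" for n
    by (rule bounded_range_Domain[OF _ v0(2), where k = "real n"]) auto
  then have "\<forall>n. \<exists>u. (v n, u) \<in> A" by blast
  then obtain u where u: "\<And>n. (v n, u n) \<in> A" by metis
  have cross: "inner (u n) (x - v n) = 0" for n
  proof (rule LIMSEQ_unique)
    show "(\<lambda>N. inner (u n) (v N - v n)) \<longlonglongrightarrow> inner (u n) (x - v n)" by (intro tendsto_intros lim)
    show "(\<lambda>N. inner (u n) (v N - v n)) \<longlonglongrightarrow> 0"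
    proof (rule tendsto_eventually, unfold eventually_sequentially, intro exI allI impI)
      fix N assume "n \<le> N"
      then have "{..real n} \<inter> {..real N} = {..real n}" by auto
      then have "F {..real n} (v N) = v n" using mult[of "{..real n}" "{..real N}" x] by (simp add: v_def)
      then show "inner (u n) (v N - v n) = 0"
        using form_cross[OF vD[of N], of "{..real n}" "u n"] u[of n] by simp
    qed
  qed
  have "- m * (norm (x - v n))\<^sup>2 \<le> q x x" for n
  proof -
    have "v n \<in> D" using dom vD by blast
    have "q (x - v n) (x - v n) = q x x - 2 * inner (u n) x + inner (u n) (v n)"
      using q[OF x(1) \<open>v n \<in> D\<close>] qA[OF u x(1)] qA[OF u \<open>v n \<in> D\<close>] by simp
    moreover have "inner (u n) x = inner (u n) (v n)" using cross[of n] by (simp add: inner_diff_right)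
    moreover have "0 * (norm (v n))\<^sup>2 \<le> inner (u n) (v n)"
      by (rule form_ge[OF _ v0(1) u]) auto
    ultimately show ?thesis using semi[OF x(1) \<open>v n \<in> D\<close>] by simp
  qed
  moreover have "(\<lambda>n. - m * (norm (x - v n))\<^sup>2) \<longlonglongrightarrow> - m * (norm (x - x))\<^sup>2"
    by (intro tendsto_intros lim)
  ultimately show ?thesis using LIMSEQ_le_const2[of "\<lambda>n. - m * (norm (x - v n))\<^sup>2" 0 "q x x"] by auto
qed

end

section \<open>Dimension counting\<close>

lemma cdimension_le_card:
  assumes "finite B" "V \<subseteq> complex_vector.span B"
  shows "cdimension (V::'a::complex_hilbert set) \<le> enat (card B)"
proof -
  have "\<exists>B. finite B \<and> V \<subseteq> complex_vector.span B" using assms by blast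
  then have "cdimension V = enat (complex_vector.dim V)" by (simp add: cdimension_def)
  then show ?thesis using complex_vector.dim_le_card[OF assms(2,1)] by simp
qed

lemma cdimension_basis:
  assumes "cdimension (V::'a::complex_hilbert set) \<noteq> \<infinity>"
  obtains B where "finite B" "B \<subseteq> V" "\<not> complex_vector.dependent B" "V \<subseteq> complex_vector.span B"
    "cdimension V = enat (card B)"
proof -
  obtain C where C: "finite C" "V \<subseteq> complex_vector.span C"
    using assms unfolding cdimension_def by (metis (no_types, lifting))
  obtain B where B: "B \<subseteq> V" "\<not> complex_vector.dependent B" "V \<subseteq> complex_vector.span B"
    "card B = complex_vector.dim V"
    by (rule complex_vector.basis_exists) (rule that)
  have "finite B" using complex_vector.independent_span_bound[OF C(1) B(2)] B(1) C(2) by blast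
  moreover have "cdimension V = enat (card B)" using C B(4) by (auto simp: cdimension_def)
  ultimately show ?thesis using that B by blast
qed

lemma card_independent_le:
  assumes "\<not> complex_vector.dependent B" "B \<subseteq> (V::'a::complex_hilbert set)"
  shows "finite B \<and> enat (card B) \<le> cdimension V \<or> cdimension V = \<infinity>"
proof (cases "cdimension V = \<infinity>")
  case False
  then obtain C where C: "finite C" "V \<subseteq> complex_vector.span C" "cdimension V = enat (card C)"
    by (rule cdimension_basis)
  then show ?thesis using complex_vector.independent_span_bound[OF C(1) assms(1)] assms(2) by auto
qed simp

text \<open>Preimages of a basis of the image, together with a basis of the kernel, span \<open>L\<close>.\<close>

theorem cdimension_rank_nullity:
  fixes f :: "'a::complex_hilbert \<Rightarrow> 'a"
  assumes L: "complex_vector.subspace L" and f: "f ` L \<subseteq> M"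
    and add: "\<And>x y. x \<in> L \<Longrightarrow> y \<in> L \<Longrightarrow> f (x + y) = f x + f y"
    and sc: "\<And>a x. x \<in> L \<Longrightarrow> f (a *\<^sub>C x) = a *\<^sub>C f x"
  shows "cdimension L \<le> cdimension {x \<in> L. f x = 0} + cdimension M"
proof (cases "cdimension {x \<in> L. f x = 0} = \<infinity> \<or> cdimension M = \<infinity>")
  case False
  then have "cdimension {x \<in> L. f x = 0} \<noteq> \<infinity>" by simp
  then obtain B where B: "finite B" "B \<subseteq> {x \<in> L. f x = 0}" "\<not> complex_vector.dependent B"
    "{x \<in> L. f x = 0} \<subseteq> complex_vector.span B" "cdimension {x \<in> L. f x = 0} = enat (card B)"
    by (rule cdimension_basis)
  obtain C where C: "C \<subseteq> f ` L" "\<not> complex_vector.dependent C" "f ` L \<subseteq> complex_vector.span C"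
    "card C = complex_vector.dim (f ` L)"
    by (rule complex_vector.basis_exists) (rule that)
  have fC: "finite C" "enat (card C) \<le> cdimension M"
    using card_independent_le[OF C(2), of M] C(1) f False by auto
  have "\<forall>c\<in>C. \<exists>y. y \<in> L \<and> f y = c" using C(1) by blast
  then obtain g where g: "\<And>c. c \<in> C \<Longrightarrow> g c \<in> L \<and> f (g c) = c" by (metis (no_types))
  have f0: "f 0 = 0" using sc[of 0 0] complex_vector.subspace_0[OF L] by simp
  have fsum: "(\<Sum>c\<in>S. a c *\<^sub>C g c) \<in> L \<and> f (\<Sum>c\<in>S. a c *\<^sub>C g c) = (\<Sum>c\<in>S. a c *\<^sub>C c)" if "S \<subseteq> C" for S a
    using finite_subset[OF that fC(1)] that
  proof (induction S)
    case (insert c S)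
    then have "a c *\<^sub>C g c \<in> L" using g complex_vector.subspace_scale[OF L] by auto
    then show ?case using insert g add sc complex_vector.subspace_add[OF L] by auto
  qed (simp add: f0 complex_vector.subspace_0[OF L])
  have "L \<subseteq> complex_vector.span (B \<union> g ` C)"
  proof
    fix x assume x: "x \<in> L"
    then obtain a where a: "f x = (\<Sum>c\<in>C. a c *\<^sub>C c)"
      using C(3) complex_vector.span_finite[OF fC(1)] by (force simp: image_iff)
    let ?s = "\<Sum>c\<in>C. a c *\<^sub>C g c"
    have s: "?s \<in> L" "f ?s = f x" using fsum[of C a] a by auto
    have d: "x - ?s \<in> L" by (rule complex_vector.subspace_diff[OF L x s(1)])
    have "f x = f (x - ?s) + f ?s" using add[OF d s(1)] by simp
    then have "x - ?s \<in> complex_vector.span B" using s d B(4) by auto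
    then have "x - ?s \<in> complex_vector.span (B \<union> g ` C)"
      using complex_vector.span_mono[of B "B \<union> g ` C"] by auto
    moreover have "?s \<in> complex_vector.span (B \<union> g ` C)"
      by (intro complex_vector.span_sum complex_vector.span_scale complex_vector.span_base) auto
    ultimately show "x \<in> complex_vector.span (B \<union> g ` C)"
      using complex_vector.span_add[of "x - ?s" _ ?s] by simp
  qed
  then have "cdimension L \<le> enat (card (B \<union> g ` C))" using B(1) fC(1) by (intro cdimension_le_card) auto
  also have "\<dots> \<le> enat (card B + card C)"
    using card_Un_le[of B "g ` C"] card_image_le[OF fC(1), of g] by simp
  also have "\<dots> \<le> cdimension {x \<in> L. f x = 0} + cdimension M"
    unfolding B(5) plus_enat_simps(1)[symmetric] by (rule add_left_mono[OF fC(2)])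
  finally show ?thesis .
qed auto

corollary cdimension_injective_le:
  fixes f :: "'a::complex_hilbert \<Rightarrow> 'a"
  assumes L: "complex_vector.subspace L" and f: "f ` L \<subseteq> M"
    and add: "\<And>x y. x \<in> L \<Longrightarrow> y \<in> L \<Longrightarrow> f (x + y) = f x + f y"
    and sc: "\<And>a x. x \<in> L \<Longrightarrow> f (a *\<^sub>C x) = a *\<^sub>C f x"
    and inj: "\<And>x. x \<in> L \<Longrightarrow> f x = 0 \<Longrightarrow> x = 0"
  shows "cdimension L \<le> cdimension M"
proof -
  have "cdimension {x \<in> L. f x = 0} \<le> enat (card ({} :: 'a set))"
    by (rule cdimension_le_card) (use inj in auto)
  then have "cdimension {x \<in> L. f x = 0} = 0" by (simp add: zero_enat_def[symmetric])
  then show ?thesis using cdimension_rank_nullity[OF L f add sc] by simp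
qed

section \<open>Compact positive operators and their singular values\<close>

text \<open>Compactness in terms of sequences, as it is used below and as it arises from form compactness.\<close>

definition compact_map :: "('a::complex_hilbert \<Rightarrow> 'a) \<Rightarrow> bool" where
  "compact_map T \<longleftrightarrow> (\<forall>u C. (\<forall>n::nat. norm (u n) \<le> C) \<longrightarrow>
     (\<exists>r l. strict_mono (r :: nat \<Rightarrow> nat) \<and> (\<lambda>n. T (u (r n))) \<longlonglongrightarrow> l))"

lemma compact_mapD:
  fixes u :: "nat \<Rightarrow> 'a::complex_hilbert"
  assumes "compact_map T" "\<And>n. norm (u n) \<le> C"
  obtains r l where "strict_mono (r :: nat \<Rightarrow> nat)" "(\<lambda>n. T (u (r n))) \<longlonglongrightarrow> l"
proof -
  have "\<exists>r l. strict_mono r \<and> (\<lambda>n. T (u (r n))) \<longlonglongrightarrow> l"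
    by (rule assms(1)[unfolded compact_map_def, rule_format, OF assms(2)])
  then show ?thesis using that by (elim exE conjE)
qed

lemma compact_operator_imp_compact_map:
  assumes "compact_operator T" shows "compact_map T"
  unfolding compact_map_def
proof (intro allI impI)
  fix u :: "nat \<Rightarrow> 'a" and C assume u: "\<forall>n. norm (u n) \<le> C"
  define D where "D = max C 1"
  have D: "D > 0" "\<And>n. norm (u n) \<le> D" using u by (auto simp: D_def le_max_iff_disj)
  have sc: "T (r *\<^sub>R x) = r *\<^sub>R T x" for r x
    using assms by (simp add: compact_operator_def clinear_map_def flip: scaleC_of_real)
  have mem: "\<forall>n. T ((1/D) *\<^sub>R u n) \<in> closure (T ` cball 0 1)"
  proof
    fix n
    have "(1/D) *\<^sub>R u n \<in> cball 0 1" using D by (simp add: field_simps)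
    then show "T ((1/D) *\<^sub>R u n) \<in> closure (T ` cball 0 1)" by (intro subsetD[OF closure_subset] imageI)
  qed
  have "seq_compact (closure (T ` cball 0 1))"
    by (rule compact_imp_seq_compact) (use assms in \<open>simp add: compact_operator_def\<close>)
  then obtain l r where "l \<in> closure (T ` cball 0 1)"
    and r: "strict_mono (r :: nat \<Rightarrow> nat)" "((\<lambda>n. T ((1/D) *\<^sub>R u n)) \<circ> r) \<longlonglongrightarrow> l"
    by (rule seq_compactE[OF _ mem]) (rule that)
  have "(\<lambda>n. D *\<^sub>R T ((1/D) *\<^sub>R u (r n))) \<longlonglongrightarrow> D *\<^sub>R l"
    using r(2) by (intro tendsto_intros) (simp add: o_def)
  then have "(\<lambda>n. T (u (r n))) \<longlonglongrightarrow> D *\<^sub>R l" using D(1) by (simp add: sc)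
  then show "\<exists>r l. strict_mono r \<and> (\<lambda>n. T (u (r n))) \<longlonglongrightarrow> l" using r(1) by blast
qed

lemma closed_orthocomplement: "closed (orthocomplement (S :: 'a::complex_hilbert set))"
proof -
  have "orthocomplement S = (\<Inter>y\<in>S. {x. cinner x y = 0})" by (auto simp: orthocomplement_def)
  moreover have "closed {x. cinner x y = 0}" for y :: 'a
    by (intro closed_Collect_eq linear_continuous_on cinner.bounded_linear_left continuous_on_const)
  ultimately show ?thesis by auto
qed

locale compact_positive =
  fixes K :: "'a::complex_hilbert \<Rightarrow> 'a"
  assumes pos: "positive_op K" and cpt: "compact_map K"
begin

lemmas hK = positive_hermitian[OF pos]

text \<open>A maximizing sequence for the form on the unit ball of \<open>M\<close> consists of approximate
  eigenvectors; compactness turns them into an eigenvector for the maximum.\<close>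

lemma maximal_eigenvector:
  assumes M: "complex_vector.subspace M" "closed M" and inv: "\<And>x. x \<in> M \<Longrightarrow> K x \<in> M"
  shows "\<exists>x l. x \<in> M \<and> 0 \<le> l \<and> K x = l *\<^sub>R x \<and> (\<forall>y\<in>M. inner (K y) y \<le> l * (norm y)\<^sup>2) \<and>
    (0 < l \<longrightarrow> norm x = 1)"
proof -
  define S where "S = {inner (K y) y | y. y \<in> M \<and> norm y \<le> 1}"
  obtain c where c: "c > 0" "\<And>x. \<bar>inner (K x) x\<bar> \<le> c * (norm x)\<^sup>2"
    using hermitian_inner_bound[OF hK] by metis
  have "s \<le> c" if s: "s \<in> S" for s
  proof -
    obtain y where y: "norm y \<le> 1" "s = inner (K y) y" using s unfolding S_def by blast
    have "c * (norm y)\<^sup>2 \<le> c * 1" using c(1) y(1) by (intro mult_left_mono) (auto simp: power_le_one)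
    then show ?thesis using c(2)[of y] y(2) by simp
  qed
  then have bdd: "bdd_above S" by (rule bdd_aboveI)
  have S0: "0 \<in> S" unfolding S_def using complex_vector.subspace_0[OF M(1)]
    by (intro CollectI exI[of _ 0]) (simp add: hermitian_zero[OF hK])
  define l where "l = Sup S"
  have l0: "0 \<le> l" unfolding l_def by (rule cSup_upper[OF S0 bdd])
  have le: "inner (K y) y \<le> l * (norm y)\<^sup>2" if y: "y \<in> M" for y
  proof (cases "y = 0")
    case False
    let ?z = "(1 / norm y) *\<^sub>R y"
    have "inner (K ?z) ?z \<in> S" unfolding S_def
      using y False by (intro CollectI exI[of _ ?z]) (simp add: csubspace_scaleR[OF M(1)])
    then have "inner (K ?z) ?z \<le> l" unfolding l_def by (rule cSup_upper[OF _ bdd])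
    then have "inner (K y) y / (norm y)\<^sup>2 \<le> l" by (simp add: hermitian_scaleR[OF hK] power2_eq_square)
    then show ?thesis using False by (simp add: field_simps)
  qed (simp add: hermitian_zero[OF hK])
  show ?thesis
  proof (cases "l = 0")
    case True
    then show ?thesis using le complex_vector.subspace_0[OF M(1)]
      by (intro exI[of _ 0] exI[of _ l]) (simp add: hermitian_zero[OF hK])
  next
    case False
    then have lp: "0 < l" using l0 by simp
    have "\<exists>y. y \<in> M \<and> norm y \<le> 1 \<and> l - 1 / Suc n < inner (K y) y" for n :: nat
    proof -
      have "l - 1 / Suc n < Sup S" by (simp add: l_def)
      then obtain s where s: "s \<in> S" "l - 1 / Suc n < s" using less_cSup_iff[OF _ bdd] S0 by blast
      then show ?thesis unfolding S_def by blast
    qed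
    then obtain u where u: "\<And>n. u n \<in> M" "\<And>n. norm (u n) \<le> 1" "\<And>n. l - 1 / Suc n < inner (K (u n)) (u n)"
      by metis
    have ul: "inner (K (u n)) (u n) \<le> l" for n
      using le[OF u(1)[of n]] mult_left_mono[of "(norm (u n))\<^sup>2" 1 l] u(2)[of n] l0 by (simp add: power_le_one)
    have lim: "(\<lambda>n. inner (K (u n)) (u n)) \<longlonglongrightarrow> l"
    proof (rule tendsto_sandwich[of "\<lambda>n. l - 1 / real (Suc n)" _ _ "\<lambda>_. l"])
      show "(\<lambda>n. l - 1 / real (Suc n)) \<longlonglongrightarrow> l"
        using tendsto_diff[OF tendsto_const[of l] LIMSEQ_Suc[OF lim_1_over_n]] by simp
      show "\<forall>\<^sub>F n in sequentially. l - 1 / real (Suc n) \<le> inner (K (u n)) (u n)"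
        using less_imp_le[OF u(3)] by (intro always_eventually allI)
      show "\<forall>\<^sub>F n in sequentially. inner (K (u n)) (u n) \<le> l" using ul by (intro always_eventually allI)
    qed (rule tendsto_const)
    have sq: "(norm (K (u n) - l *\<^sub>R u n))\<^sup>2 \<le> l * (l - inner (K (u n)) (u n))" for n
    proof -
      have "(norm (K (u n)))\<^sup>2 \<le> l * inner (K (u n)) (u n)"
        by (rule positive_norm_bound(1)[OF hK M(1) inv _ le l0 u(1)]) (use positive_inner[OF pos] in auto)
      moreover have "l * l * (norm (u n))\<^sup>2 \<le> l * l"
        using u(2)[of n] l0 mult_left_mono[of "(norm (u n))\<^sup>2" 1 "l * l"] by (simp add: power_le_one)
      moreover have "(norm (K (u n) - l *\<^sub>R u n))\<^sup>2 =
          (norm (K (u n)))\<^sup>2 - 2 * (l * inner (K (u n)) (u n)) + l * l * (norm (u n))\<^sup>2"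
        unfolding power2_norm_eq_inner by (simp add: inner_simps inner_commute algebra_simps)
      ultimately show ?thesis by (simp add: algebra_simps)
    qed
    have "(\<lambda>n. (norm (K (u n) - l *\<^sub>R u n))\<^sup>2) \<longlonglongrightarrow> 0"
    proof (rule tendsto_sandwich[of "\<lambda>_. 0" _ _ "\<lambda>n. l * (l - inner (K (u n)) (u n))"])
      show "(\<lambda>n. l * (l - inner (K (u n)) (u n))) \<longlonglongrightarrow> 0"
        using tendsto_mult[OF tendsto_const[of l] tendsto_diff[OF tendsto_const[of l] lim]] by simp
    qed (use sq in auto)
    then have dl: "(\<lambda>n. K (u n) - l *\<^sub>R u n) \<longlonglongrightarrow> 0"
      using tendsto_real_sqrt[of "\<lambda>n. (norm (K (u n) - l *\<^sub>R u n))\<^sup>2" 0] tendsto_norm_zero_cancel by auto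
    obtain r y where r: "strict_mono r" "(\<lambda>n. K (u (r n))) \<longlonglongrightarrow> y"
      by (rule compact_mapD[OF cpt u(2)]) (rule that)
    have "(\<lambda>n. K (u (r n)) - (K (u (r n)) - l *\<^sub>R u (r n))) \<longlonglongrightarrow> y - 0"
      by (intro tendsto_diff r(2)) (use LIMSEQ_subseq_LIMSEQ[OF dl r(1)] in \<open>simp add: o_def\<close>)
    then have "(\<lambda>n. (1/l) *\<^sub>R (l *\<^sub>R u (r n))) \<longlonglongrightarrow> (1/l) *\<^sub>R y" by (intro tendsto_intros) simp
    then have ux: "(\<lambda>n. u (r n)) \<longlonglongrightarrow> (1/l) *\<^sub>R y" using lp by simp
    define x where "x = (1/l) *\<^sub>R y"
    have ux: "(\<lambda>n. u (r n)) \<longlonglongrightarrow> x" using ux by (simp add: x_def)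
    have Kux: "(\<lambda>n. K (u (r n))) \<longlonglongrightarrow> K x"
      by (rule bounded_linear.tendsto[OF hermitian_bounded[OF hK] ux])
    have "K x = y" by (rule LIMSEQ_unique[OF Kux r(2)])
    then have Kx: "K x = l *\<^sub>R x" using lp by (simp add: x_def)
    have xM: "x \<in> M" using closed_sequentially[OF M(2) _ ux] u(1) by blast
    have "inner (K x) x = l"
    proof (rule LIMSEQ_unique)
      show "(\<lambda>n. inner (K (u (r n))) (u (r n))) \<longlonglongrightarrow> inner (K x) x" by (intro tendsto_inner Kux ux)
      show "(\<lambda>n. inner (K (u (r n))) (u (r n))) \<longlonglongrightarrow> l"
        using LIMSEQ_subseq_LIMSEQ[OF lim r(1)] by (simp add: o_def)
    qed
    then have "(norm x)\<^sup>2 = 1" using lp by (simp add: Kx power2_norm_eq_inner)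
    then have "norm x = 1" by (simp add: power2_eq_1_iff) (metis norm_ge_zero neg_0_le_iff_le not_one_le_zero)
    then show ?thesis using xM Kx le lp by (intro exI[of _ x] exI[of _ l]) auto
  qed
qed

definition pick :: "'a set \<Rightarrow> 'a \<times> real" where
  "pick M = (SOME p. fst p \<in> M \<and> 0 \<le> snd p \<and> K (fst p) = snd p *\<^sub>R fst p \<and>
    (\<forall>y\<in>M. inner (K y) y \<le> snd p * (norm y)\<^sup>2) \<and> (0 < snd p \<longrightarrow> norm (fst p) = 1))"

text \<open>Eigenvectors are split off one by one, always for the largest eigenvalue that remains. Once the
  positive eigenvalues are exhausted, \<open>lam j\<close> is \<open>0\<close>.\<close>

definition flag :: "nat \<Rightarrow> 'a set" where
  "flag = rec_nat UNIV (\<lambda>_ M. M \<inter> orthocomplement {fst (pick M)})"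

definition ev :: "nat \<Rightarrow> 'a" where "ev j = fst (pick (flag j))"
definition lam :: "nat \<Rightarrow> real" where "lam j = snd (pick (flag j))"

lemma flag_simps: "flag 0 = UNIV" "flag (Suc j) = flag j \<inter> orthocomplement {ev j}"
  by (simp_all add: flag_def ev_def)

lemma
  shows flag_csubspace: "complex_vector.subspace (flag j)" and flag_closed: "closed (flag j)"
    and flag_invariant: "x \<in> flag j \<Longrightarrow> K x \<in> flag j"
    and ev_flag: "ev j \<in> flag j" and lam_nonneg: "0 \<le> lam j" and K_ev: "K (ev j) = lam j *\<^sub>R ev j"
    and lam_max: "y \<in> flag j \<Longrightarrow> inner (K y) y \<le> lam j * (norm y)\<^sup>2"
    and norm_ev: "0 < lam j \<Longrightarrow> norm (ev j) = 1"
proof -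
  have main: "complex_vector.subspace (flag j) \<and> closed (flag j) \<and> (\<forall>x\<in>flag j. K x \<in> flag j)"
    and pick: "ev j \<in> flag j \<and> 0 \<le> lam j \<and> K (ev j) = lam j *\<^sub>R ev j \<and>
      (\<forall>y\<in>flag j. inner (K y) y \<le> lam j * (norm y)\<^sup>2) \<and> (0 < lam j \<longrightarrow> norm (ev j) = 1)" if "complex_vector.subspace (flag j) \<and> closed (flag j) \<and> (\<forall>x\<in>flag j. K x \<in> flag j)" for j
  proof -
    have "\<exists>x l. x \<in> flag j \<and> 0 \<le> l \<and> K x = l *\<^sub>R x \<and> (\<forall>y\<in>flag j. inner (K y) y \<le> l * (norm y)\<^sup>2) \<and>
        (0 < l \<longrightarrow> norm x = 1)"
      by (rule maximal_eigenvector) (use that in auto)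
    then obtain x l where "x \<in> flag j \<and> 0 \<le> l \<and> K x = l *\<^sub>R x \<and> (\<forall>y\<in>flag j. inner (K y) y \<le> l * (norm y)\<^sup>2) \<and>
        (0 < l \<longrightarrow> norm x = 1)"
      by (elim exE) (rule that)
    then have "\<exists>p. fst p \<in> flag j \<and> 0 \<le> snd p \<and> K (fst p) = snd p *\<^sub>R fst p \<and>
        (\<forall>y\<in>flag j. inner (K y) y \<le> snd p * (norm y)\<^sup>2) \<and> (0 < snd p \<longrightarrow> norm (fst p) = 1)" by (intro exI[of _ "(x, l)"]) simp
    then show "ev j \<in> flag j \<and> 0 \<le> lam j \<and> K (ev j) = lam j *\<^sub>R ev j \<and>
      (\<forall>y\<in>flag j. inner (K y) y \<le> lam j * (norm y)\<^sup>2) \<and> (0 < lam j \<longrightarrow> norm (ev j) = 1)"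
      unfolding ev_def lam_def pick_def by (rule someI_ex)
  qed (use that in auto)
  have main: "complex_vector.subspace (flag j) \<and> closed (flag j) \<and> (\<forall>x\<in>flag j. K x \<in> flag j)" for j
  proof (induction j)
    case (Suc j)
    then have "K (ev j) = lam j *\<^sub>R ev j" using pick by blast
    then have "cinner (K x) (ev j) = 0" if "cinner x (ev j) = 0" for x
      using that by (simp add: hermitian_cinner[OF hK] cinner_scaleR_right)
    then have inv: "K x \<in> orthocomplement {ev j}" if "x \<in> orthocomplement {ev j}" for x
      using that by (simp add: orthocomplement_def)
    show ?case unfolding flag_simps
    proof (intro conjI ballI)
      show "complex_vector.subspace (flag j \<inter> orthocomplement {ev j})"
        by (rule complex_vector.subspace_inter[OF _ csubspace_orthocomplement]) (use Suc in blast)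
      show "closed (flag j \<inter> orthocomplement {ev j})"
        by (rule closed_Int[OF _ closed_orthocomplement]) (use Suc in blast)
      show "K x \<in> flag j \<inter> orthocomplement {ev j}" if "x \<in> flag j \<inter> orthocomplement {ev j}" for x
        using that Suc inv by blast
    qed
  qed (simp add: flag_simps)
  show "complex_vector.subspace (flag j)" "closed (flag j)" "x \<in> flag j \<Longrightarrow> K x \<in> flag j" using main by blast+
  show "ev j \<in> flag j" "0 \<le> lam j" "K (ev j) = lam j *\<^sub>R ev j"
    "y \<in> flag j \<Longrightarrow> inner (K y) y \<le> lam j * (norm y)\<^sup>2" "0 < lam j \<Longrightarrow> norm (ev j) = 1"
    using pick[OF main] by blast+
qed

lemma flag_iff: "y \<in> flag J \<longleftrightarrow> (\<forall>i<J. cinner y (ev i) = 0)"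
  by (induction J) (auto simp: flag_simps orthocomplement_def less_Suc_eq)

lemma ev_orthogonal: "i \<noteq> j \<Longrightarrow> cinner (ev i) (ev j) = 0"
proof -
  have *: "cinner (ev j) (ev i) = 0" if "i < j" for i j
    using ev_flag[of j] that unfolding flag_iff by blast
  assume "i \<noteq> j"
  then consider "i < j" | "j < i" by linarith
  then show ?thesis
  proof cases
    case 1
    then show ?thesis using *[OF 1] cinner_commute[of "ev i" "ev j"] by simp
  qed (rule *)
qed

lemma lam_decseq: "decseq lam"
proof (rule decseq_SucI)
  fix j
  show "lam (Suc j) \<le> lam j"
  proof (cases "lam (Suc j) = 0")
    case False
    then have n: "norm (ev (Suc j)) = 1" using norm_ev[of "Suc j"] lam_nonneg[of "Suc j"] by simp
    have "ev (Suc j) \<in> flag j" using ev_flag[of "Suc j"] by (simp add: flag_simps)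
    from lam_max[OF this] show ?thesis using n by (simp add: K_ev power2_norm_eq_inner[symmetric])
  qed (simp add: lam_nonneg)
qed

text \<open>Otherwise the \<open>ev j\<close> are orthonormal and their images under \<open>K\<close> stay apart, so that no
  subsequence of the images converges.\<close>

lemma lam_small: 
  assumes "0 < e" shows "\<exists>j. lam j < e"
proof (rule ccontr)
  assume "\<not> ?thesis"
  then have ge: "e \<le> lam j" for j by (simp add: not_less)
  then have n: "norm (ev j) = 1" for j using norm_ev[of j] assms by (meson less_le_trans)
  obtain r l where r: "strict_mono r" "(\<lambda>n. K (ev (r n))) \<longlonglongrightarrow> l"
    by (rule compact_mapD[OF cpt, of ev 1]) (simp add: n, rule that)
  have "Cauchy (\<lambda>n. K (ev (r n)))" using r(2) by (intro LIMSEQ_imp_Cauchy)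
  from metric_CauchyD[OF this assms] obtain N where
    N: "\<And>m n. N \<le> m \<Longrightarrow> N \<le> n \<Longrightarrow> dist (K (ev (r m))) (K (ev (r n))) < e" by blast
  let ?i = "r N" and ?j = "r (Suc N)"
  have "?i \<noteq> ?j" using strict_monoD[OF r(1), of N "Suc N"] by simp
  then have "inner (ev ?i) (ev ?j) = 0" using ev_orthogonal by (simp add: inner_eq_Re_cinner)
  then have "inner (K (ev ?i)) (K (ev ?j)) = 0" by (simp add: K_ev)
  moreover have "(norm (a - b))\<^sup>2 = (norm a)\<^sup>2 + (norm b)\<^sup>2 - 2 * inner a b" for a b :: 'a
    by (simp add: power2_norm_eq_inner inner_simps inner_commute)
  ultimately have "(norm (K (ev ?i) - K (ev ?j)))\<^sup>2 = (lam ?i)\<^sup>2 + (lam ?j)\<^sup>2"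
    using n[of ?i] n[of ?j] by (simp add: K_ev)
  moreover have "e\<^sup>2 \<le> (lam ?i)\<^sup>2" using ge[of ?i] assms by (intro power_mono) auto
  ultimately have "e\<^sup>2 \<le> (norm (K (ev ?i) - K (ev ?j)))\<^sup>2" using zero_le_power2[of "lam ?j"] by linarith
  then have "e \<le> norm (K (ev ?i) - K (ev ?j))" by (rule power2_le_imp_le) simp
  moreover have "norm (K (ev ?i) - K (ev ?j)) < e" using N[of N "Suc N"] by (simp add: dist_norm)
  ultimately show False by linarith
qed

lemma finite_lam: 
  assumes "0 < e" shows "finite {j. e \<le> lam j}"
proof -
  obtain J where J: "lam J < e" using lam_small[OF assms] by blast
  have "j < J" if "e \<le> lam j" for j
  proof (rule ccontr)
    assume "\<not> j < J"
    then have "lam j \<le> lam J" using decseqD[OF lam_decseq, of J j] by simp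
    then show False using that J by linarith
  qed
  then have "{j. e \<le> lam j} \<subseteq> {..<J}" by blast
  then show ?thesis by (rule finite_subset) simp
qed

lemma eigenspace_iff: "x \<in> eigenspace (graph_of K) (complex_of_real e) \<longleftrightarrow> K x = e *\<^sub>R x"
  by (auto simp: eigenspace_def graph_of_iff scaleC_of_real)

text \<open>An eigenvector for \<open>e > 0\<close> orthogonal to the \<open>ev j\<close> with \<open>lam j = e\<close> is orthogonal to all
  of them, so it lies in every \<open>flag j\<close>, where the form is bounded by \<open>lam j \<rightarrow> 0\<close>.\<close>

lemma cdimension_eigenspace:
  assumes e: "0 < e"
  shows "finite {j. lam j = e}"
    and "cdimension (eigenspace (graph_of K) (complex_of_real e)) = enat (card {j. lam j = e})"
proof -
  let ?I = "{j. lam j = e}" and ?W = "eigenspace (graph_of K) (complex_of_real e)"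
  show fin: "finite ?I" using finite_subset[OF _ finite_lam[OF e], of ?I] by auto
  have n: "norm (ev i) = 1" if "i \<in> ?I" for i using norm_ev[of i] that e by auto
  have inj: "inj_on ev ?I"
  proof (rule inj_onI, rule ccontr)
    fix i j assume "i \<in> ?I" "j \<in> ?I" "ev i = ev j" "i \<noteq> j"
    then show False using ev_orthogonal[of i j] n[of i] by (simp add: cinner_self)
  qed
  have indep: "\<not> complex_vector.dependent (ev ` ?I)"
  proof (rule complex_vector.independent_if_scalars_zero)
    fix f x assume s: "(\<Sum>x\<in>ev ` ?I. f x *\<^sub>C x) = 0" and x: "x \<in> ev ` ?I"
    then obtain i where i: "i \<in> ?I" "x = ev i" by blast
    have "0 = cinner (\<Sum>j\<in>?I. f (ev j) *\<^sub>C ev j) x" using s inj by (simp add: sum.reindex cinner.zero_left)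
    also have "\<dots> = (\<Sum>j\<in>?I. f (ev j) * cinner (ev j) x)" by (simp add: cinner.sum_left cinner_scaleC_left)
    also have "\<dots> = (\<Sum>j\<in>?I. if j = i then f x else 0)"
      using n[OF i(1)] i(2) by (intro sum.cong) (auto simp: ev_orthogonal cinner_self)
    also have "\<dots> = f x" using fin i(1) by simp
    finally show "f x = 0" by simp
  qed (use fin in simp)
  have sub: "ev ` ?I \<subseteq> ?W" unfolding subset_iff eigenspace_iff by (auto simp: K_ev)
  have span: "?W \<subseteq> complex_vector.span (ev ` ?I)"
  proof
    fix y assume "y \<in> ?W"
    then have y: "K y = e *\<^sub>R y" by (simp add: eigenspace_iff)
    define s where "s = (\<Sum>i\<in>?I. cinner y (ev i) *\<^sub>C ev i)"
    define z where "z = y - s"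
    have Ks: "K s = e *\<^sub>R s"
    proof -
      have "K s = (\<Sum>i\<in>?I. K (cinner y (ev i) *\<^sub>C ev i))"
        unfolding s_def by (rule linear_sum[OF bounded_linear.linear[OF hermitian_bounded[OF hK]]])
      also have "\<dots> = (\<Sum>i\<in>?I. e *\<^sub>R (cinner y (ev i) *\<^sub>C ev i))"
        by (rule sum.cong) (auto simp: hermitian_scaleC[OF hK] K_ev scaleR_scaleC)
      finally show ?thesis by (simp add: s_def scaleR_sum_right)
    qed
    then have Kz: "K z = e *\<^sub>R z" by (simp add: z_def hermitian_diff[OF hK] y scaleR_diff_right)
    have orth: "cinner z (ev j) = 0" for j
    proof (cases "lam j = e")
      case True
      have "cinner s (ev j) = (\<Sum>i\<in>?I. cinner y (ev i) * cinner (ev i) (ev j))"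
        by (simp add: s_def cinner.sum_left cinner_scaleC_left)
      also have "\<dots> = (\<Sum>i\<in>?I. if i = j then cinner y (ev j) else 0)"
        using n[of j] True by (intro sum.cong) (auto simp: ev_orthogonal cinner_self)
      also have "\<dots> = cinner y (ev j)" using fin True by simp
      finally show ?thesis by (simp add: z_def cinner.diff_left)
    next
      case False
      have "complex_of_real e * cinner z (ev j) = complex_of_real (lam j) * cinner z (ev j)"
        using hermitian_cinner[OF hK, of z "ev j"] by (simp add: Kz K_ev cinner_scaleR_left cinner_scaleR_right)
      then show ?thesis using False by auto
    qed
    obtain j where j: "lam j < e" using lam_small[OF e] by blast
    have "z \<in> flag j" using orth by (simp add: flag_iff)
    then have "e * (norm z)\<^sup>2 \<le> lam j * (norm z)\<^sup>2"
      using lam_max[of z j] by (simp add: Kz power2_norm_eq_inner)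
    then have "(e - lam j) * (norm z)\<^sup>2 \<le> 0" by (simp add: algebra_simps)
    then have "z = 0" using j by (simp add: mult_le_0_iff)
    then have "y = s" by (simp add: z_def)
    moreover have "s \<in> complex_vector.span (ev ` ?I)"
      unfolding s_def
      by (intro complex_vector.span_sum complex_vector.span_scale) (auto intro: complex_vector.span_base)
    ultimately show "y \<in> complex_vector.span (ev ` ?I)" by simp
  qed
  have ci: "card (ev ` ?I) = card ?I" by (rule card_image[OF inj])
  have le: "cdimension ?W \<le> enat (card ?I)"
    using cdimension_le_card[OF _ span] fin ci by simp
  moreover have "enat (card ?I) \<le> cdimension ?W"
    using card_independent_le[OF indep sub] le ci by auto
  ultimately show "cdimension ?W = enat (card ?I)" by (rule antisym)
qed

text \<open>\<open>K\<close> itself is the positive root of \<open>K\<^sup>2\<close>.\<close>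

lemma op_abs_eq: "op_abs K = graph_of K"
proof -
  have "graph_of K O op_adjoint (graph_of K) = graph_of (\<lambda>x. K (K x))"
    unfolding op_adjoint_graph[OF hK] by (auto simp: graph_of_iff relcomp_unfold)
  then have "op_abs K = graph_of (psqrt (\<lambda>x. K (K x)))"
    unfolding op_abs_def by (simp add: op_sqrt_graph[OF hermitian_square_positive[OF hK]])
  moreover have "K = psqrt (\<lambda>x. K (K x))"
    by (rule psqrt_unique[OF pos refl hermitian_square_positive[OF hK]])
  ultimately show ?thesis by simp
qed

text \<open>The sequence \<open>lam\<close> satisfies the defining conditions, so the chosen sequence does too; the two agree
  in the number of indices at which a given positive value is attained.\<close>

lemma singular_value:
  shows "decseq (singular_value K)"
    and "0 < e \<Longrightarrow> finite {j. singular_value K j = e}"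
    and "0 < e \<Longrightarrow> card {j. singular_value K j = e} = card {j. lam j = e}"
proof -
  let ?P = "\<lambda>m. decseq m \<and> (\<forall>j::nat. 0 \<le> m j) \<and> (\<forall>e>0. finite {j. m j = e} \<and>
     enat (card {j. m j = e}) = cdimension (eigenspace (op_abs K) (complex_of_real e)))"
  have "?P lam"
    using lam_decseq lam_nonneg cdimension_eigenspace by (simp add: op_abs_eq)
  then have *: "?P (singular_value K)"
    unfolding singular_value_def by (rule someI[where P = ?P])
  then show "decseq (singular_value K)" by blast
  show "0 < e \<Longrightarrow> finite {j. singular_value K j = e}" using * by blast
  assume e: "0 < e"
  have "enat (card {j. singular_value K j = e}) = cdimension (eigenspace (op_abs K) (complex_of_real e))"
    using * e by blast
  then show "card {j. singular_value K j = e} = card {j. lam j = e}"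
    using cdimension_eigenspace(2)[OF e] by (simp add: op_abs_eq)
qed

text \<open>Together the values \<open>lam 0, \<dots>, lam (J - 1)\<close> are attained by the singular values at least \<open>J\<close> times,
  hence at some index \<open>\<ge> J - 1\<close>.\<close>

lemma singular_value_greater_one:
  assumes J: "0 < J" and gt: "\<And>j. j < J \<Longrightarrow> 1 < lam j"
  shows "1 < singular_value K (J - 1)"
proof -
  let ?s = "singular_value K" and ?L = "lam ` {..<J}"
  let ?U = "\<Union>e\<in>?L. {j. ?s j = e}" and ?W = "\<Union>e\<in>?L. {j. lam j = e}"
  have pos: "1 < e" if "e \<in> ?L" for e
  proof -
    obtain j where "j < J" "e = lam j" using \<open>e \<in> ?L\<close> by blast
    then show ?thesis using gt[of j] by simp
  qed
  have pos0: "0 < e" if "e \<in> ?L" for e using pos[OF that] by linarith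
  have finU: "finite {j. ?s j = e}" if "e \<in> ?L" for e by (rule singular_value(2)[OF pos0[OF that]])
  have finW: "finite {j. lam j = e}" if "e \<in> ?L" for e by (rule cdimension_eigenspace(1)[OF pos0[OF that]])
  have "card ?U = (\<Sum>e\<in>?L. card {j. ?s j = e})"
    by (rule card_UN_disjoint) (use finU in auto)
  also have "\<dots> = (\<Sum>e\<in>?L. card {j. lam j = e})"
    using pos0 by (intro sum.cong refl singular_value(3))
  also have "\<dots> = card ?W"
    by (rule card_UN_disjoint[symmetric]) (use finW in auto)
  also have "card {..<J} \<le> \<dots>"
    by (rule card_mono) (use finW in auto)
  finally have cU: "J \<le> card ?U" by simp
  have "\<exists>i\<in>?U. J - 1 \<le> i"
  proof (rule ccontr)
    assume "\<not> ?thesis"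
    then have "?U \<subseteq> {..<J - 1}" by (auto simp: not_le)
    then have "card ?U \<le> J - 1" using card_mono[of "{..<J - 1}" ?U] by simp
    then show False using cU J by simp
  qed
  then obtain i where i: "i \<in> ?U" "J - 1 \<le> i" by blast
  then have "1 < ?s i" using pos by auto
  then show ?thesis using decseqD[OF singular_value(1) i(2)] by simp
qed

text \<open>If \<open>J\<close> eigenvalues exceed \<open>1\<close>, then \<open>K \<le> 1\<close> on the vectors orthogonal to the first \<open>J\<close>
  eigenvectors, so the components along these \<open>J\<close> eigenvectors determine a vector of \<open>L\<close>. The
  \<open>J\<close>-th singular value exceeds \<open>1\<close>, whence \<open>J\<^sup>1\<^sup>/\<^sup>p\<close> is at most the weak Schatten norm.\<close>

theorem cdimension_le_weak_schatten_norm: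
  assumes L: "complex_vector.subspace L" and gt: "\<And>v. v \<in> L \<Longrightarrow> v \<noteq> 0 \<Longrightarrow> (norm v)\<^sup>2 < inner (K v) v"
    and p: "0 < p" and K: "K \<in> weak_schatten p"
  shows "cdimension L \<noteq> \<infinity>"
    and "ereal_of_enat (cdimension L) \<le> ereal (weak_schatten_norm p K powr p)"
proof -
  define J where "J = (LEAST j. lam j \<le> 1)"
  obtain j where "lam j < 1" using lam_small[of 1] by auto
  then have J1: "lam J \<le> 1" unfolding J_def by (intro LeastI[of "\<lambda>j. lam j \<le> 1" j] less_imp_le)
  have J2: "1 < lam i" if "i < J" for i using not_less_Least[of i "\<lambda>j. lam j \<le> 1"] that by (simp add: J_def)
  let ?S = "complex_vector.span (ev ` {..<J})"
  define f where "f v = (\<Sum>i<J. cinner v (ev i) *\<^sub>C ev i)" for v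
  have "cdimension L \<le> cdimension ?S"
  proof (rule cdimension_injective_le[OF L, of f])
    show "f ` L \<subseteq> ?S"
      unfolding f_def image_subset_iff
      by (intro ballI complex_vector.span_sum complex_vector.span_scale) (auto intro: complex_vector.span_base)
    show "f (x + y) = f x + f y" for x y
      by (simp add: f_def cinner_simps scaleC_add_left sum.distrib)
    show "f (a *\<^sub>C x) = a *\<^sub>C f x" for a x
      by (simp add: f_def cinner_simps scaleC_scaleC complex_vector.scale_sum_right)
    show "x = 0" if x: "x \<in> L" "f x = 0" for x
    proof -
      have "cinner x (ev i) = 0" if i: "i < J" for i
      proof -
        have "0 = cinner (f x) (ev i)" using x(2) by (simp add: cinner.zero_left)
        also have "\<dots> = (\<Sum>k<J. cinner x (ev k) * cinner (ev k) (ev i))"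
          by (simp add: f_def cinner.sum_left cinner_scaleC_left)
        also have "\<dots> = (\<Sum>k<J. if k = i then cinner x (ev i) else 0)"
          using norm_ev[of i] J2[OF i] by (intro sum.cong) (auto simp: ev_orthogonal cinner_self)
        also have "\<dots> = cinner x (ev i)" using i by simp
        finally show ?thesis by simp
      qed
      then have "x \<in> flag J" by (simp add: flag_iff)
      then have "inner (K x) x \<le> 1 * (norm x)\<^sup>2"
        using lam_max[of x J] mult_right_mono[OF J1, of "(norm x)\<^sup>2"] by simp
      then show ?thesis using gt[OF x(1)] by force
    qed
  qed
  also have "\<dots> \<le> enat (card (ev ` {..<J}))" by (rule cdimension_le_card) auto
  also have "\<dots> \<le> enat J" using card_image_le[of "{..<J}" ev] by simp
  finally have LJ: "cdimension L \<le> enat J" .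
  then show "cdimension L \<noteq> \<infinity>" by (cases "cdimension L") simp_all
  have "real J \<le> weak_schatten_norm p K powr p"
  proof (cases "J = 0")
    case False
    have bdd: "bdd_above (range (\<lambda>j. (real j + 1) powr (1 / p) * singular_value K j))"
      using K by (simp add: weak_schatten_def)
    have "1 < singular_value K (J - 1)"
      by (rule singular_value_greater_one[of J, OF _ J2]) (use False in auto)
    then have "real J powr (1/p) * 1 \<le> real J powr (1/p) * singular_value K (J - 1)"
      by (intro mult_left_mono) auto
    also have "real J powr (1/p) * singular_value K (J - 1) = (real (J - 1) + 1) powr (1/p) * singular_value K (J - 1)"
      using False by (simp add: of_nat_diff)
    also have "\<dots> \<le> weak_schatten_norm p K"
      unfolding weak_schatten_norm_def by (rule cSUP_upper[OF _ bdd]) simp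
    finally have "(real J powr (1/p)) powr p \<le> weak_schatten_norm p K powr p"
      using p by (intro powr_mono2) auto
    then show ?thesis using p False by (simp add: powr_powr)
  qed simp
  then have "ereal_of_enat (enat J) \<le> ereal (weak_schatten_norm p K powr p)" by simp
  moreover have "ereal_of_enat (cdimension L) \<le> ereal_of_enat (enat J)"
    using LJ by (simp only: ereal_of_enat_le_iff)
  ultimately show "ereal_of_enat (cdimension L) \<le> ereal (weak_schatten_norm p K powr p)"
    by (rule order_trans[rotated])
qed

end

section \<open>Spectral projections and counting functions\<close>

lemma (in inverse_of_positive) spectral_projection_semibounded:
  "semibounded_spectral_operator (spectral_projection (shifted_inverse T c)) (shifted_inverse T c) c"
proof -
  let ?A = "shifted_inverse T c"
  have sp: "spectral_measure_of ?A (spectral_projection ?A)"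
    unfolding spectral_projection_def using someI_ex[OF spectral_measure_exists] by simp
  have A: "(x, y) \<in> ?A \<longleftrightarrow> (\<exists>z. x = T z \<and> y = z - c *\<^sub>R T z)" for x y
    by (auto simp: shifted_inverse_def)
  show ?thesis
  proof unfold_locales
    show "projection_valued_measure (spectral_projection ?A)"
      using sp by (simp add: spectral_measure_of_def)
    show "spectral_measure_of ?A (spectral_projection ?A)" by (rule sp)
    show "inner y x' = inner x y'" if xy: "(x, y) \<in> ?A" "(x', y') \<in> ?A" for x y x' y'
    proof -
      obtain z z' where "x = T z" "y = z - c *\<^sub>R T z" "x' = T z'" "y' = z' - c *\<^sub>R T z'"
        using xy unfolding A by blast
      then show ?thesis
        using hermitian_inner[OF hT, of z z'] by (simp add: inner_diff_left inner_diff_right)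
    qed
    show "(x + x', y + y') \<in> ?A" if xy: "(x, y) \<in> ?A" "(x', y') \<in> ?A" for x y x' y'
    proof -
      obtain z z' where z: "x = T z" "y = z - c *\<^sub>R T z" "x' = T z'" "y' = z' - c *\<^sub>R T z'"
        using xy unfolding A by blast
      show ?thesis unfolding A
        by (intro exI[of _ "z + z'"]) (simp add: z hermitian_add[OF hT] scaleR_add_right)
    qed
    show "y = y'" if xy: "(x, y) \<in> ?A" "(x, y') \<in> ?A" for x y y'
    proof -
      obtain z z' where z: "x = T z" "y = z - c *\<^sub>R T z" "x = T z'" "y' = z' - c *\<^sub>R T z'"
        using xy unfolding A by blast
      then have "T (z - z') = 0" by (simp add: hermitian_diff[OF hT])
      then have "z - z' = 0" by (rule inj)
      then show ?thesis using z by simp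
    qed
    show "- c * (norm x)\<^sup>2 \<le> inner y x" if xy: "(x, y) \<in> ?A" for x y
    proof -
      obtain z where "x = T z" "y = z - c *\<^sub>R T z" using xy unfolding A by blast
      then show ?thesis using positive_inner[OF pos, of z]
        by (simp add: inner_diff_left inner_diff_right power2_norm_eq_inner inner_commute)
    qed
  qed
qed

text \<open>\<open>K = R\<^sup>-\<^sup>1 - c\<close> with \<open>R = (K + c)\<^sup>-\<^sup>1\<close>, where \<open>c\<close> is chosen so that \<open>K + c \<ge> 1\<close>.\<close>

lemma graph_of_eq_shifted_inverse:
  assumes K: "hermitian K"
  obtains R c where "inverse_of_positive R" "graph_of K = shifted_inverse R c"
proof -
  obtain k where k: "k > 0" "\<And>x. \<bar>inner (K x) x\<bar> \<le> k * (norm x)\<^sup>2"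
    using hermitian_inner_bound[OF K] by metis
  define c where "c = k + 1"
  have B: "hermitian (\<lambda>x. K x + c *\<^sub>R x)" by (rule hermitian_add_op[OF K hermitian_const])
  have co: "1 * (norm x)\<^sup>2 \<le> inner (K x + c *\<^sub>R x) x" for x
    using k(2)[of x] by (simp add: inner_add_left power2_norm_eq_inner c_def abs_le_iff algebra_simps)
  obtain R where R: "positive_op R" "\<And>x. K (R x) + c *\<^sub>R R x = x" "\<And>x. R (K x + c *\<^sub>R x) = x"
    using coercive_invertible[OF B zero_less_one co] by blast
  have "inverse_of_positive R"
  proof
    show "positive_op R" by (rule R)
    show "x = 0" if "R x = 0" for x
      using R(2)[of x] that by (simp add: hermitian_zero[OF K])
  qed
  moreover have "graph_of K = shifted_inverse R c"
  proof (intro subset_antisym subrelI)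
    fix x y assume "(x, y) \<in> graph_of K"
    then have "y = K x" by (simp add: graph_of_iff)
    then show "(x, y) \<in> shifted_inverse R c"
      unfolding shifted_inverse_def by (intro CollectI exI[of _ "K x + c *\<^sub>R x"]) (simp add: R(3))
  next
    fix x y assume "(x, y) \<in> shifted_inverse R c"
    then obtain z where z: "x = R z" "y = z - c *\<^sub>R R z" unfolding shifted_inverse_def by blast
    have "K (R z) = z - c *\<^sub>R R z" using R(2)[of z] by (metis add_diff_cancel_right')
    then show "(x, y) \<in> graph_of K" using z by (simp add: graph_of_iff)
  qed
  ultimately show ?thesis by (rule that)
qed

lemma
  assumes K: "hermitian K"
  shows spectral_projection_graph: "B \<in> sets borel \<Longrightarrow> orthogonal_projection (spectral_projection (graph_of K) B)"
    and above_one: "spectral_projection (graph_of K) {1<..} x = x \<Longrightarrow> x \<noteq> 0 \<Longrightarrow> (norm x)\<^sup>2 < inner (K x) x"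
    and not_above_one: "spectral_projection (graph_of K) {1<..} x = 0 \<Longrightarrow> inner (K x) x \<le> (norm x)\<^sup>2"
    and below_zero: "spectral_projection (graph_of K) {..<0} x = x \<Longrightarrow> x \<noteq> 0 \<Longrightarrow> inner (K x) x < 0"
    and not_below_zero: "spectral_projection (graph_of K) {..<0} x = 0 \<Longrightarrow> 0 \<le> inner (K x) x"
proof -
  obtain R c where R: "inverse_of_positive R" and eq: "graph_of K = shifted_inverse R c"
    using graph_of_eq_shifted_inverse[OF K] by metis
  interpret semibounded_spectral_operator "spectral_projection (graph_of K)" "graph_of K" c
    unfolding eq by (rule inverse_of_positive.spectral_projection_semibounded[OF R])
  have xK: "(x, K x) \<in> graph_of K" by (simp add: graph_of_iff)
  show "B \<in> sets borel \<Longrightarrow> orthogonal_projection (spectral_projection (graph_of K) B)" by (rule proj)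
  show "(norm x)\<^sup>2 < inner (K x) x" if "spectral_projection (graph_of K) {1<..} x = x" "x \<noteq> 0"
    using form_greater[OF _ that(1) xK, of 1] that(2) by simp
  show "inner (K x) x < 0" if "spectral_projection (graph_of K) {..<0} x = x" "x \<noteq> 0"
    using form_less[OF _ that(1) xK, of 0] that(2) by simp
  show "inner (K x) x \<le> (norm x)\<^sup>2" if "spectral_projection (graph_of K) {1<..} x = 0"
  proof -
    have "spectral_projection (graph_of K) (- {1<..}) x = x" using compl[of "{1<..}" x] that by simp
    from form_le[OF _ this xK, of 1] show ?thesis by simp
  qed
  show "0 \<le> inner (K x) x" if "spectral_projection (graph_of K) {..<0} x = 0"
  proof -
    have "spectral_projection (graph_of K) (- {..<0}) x = x" using compl[of "{..<0}" x] that by simp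
    from form_ge[OF _ this xK, of 0] show ?thesis by simp
  qed
qed

section \<open>The counting argument\<close>

text \<open>Here \<open>P\<close> stands for the projection onto \<open>ker H\<close>, the map \<open>J\<close> for a parametrization of the form domain
  in which the form of \<open>H\<^sub>V\<close> becomes \<open>\<parallel>v - P v\<parallel>\<^sup>2 + \<langle>W v|v\<rangle>\<close>, and \<open>Pm\<close> for the projection onto the negative
  spectral subspace of \<open>H\<^sub>V\<close>, which enters only through the sign of the form on its range and on its
  kernel.\<close>

locale birman_schwinger =
  fixes P W Pm J :: "'a::complex_hilbert \<Rightarrow> 'a"
  assumes P: "orthogonal_projection P" and W: "hermitian W" and Pm: "orthogonal_projection Pm"
    and J: "clinear_map J" and J_inj: "J v = 0 \<Longrightarrow> v = 0" and Pm_J: "range Pm \<subseteq> range J"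
    and negative: "Pm (J v) = J v \<Longrightarrow> v \<noteq> 0 \<Longrightarrow> (norm (v - P v))\<^sup>2 + inner (W v) v < 0"
    and nonnegative: "Pm (J v) = 0 \<Longrightarrow> 0 \<le> (norm (v - P v))\<^sup>2 + inner (W v) v"
begin

definition Q :: "'a \<Rightarrow> 'a" where "Q v = v - P v"
definition K :: "'a \<Rightarrow> 'a" where "K v = - Q (W (Q v))"
definition C :: "'a \<Rightarrow> 'a" where "C v = P (W (P v))"
definition h :: "'a \<Rightarrow> real" where "h v = (norm (Q v))\<^sup>2 + inner (W v) v"

abbreviation P1 :: "'a \<Rightarrow> 'a" where "P1 \<equiv> spectral_projection (graph_of K) {1<..}"
abbreviation Pc :: "'a \<Rightarrow> 'a" where "Pc \<equiv> spectral_projection (graph_of C) {..<0}"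

lemma Q: "orthogonal_projection Q" unfolding Q_def by (rule projection_complement[OF P])

lemmas hP = projection_hermitian[OF P] and hQ = projection_hermitian[OF Q]
  and hPm = projection_hermitian[OF Pm]

lemma hK: "hermitian K" and hC: "hermitian C"
  unfolding K_def C_def
  by (rule hermitian_minus_op[OF hermitian_sandwich[OF hQ W]], rule hermitian_sandwich[OF hP W])

lemma hP1: "hermitian P1" and hPc: "hermitian Pc"
  by (rule projection_hermitian[OF spectral_projection_graph[OF hK]], simp,
      rule projection_hermitian[OF spectral_projection_graph[OF hC]], simp)

lemma range_iff: "orthogonal_projection S \<Longrightarrow> x \<in> range S \<longleftrightarrow> S x = x"
  by (metis projection_idem rangeE rangeI)

lemma P1: "x \<in> range P1 \<longleftrightarrow> P1 x = x" and Pc: "x \<in> range Pc \<longleftrightarrow> Pc x = x"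
  by (rule range_iff, rule spectral_projection_graph[OF hK], simp,
      rule range_iff, rule spectral_projection_graph[OF hC], simp)

lemma QP: "Q (P v) = 0"
  by (simp add: Q_def projection_idem[OF P])

lemma K_form: "inner (K v) v = - inner (W (Q v)) (Q v)"
  by (simp add: K_def hermitian_inner[OF hQ, of "W (Q v)"])

lemma C_form: "inner (C v) v = inner (W (P v)) (P v)"
  by (simp add: C_def hermitian_inner[OF hP, of "W (P v)"])

lemma negative_h: "Pm (J v) = J v \<Longrightarrow> h v \<ge> 0 \<Longrightarrow> v = 0"
  using negative[of v] by (force simp: h_def Q_def)

lemma nonnegative_h: "Pm (J v) = 0 \<Longrightarrow> 0 \<le> h v"
  using nonnegative[of v] by (simp add: h_def Q_def)

lemma J_add: "J (x + y) = J x + J y" and J_scaleC: "J (a *\<^sub>C x) = a *\<^sub>C J x"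
  using J by (auto simp: clinear_map_def)

definition Ji :: "'a \<Rightarrow> 'a" where "Ji = inv J"

lemma J_injective: "inj J"
proof (rule injI)
  fix x y assume "J x = J y"
  then have "J (x - y) = 0" using J_add[of "x - y" y] by simp
  then have "x - y = 0" by (rule J_inj)
  then show "x = y" by simp
qed

lemma Ji_J: "Ji (J v) = v" unfolding Ji_def by (rule inv_f_f[OF J_injective])

lemma range_Pm: 
  assumes "x \<in> range Pm" shows "\<exists>v. x = J v \<and> Pm (J v) = J v"
proof -
  obtain v where "x = J v" using assms Pm_J by blast
  moreover have "Pm x = x" using assms range_iff[OF Pm] by blast
  ultimately show ?thesis by blast
qed

lemma Ji_linear: 
  assumes "x \<in> range Pm" 
  shows "y \<in> range Pm \<Longrightarrow> Ji (x + y) = Ji x + Ji y" and "Ji (a *\<^sub>C x) = a *\<^sub>C Ji x"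
proof -
  obtain v where v: "x = J v" using assms Pm_J by blast
  show "Ji (a *\<^sub>C x) = a *\<^sub>C Ji x" using v by (simp add: Ji_J flip: J_scaleC)
  assume "y \<in> range Pm"
  then obtain w where w: "y = J w" using Pm_J by blast
  show "Ji (x + y) = Ji x + Ji y" using v w by (simp add: Ji_J flip: J_add)
qed

lemma composite_linear:
  assumes S: "hermitian S" and x: "x \<in> range Pm"
  shows "y \<in> range Pm \<Longrightarrow> S (Ji (x + y)) = S (Ji x) + S (Ji y)" and "S (Ji (a *\<^sub>C x)) = a *\<^sub>C S (Ji x)"
  using Ji_linear[OF x] by (simp_all add: hermitian_add[OF S] hermitian_scaleC[OF S])

lemma csubspace_projection_range: "hermitian S \<Longrightarrow> complex_vector.subspace (range S)"
  by (rule csubspace_range[OF hermitian_clinear])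

text \<open>For \<open>v\<close> in the range of \<open>P1\<close>, \<open>h (Q v) = \<parallel>Q v\<parallel>\<^sup>2 - \<langle>K v|v\<rangle>\<close> is negative unless \<open>v = 0\<close>.\<close>

lemma count_lower: "cdimension (range P1) \<le> cdimension (range Pm)"
proof (rule cdimension_injective_le[of _ "\<lambda>v. Pm (J (Q v))"])
  show "complex_vector.subspace (range P1)" by (rule csubspace_projection_range[OF hP1])
  show "(\<lambda>v. Pm (J (Q v))) ` range P1 \<subseteq> range Pm" by blast
  show "x = 0" if x: "x \<in> range P1" "Pm (J (Q x)) = 0" for x
  proof (rule ccontr)
    assume "x \<noteq> 0"
    then have "(norm x)\<^sup>2 < inner (K x) x" using above_one[OF hK] x(1) unfolding P1 by blast
    moreover have "0 \<le> h (Q x)" by (rule nonnegative_h[OF x(2)])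
    then have "inner (K x) x \<le> (norm (Q x))\<^sup>2" by (simp add: h_def K_form projection_idem[OF Q])
    moreover have "(norm (Q x))\<^sup>2 \<le> (norm x)\<^sup>2" by (rule power_mono[OF projection_norm_le[OF Q]]) simp
    ultimately show False by linarith
  qed
qed (simp_all add: hermitian_add[OF hQ] J_add hermitian_add[OF hPm] hermitian_scaleC[OF hQ] J_scaleC
    hermitian_scaleC[OF hPm])

text \<open>Common form of the two upper bounds. Restricting to the vectors \<open>J v\<close> in the range of \<open>Pm\<close> with
  \<open>S v = 0\<close> lowers the dimension by at most the rank of \<open>S\<close>, and on these \<open>J v \<mapsto> P1 (R v)\<close> is
  injective.\<close>

lemma count_upper:
  assumes S: "hermitian S" and R: "hermitian R"
    and inj: "\<And>v. S v = 0 \<Longrightarrow> P1 (R v) = 0 \<Longrightarrow> 0 \<le> h v"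
  shows "cdimension (range Pm) \<le> cdimension (range P1) + cdimension (range S)"
proof -
  let ?N = "{x \<in> range Pm. S (Ji x) = 0}"
  have "cdimension (range Pm) \<le> cdimension ?N + cdimension (range S)"
    by (rule cdimension_rank_nullity[of _ "\<lambda>x. S (Ji x)"])
      (auto simp: composite_linear[OF S] csubspace_projection_range[OF hPm])
  moreover have "cdimension ?N \<le> cdimension (range P1)"
  proof (rule cdimension_injective_le[of _ "\<lambda>x. P1 (R (Ji x))"])
    have Rm: "complex_vector.subspace (range Pm)" by (rule csubspace_projection_range[OF hPm])
    have "S (Ji 0) = 0"
      using composite_linear(2)[OF S complex_vector.subspace_0[OF Rm], of 0] by simp
    then show "complex_vector.subspace ?N"
      using complex_vector.subspace_0[OF Rm] complex_vector.subspace_add[OF Rm] complex_vector.subspace_scale[OF Rm]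
      by (auto simp: complex_vector.subspace_def composite_linear[OF S])
    show "(\<lambda>x. P1 (R (Ji x))) ` ?N \<subseteq> range P1" by blast
    show "P1 (R (Ji (x + y))) = P1 (R (Ji x)) + P1 (R (Ji y))" if "x \<in> ?N" "y \<in> ?N" for x y
      using that by (simp add: composite_linear[OF R] hermitian_add[OF hP1])
    show "P1 (R (Ji (a *\<^sub>C x))) = a *\<^sub>C P1 (R (Ji x))" if "x \<in> ?N" for a x
      using that by (simp add: composite_linear[OF R] hermitian_scaleC[OF hP1])
    show "x = 0" if x: "x \<in> ?N" "P1 (R (Ji x)) = 0" for x
    proof -
      obtain v where v: "x = J v" "Pm (J v) = J v" using range_Pm x(1) by blast
      then have "0 \<le> h v" using x by (intro inj) (simp_all add: Ji_J)
      then have "v = 0" by (rule negative_h[OF v(2)])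
      then show ?thesis using v(1) J_scaleC[of 0 0] by simp
    qed
  qed
  ultimately show ?thesis by (meson add_right_mono order_trans)
qed

lemma count_upper_kernel: "cdimension (range Pm) \<le> cdimension (range P1) + cdimension (range P)"
proof (rule count_upper[OF hP hermitian_id])
  fix v assume v: "P v = 0" "P1 v = 0"
  then have "Q v = v" by (simp add: Q_def)
  then show "0 \<le> h v" using not_above_one[OF hK v(2)] by (simp add: h_def K_form)
qed

lemma count_compression_lower: "cdimension (range Pc) \<le> cdimension (range Pm)"
proof (rule cdimension_injective_le[of _ "\<lambda>v. Pm (J (P v))"])
  show "complex_vector.subspace (range Pc)" by (rule csubspace_projection_range[OF hPc])
  show "(\<lambda>v. Pm (J (P v))) ` range Pc \<subseteq> range Pm" by blast
  show "x = 0" if x: "x \<in> range Pc" "Pm (J (P x)) = 0" for x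
  proof (rule ccontr)
    assume "x \<noteq> 0"
    then have "inner (C x) x < 0" using below_zero[OF hC] x(1) unfolding Pc by blast
    moreover have "0 \<le> h (P x)" by (rule nonnegative_h[OF x(2)])
    ultimately show False by (simp add: h_def C_form QP)
  qed
qed (simp_all add: hermitian_add[OF hP] J_add hermitian_add[OF hPm] hermitian_scaleC[OF hP] J_scaleC
    hermitian_scaleC[OF hPm])

lemma count_compression_kernel: "cdimension (range Pc) \<le> cdimension (range P)"
proof (rule cdimension_injective_le[of _ P])
  show "complex_vector.subspace (range Pc)" by (rule csubspace_projection_range[OF hPc])
  show "x = 0" if x: "x \<in> range Pc" "P x = 0" for x
  proof (rule ccontr)
    assume "x \<noteq> 0"
    then have "inner (C x) x < 0" using below_zero[OF hC] x(1) unfolding Pc by blast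
    then show False using x(2) by (simp add: C_form)
  qed
qed (auto simp: hermitian_add[OF hP] hermitian_scaleC[OF hP])

text \<open>If \<open>W \<le> 0\<close>, a vector \<open>P v\<close> on which the form of \<open>W\<close> vanishes is annihilated by \<open>W\<close>, so the
  mixed terms in \<open>h v\<close> disappear.\<close>

lemma count_compression_upper:
  assumes neg: "positive_op (\<lambda>v. - W v)"
  shows "cdimension (range Pm) \<le> cdimension (range P1) + cdimension (range Pc)"
proof (rule count_upper[OF hPc hQ])
  fix v assume v: "Pc v = 0" "P1 (Q v) = 0"
  have "0 \<le> inner (W (P v)) (P v)" using not_below_zero[OF hC v(1)] by (simp add: C_form)
  then have "inner (- W (P v)) (P v) = 0" using positive_inner[OF neg, of "P v"] by simp
  then have WP: "W (P v) = 0" using positive_inner_eq_0[OF neg] by simp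
  have "v = P v + Q v" by (simp add: Q_def)
  then have "inner (W v) v = inner (W (P v + Q v)) (P v + Q v)" by simp
  also have "\<dots> = inner (W (Q v)) (Q v)"
    using hermitian_inner[OF W, of "Q v" "P v"] by (simp add: hermitian_add[OF W] WP inner_add_right)
  finally show "0 \<le> h v"
    using not_above_one[OF hK v(2)] by (simp add: h_def K_form projection_idem[OF Q])
qed

lemma K_positive: "positive_op (\<lambda>v. - W v) \<Longrightarrow> positive_op K"
  using hK positive_inner[of "\<lambda>v. - W v"] by (auto simp: positive_op_def K_form)

end

section \<open>Positivity from the resolvent set\<close>

lemma resolvent_real:
  assumes H: "selfadjoint H" and t: "complex_of_real t \<in> resolvent_set H"
  obtains R where "hermitian R" "\<And>x y. (x, y) \<in> H \<longleftrightarrow> R (y - t *\<^sub>R x) = x"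
proof -
  obtain R where bR: "bounded_linear R" and R: "(add_scalar H (- complex_of_real t))\<inverse> = graph_of R"
    using t unfolding resolvent_set_def by blast
  have iff: "(x, y) \<in> H \<longleftrightarrow> R (y - t *\<^sub>R x) = x" for x y
  proof -
    have "(x, y) \<in> H \<longleftrightarrow> (x, y - t *\<^sub>R x) \<in> add_scalar H (- complex_of_real t)"
      by (auto simp: add_scalar_def complex_vector.scale_minus_left scaleC_of_real)
    also have "\<dots> \<longleftrightarrow> (y - t *\<^sub>R x, x) \<in> graph_of R" unfolding R[symmetric] by (rule converse_iff[symmetric])
    finally show ?thesis by (auto simp: graph_of_iff)
  qed
  have sym: "cinner (R u) v = cinner u (R v)" for u v
  proof -
    have "(R u, u + t *\<^sub>R R u) \<in> H" "(R v, v + t *\<^sub>R R v) \<in> H" using iff by simp_all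
    from selfadjoint_symmetric[OF H this] show ?thesis
      by (simp add: cinner_simps cinner_scaleR_left cinner_scaleR_right)
  qed
  have "R (x + y) = R x + R y" for x y by (rule cinner_eqI) (simp add: sym cinner_simps)
  moreover have "R (a *\<^sub>C x) = a *\<^sub>C R x" for a x by (rule cinner_eqI) (simp add: sym cinner_simps)
  ultimately have "hermitian R" using bR sym by (simp add: hermitian_def clinear_map_def)
  then show ?thesis using iff by (rule that)
qed

definition bounded_below :: "('a::real_normed_vector \<Rightarrow> 'a) \<Rightarrow> bool" where
  "bounded_below B \<longleftrightarrow> (\<exists>d>0. \<forall>x. d * norm x \<le> norm (B x))"

lemma bounded_below_comp:
  assumes "bounded_below A" "bounded_below B" shows "bounded_below (\<lambda>x. A (B x))"
proof -
  obtain a b where ab: "a > 0" "\<And>x. a * norm x \<le> norm (A x)" "b > 0" "\<And>x. b * norm x \<le> norm (B x)"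
    using assms unfolding bounded_below_def by blast
  have "(a * b) * norm x \<le> norm (A (B x))" for x
    using order_trans[OF mult_left_mono[OF ab(4)[of x] less_imp_le[OF ab(1)]] ab(2)] by (simp add: mult.assoc)
  then show ?thesis unfolding bounded_below_def using ab by (intro exI[of _ "a * b"]) simp
qed

text \<open>The smallest \<open>e \<ge> 0\<close> with \<open>B + e \<ge> 0\<close> must be \<open>0\<close>: if \<open>B + e\<close> is positive and bounded below
  in norm, its form is coercive, and \<open>e\<close> can be lowered.\<close>

lemma positive_if_shifts_bounded_below:
  assumes B: "hermitian (B :: 'a::complex_hilbert \<Rightarrow> 'a)" and bb: "\<And>e. 0 < e \<Longrightarrow> bounded_below (\<lambda>x. B x + e *\<^sub>R x)"
  shows "positive_op B"
proof -
  \<comment> \<open>The shifts that make the form of \<open>B\<close> nonnegative.\<close>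
  define S where "S = {e. 0 \<le> e \<and> (\<forall>x. 0 \<le> inner (B x) x + e * (norm x)\<^sup>2)}"
  obtain c where c: "c > 0" "\<And>x. \<bar>inner (B x) x\<bar> \<le> c * (norm x)\<^sup>2"
    using hermitian_inner_bound[OF B] by metis
  have cS: "c \<in> S" unfolding S_def using c(1) c(2) by (simp add: abs_le_iff) (metis add.commute diff_ge_0_iff_ge diff_minus_eq_add minus_le_iff neg_le_iff_le)
  have bdd: "bdd_below S" unfolding S_def by (rule bdd_belowI[of _ 0]) simp
  define e where "e = Inf S"
  have e0: "0 \<le> e" unfolding e_def by (rule cInf_greatest) (use cS in \<open>auto simp: S_def\<close>)
  have e: "0 \<le> inner (B x) x + e * (norm x)\<^sup>2" for x
  proof (cases "x = 0")
    case False
    have "- inner (B x) x / (norm x)\<^sup>2 \<le> e" unfolding e_def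
    proof (rule cInf_greatest)
      fix s assume "s \<in> S"
      then have "0 \<le> inner (B x) x + s * (norm x)\<^sup>2" by (simp add: S_def)
      then show "- inner (B x) x / (norm x)\<^sup>2 \<le> s" using False by (simp add: field_simps)
    qed (use cS in blast)
    then show ?thesis using False by (simp add: field_simps)
  qed (simp add: hermitian_zero[OF B])
  have "e = 0"
  proof (rule ccontr)
    assume "e \<noteq> 0"
    then have ep: "0 < e" using e0 by simp
    obtain d where d: "d > 0" "\<And>x. d * norm x \<le> norm (B x + e *\<^sub>R x)"
      using bb[OF ep] unfolding bounded_below_def by blast
    have hD: "hermitian (\<lambda>x. B x + e *\<^sub>R x)" by (rule hermitian_add_op[OF B hermitian_const])
    obtain C where C: "C > 0" "\<And>x. \<bar>inner (B x + e *\<^sub>R x) x\<bar> \<le> C * (norm x)\<^sup>2"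
      using hermitian_inner_bound[OF hD] by metis
    have co: "d\<^sup>2 / C * (norm x)\<^sup>2 \<le> inner (B x) x + e * (norm x)\<^sup>2" for x
    proof -
      have "(d * norm x)\<^sup>2 \<le> (norm (B x + e *\<^sub>R x))\<^sup>2" by (rule power_mono[OF d(2)]) (use d(1) in simp)
      also have "\<dots> \<le> C * inner (B x + e *\<^sub>R x) x"
        by (rule positive_norm_bound(1)[OF hD, of UNIV])
          (use e C in \<open>auto simp: inner_add_left power2_norm_eq_inner abs_le_iff\<close>)
      also have "inner (B x + e *\<^sub>R x) x = inner (B x) x + e * (norm x)\<^sup>2"
        by (simp add: inner_add_left power2_norm_eq_inner)
      finally show ?thesis using C(1) by (simp add: field_simps power_mult_distrib)
    qed
    define s where "s = max 0 (e - d\<^sup>2 / C)"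
    have "s \<in> S" unfolding S_def
    proof (intro CollectI conjI allI)
      fix x :: 'a
      have "(e - d\<^sup>2 / C) * (norm x)\<^sup>2 \<le> s * (norm x)\<^sup>2" by (rule mult_right_mono) (auto simp: s_def)
      then show "0 \<le> inner (B x) x + s * (norm x)\<^sup>2" using co[of x] by (simp add: algebra_simps)
    qed (simp add: s_def)
    then have "e \<le> s" unfolding e_def by (rule cInf_lower[OF _ bdd])
    moreover have "0 < d\<^sup>2 / C" using d(1) C(1) by simp
    ultimately show False using ep by (simp add: s_def max_def split: if_splits)
  qed
  then show ?thesis using B e by (simp add: positive_op_def)
qed

text \<open>The vector \<open>y = X x - x\<close> satisfies \<open>X y = - y\<close>.\<close>

lemma positive_root_fixed:
  assumes X: "positive_op X" and "X (X x) = x" shows "X x = x"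
proof -
  define y where "y = X x - x"
  have "X y = - y" using assms(2) by (simp add: y_def hermitian_diff[OF positive_hermitian[OF X]])
  then have "inner y y \<le> 0" using positive_inner[OF X, of y] by simp
  then have "inner y y = 0" by (rule antisym[OF _ inner_ge_zero])
  then have "y = 0" by simp
  then show ?thesis by (simp add: y_def)
qed

section \<open>The unperturbed operator\<close>

locale isolated_zero =
  fixes H :: "'a::complex_hilbert operator"
  assumes sa: "selfadjoint H" and sp: "spectrum H \<subseteq> complex_of_real ` {0..}"
    and ds: "0 \<in> discrete_spectrum H"
begin

text \<open>The resolvent at \<open>-1\<close>.\<close>

definition T :: "'a \<Rightarrow> 'a" where
  "T = (SOME R. hermitian R \<and> (\<forall>x y. (x, y) \<in> H \<longleftrightarrow> R (y + x) = x))"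

lemma negative_resolvent: "t < 0 \<Longrightarrow> complex_of_real t \<in> resolvent_set H"
proof (rule ccontr)
  assume t: "t < 0" and "complex_of_real t \<notin> resolvent_set H"
  then have "complex_of_real t \<in> spectrum H" by (simp add: spectrum_def)
  then obtain s where "0 \<le> s" "complex_of_real t = complex_of_real s" using sp by blast
  then show False using t by simp
qed

lemma hT: "hermitian T" and H_iff: "(x, y) \<in> H \<longleftrightarrow> T (y + x) = x"
proof -
  obtain R where "hermitian R" "\<And>x y. (x, y) \<in> H \<longleftrightarrow> R (y - (-1) *\<^sub>R x) = x"
    by (rule resolvent_real[OF sa negative_resolvent[of "-1"]]) (simp, rule that)
  then have "\<exists>R. hermitian R \<and> (\<forall>x y. (x, y) \<in> H \<longleftrightarrow> R (y + x) = x)" by (intro exI[of _ R]) simp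
  from someI_ex[OF this, folded T_def] show "hermitian T" "(x, y) \<in> H \<longleftrightarrow> T (y + x) = x" by blast+
qed

lemma T_inj: "T x = 0 \<Longrightarrow> x = 0"
proof -
  assume "T x = 0"
  then have "(0, x) \<in> H" by (simp add: H_iff)
  moreover have "(0, 0) \<in> H" by (simp add: H_iff hermitian_zero[OF hT])
  ultimately show "x = 0" using sa by (auto simp: selfadjoint_def is_operator_def dest: single_valuedD)
qed

text \<open>For \<open>T = (H + 1)\<^sup>-\<^sup>1\<close>, the equation \<open>(T - r) w = v\<close> says \<open>(H - s) (T w) = - v / r\<close> with
  \<open>s = 1 / r - 1\<close>, so the resolvent of \<open>H\<close> at \<open>s\<close> bounds \<open>T w\<close>, and thereby \<open>w\<close>, in terms of \<open>v\<close>.\<close>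

lemma shifted_bounded_below:
  assumes r: "r \<noteq> 0" "complex_of_real (1 / r - 1) \<in> resolvent_set H"
  shows "bounded_below (\<lambda>x. T x - r *\<^sub>R x)"
proof -
  define s where "s = 1 / r - 1"
  obtain R where hR: "hermitian R" and R: "\<And>x y. (x, y) \<in> H \<longleftrightarrow> R (y - s *\<^sub>R x) = x"
    by (rule resolvent_real[OF sa r(2), folded s_def]) (rule that)
  obtain c where c: "c > 0" "\<And>x. norm (R x) \<le> c * norm x"
    using hermitian_inner_bound[OF hR] by metis
  have "norm w \<le> ((c / \<bar>r\<bar> + 1) / \<bar>r\<bar>) * norm (T w - r *\<^sub>R w)" for w
  proof -
    define v where "v = T w - r *\<^sub>R w"
    have "(T w, w - T w) \<in> H" by (simp add: H_iff)
    then have "R (w - T w - s *\<^sub>R T w) = T w" by (simp add: R)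
    moreover have "w - T w - s *\<^sub>R T w = - ((1/r) *\<^sub>R v)" using r(1)
      by (simp add: s_def v_def scaleR_diff_left scaleR_diff_right)
    ultimately have Tw: "T w = - ((1/r) *\<^sub>R R v)" by (simp add: hermitian_minus[OF hR] hermitian_scaleR[OF hR])
    have "norm (T w) = norm (R v) / \<bar>r\<bar>" unfolding Tw by simp
    also have "\<dots> \<le> c * norm v / \<bar>r\<bar>" using c(2)[of v] by (rule divide_right_mono) simp
    finally have n: "norm (T w) \<le> c / \<bar>r\<bar> * norm v" by simp
    have "r *\<^sub>R w = T w - v" by (simp add: v_def)
    then have "\<bar>r\<bar> * norm w \<le> norm (T w) + norm v" by (metis norm_scaleR norm_triangle_ineq4)
    also have "\<dots> \<le> (c / \<bar>r\<bar> + 1) * norm v" using n by (simp add: algebra_simps)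
    finally have "norm w * \<bar>r\<bar> \<le> (c / \<bar>r\<bar> + 1) * norm v" by (subst mult.commute)
    then have "norm w \<le> (c / \<bar>r\<bar> + 1) * norm v / \<bar>r\<bar>"
      using r(1) by (subst pos_le_divide_eq) (rule zero_less_abs_iff[THEN iffD2])
    then show ?thesis by (simp add: v_def)
  qed
  then have *: "norm w \<le> k * norm (T w - r *\<^sub>R w)" if "k = (c / \<bar>r\<bar> + 1) / \<bar>r\<bar>" for w k using that by simp
  define k where "k = (c / \<bar>r\<bar> + 1) / \<bar>r\<bar>"
  have k: "k > 0" using c(1) r(1) by (simp add: k_def add_pos_pos)
  have "(1/k) * norm w \<le> norm (T w - r *\<^sub>R w)" for w
    using *[OF k_def, of w] k by (simp add: field_simps)
  then show ?thesis unfolding bounded_below_def using k by (intro exI[of _ "1/k"]) simp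
qed

lemma T_pos: "positive_op T"
proof (rule positive_if_shifts_bounded_below[OF hT])
  fix e :: real assume e: "0 < e"
  have "1 / (- e) - 1 < 0" using e by (simp add: field_simps)
  then have "bounded_below (\<lambda>x. T x - (- e) *\<^sub>R x)"
    using e by (intro shifted_bounded_below negative_resolvent) auto
  then show "bounded_below (\<lambda>x. T x + e *\<^sub>R x)" by simp
qed

lemma bounded_below_minus: "bounded_below B \<Longrightarrow> bounded_below (\<lambda>x. - B x)"
  by (simp add: bounded_below_def)

lemma one_minus_T_pos: "positive_op (\<lambda>x. x - T x)"
proof (rule positive_if_shifts_bounded_below[OF hermitian_diff_op[OF hermitian_id hT]])
  fix e :: real assume e: "0 < e"
  have "1 / (1 + e) - 1 < 0" using e by (simp add: field_simps)
  then have "bounded_below (\<lambda>x. T x - (1 + e) *\<^sub>R x)"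
    using e by (intro shifted_bounded_below negative_resolvent) auto
  from bounded_below_minus[OF this] show "bounded_below (\<lambda>x. x - T x + e *\<^sub>R x)"
    by (simp add: algebra_simps)
qed

text \<open>The map \<open>r \<mapsto> 1 / r - 1\<close> takes \<open>(a, 1)\<close> to a one-sided neighbourhood \<open>(0, 1 / a - 1)\<close> of the isolated point
  \<open>0\<close> of the spectrum of \<open>H\<close>.\<close>

lemma gap: obtains a where "0 < a" "a < 1" "\<And>r. a < r \<Longrightarrow> r < 1 \<Longrightarrow> bounded_below (\<lambda>x. T x - r *\<^sub>R x)"
proof -
  have "0 isolated_in spectrum H" using ds by (simp add: discrete_spectrum_def)
  then obtain U where U: "open U" "U \<inter> spectrum H = {0}" by (auto simp: isolated_in_def)
  then obtain e where e: "e > 0" "ball 0 e \<subseteq> U" using open_contains_ball[of U] by blast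
  define a where "a = 1 / (1 + e)"
  have a: "0 < a" "a < 1" using e by (auto simp: a_def)
  have "bounded_below (\<lambda>x. T x - r *\<^sub>R x)" if r: "a < r" "r < 1" for r
  proof (rule shifted_bounded_below)
    show "r \<noteq> 0" using r a by simp
    have rp: "0 < r" using r a by linarith
    have "1 < r * (1 + e)" using r(1) e(1) by (simp add: a_def field_simps)
    then have s: "0 < 1 / r - 1" "1 / r - 1 < e" using r(2) rp by (simp_all add: field_simps)
    then have "complex_of_real (1 / r - 1) \<in> U" using e(2) by (auto simp: subset_iff simp del: of_real_diff)
    moreover have "complex_of_real (1 / r - 1) \<noteq> 0" using s(1) unfolding of_real_eq_0_iff by linarith
    ultimately have "complex_of_real (1 / r - 1) \<notin> spectrum H" using U(2) by blast
    then show "complex_of_real (1 / r - 1) \<in> resolvent_set H" by (simp add: spectrum_def)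
  qed
  then show ?thesis using that a by blast
qed

definition P :: "'a \<Rightarrow> 'a" where "P = projection_onto (op_kernel H)"

lemma kernel_iff: "x \<in> op_kernel H \<longleftrightarrow> T x = x"
  by (simp add: op_kernel_def H_iff)

lemma kernel_csubspace: "complex_vector.subspace (op_kernel H)" and kernel_closed: "closed (op_kernel H)"
proof -
  have eq: "op_kernel H = {x. x - T x = 0}" by (auto simp: kernel_iff)
  show "complex_vector.subspace (op_kernel H)"
    unfolding eq by (rule csubspace_kernel[OF hermitian_clinear[OF hermitian_diff_op[OF hermitian_id hT]]])
  show "closed (op_kernel H)" unfolding eq
    by (intro closed_Collect_eq linear_continuous_on hermitian_bounded hermitian_diff_op[OF hermitian_id hT]
        continuous_on_const)
qed

lemma P: "orthogonal_projection P"
  unfolding P_def by (rule projection_onto_orthogonal[OF kernel_csubspace kernel_closed])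

lemmas hP = projection_hermitian[OF P]

lemma P_fixed: "P x = x \<longleftrightarrow> x \<in> op_kernel H" and P_zero: "P x = 0 \<longleftrightarrow> x \<in> orthocomplement (op_kernel H)"
  unfolding P_def by (rule projection_onto_fixed[OF kernel_csubspace kernel_closed])+

lemma range_P: "range P = op_kernel H"
  using P_fixed projection_idem[OF P] by (metis (no_types, opaque_lifting) rangeE rangeI subsetI subset_antisym)

lemma TP: "T (P x) = P x"
  using P_fixed[of "P x"] projection_idem[OF P, of x] by (simp add: kernel_iff)

lemma PT: "P (T x) = P x"
  by (rule cinner_eqI) (simp add: hermitian_cinner[OF hP] hermitian_cinner[OF hT] TP)

text \<open>Since \<open>(a, 1)\<close> contains no spectrum of \<open>T\<close>, completing the square shows
  \<open>(1 - T) (a - T) \<ge> 0\<close>; hence \<open>T \<le> a\<close> on the range of \<open>(1 - T)\<^sup>1\<^sup>/\<^sup>2\<close>, which is dense in the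
  orthogonal complement of the kernel.\<close>

lemma gap_coercive: obtains d where "0 < d" "\<And>x. P x = 0 \<Longrightarrow> d * (norm x)\<^sup>2 \<le> inner (x - T x) x"
proof -
  obtain a where a: "0 < a" "a < 1" "\<And>r. a < r \<Longrightarrow> r < 1 \<Longrightarrow> bounded_below (\<lambda>x. T x - r *\<^sub>R x)"
    by (rule gap) (rule that)
  define m where "m = (1 + a) / 2"
  define d where "d = (1 - a) / 2"
  define D where "D x = T x - m *\<^sub>R x" for x
  have hD: "hermitian D" unfolding D_def by (rule hermitian_diff_op[OF hT hermitian_const])
  define B where "B x = D (D x) - d\<^sup>2 *\<^sub>R x" for x
  have hB: "hermitian B" unfolding B_def
    by (rule hermitian_diff_op[OF hermitian_comp[OF hD hD refl] hermitian_const])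
  have pB: "positive_op B"
  proof (rule positive_if_shifts_bounded_below[OF hB])
    fix e :: real assume e: "0 < e"
    show "bounded_below (\<lambda>x. B x + e *\<^sub>R x)"
    proof (cases "e \<le> d\<^sup>2")
      case True
      define s where "s = sqrt (d\<^sup>2 - e)"
      have s2: "s * s = d\<^sup>2 - e" using True by (simp add: s_def)
      have "s < sqrt (d\<^sup>2)" unfolding s_def by (rule real_sqrt_less_mono) (use e in simp)
      then have s: "0 \<le> s" "s < d" using a True by (auto simp: s_def d_def)
      have "bounded_below (\<lambda>x. (\<lambda>y. T y - (m + s) *\<^sub>R y) (T x - (m - s) *\<^sub>R x))"
        by (rule bounded_below_comp; rule a(3)) (use s a in \<open>auto simp: m_def d_def field_simps\<close>)
      moreover have "(\<lambda>y. T y - (m + s) *\<^sub>R y) (T x - (m - s) *\<^sub>R x) = B x + e *\<^sub>R x" for x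
      proof -
        have "D (D x) - (s * s) *\<^sub>R x = (\<lambda>y. T y - (m + s) *\<^sub>R y) (T x - (m - s) *\<^sub>R x)"
          by (simp add: D_def hermitian_diff[OF hT] hermitian_add[OF hT] hermitian_scaleR[OF hT] algebra_simps)
        then show ?thesis by (simp add: B_def s2 algebra_simps)
      qed
      ultimately show ?thesis by simp
    next
      case False
      have "(e - d\<^sup>2) * norm x \<le> norm (B x + e *\<^sub>R x)" for x
      proof (cases "x = 0")
        case nz: False
        have "(e - d\<^sup>2) * (norm x)\<^sup>2 \<le> (norm (D x))\<^sup>2 + (e - d\<^sup>2) * (norm x)\<^sup>2" by simp
        also have "\<dots> = inner (B x + e *\<^sub>R x) x"
          using hermitian_inner[OF hD, of "D x" x]
          by (simp add: B_def inner_add_left inner_diff_left power2_norm_eq_inner algebra_simps)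
        also have "\<dots> \<le> norm (B x + e *\<^sub>R x) * norm x" by (rule norm_cauchy_schwarz)
        finally show ?thesis using nz by (simp add: power2_eq_square)
      qed simp
      then show ?thesis unfolding bounded_below_def using False by (intro exI[of _ "e - d\<^sup>2"]) auto
    qed
  qed
  have Beq: "B x = (\<lambda>y. a *\<^sub>R y - T y) (x - T x)" for x
  proof -
    have "m + m = 1 + a" "m * m - d\<^sup>2 = a" by (simp_all add: m_def d_def power2_eq_square field_simps)
    have "B x = T (T x) - (m + m) *\<^sub>R T x + (m * m - d\<^sup>2) *\<^sub>R x"
      by (simp only: B_def D_def hermitian_diff[OF hT] hermitian_scaleR[OF hT] scaleR_add_left
          scaleR_diff_left scaleR_diff_right scaleR_scaleR) simp
    also have "\<dots> = (\<lambda>y. a *\<^sub>R y - T y) (x - T x)"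
      unfolding \<open>m + m = 1 + a\<close> \<open>m * m - d\<^sup>2 = a\<close> by (simp add: hermitian_diff[OF hT] algebra_simps)
    finally show ?thesis .
  qed
  define S where "S = psqrt (\<lambda>x. x - T x)"
  have SS: "S (S x) = x - T x" for x unfolding S_def by (rule psqrt_square[OF one_minus_T_pos])
  have hS: "hermitian S" unfolding S_def by (rule positive_hermitian[OF psqrt_positive[OF one_minus_T_pos]])
  have ST: "T (S x) = S (T x)" for x
    unfolding S_def by (rule psqrt_commute[OF one_minus_T_pos hermitian_bounded[OF hT]]) (simp add: hermitian_diff[OF hT])
  have le_range: "inner (T (S y)) (S y) \<le> a * (norm (S y))\<^sup>2" for y
  proof -
    have "B y = S (a *\<^sub>R S y - T (S y))"
      by (simp add: Beq hermitian_diff[OF hS] hermitian_scaleR[OF hS] ST[symmetric] SS)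
    then have "0 \<le> inner (a *\<^sub>R S y - T (S y)) (S y)"
      using positive_inner[OF pB, of y] hermitian_inner[OF hS] by simp
    then show ?thesis by (simp add: inner_diff_left power2_norm_eq_inner)
  qed
  have le_closure: "inner (T x) x \<le> a * (norm x)\<^sup>2" if "x \<in> closure (range S)" for x
  proof -
    have "\<exists>u. (\<forall>n. u n \<in> range S) \<and> u \<longlonglongrightarrow> x" using that unfolding closure_sequential .
    then obtain u where u: "(\<forall>n. u n \<in> range S) \<and> u \<longlonglongrightarrow> x" ..
    have le: "inner (T (u n)) (u n) \<le> a * (norm (u n))\<^sup>2" for n
    proof -
      obtain v where "u n = S v" using u by blast
      then show ?thesis using le_range[of v] by simp
    qed
    show ?thesis
    proof (rule LIMSEQ_le)
      show "(\<lambda>n. inner (T (u n)) (u n)) \<longlonglongrightarrow> inner (T x) x"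
        by (intro tendsto_inner bounded_linear.tendsto[OF hermitian_bounded[OF hT]] u[THEN conjunct2])
      show "(\<lambda>n. a * (norm (u n))\<^sup>2) \<longlonglongrightarrow> a * (norm x)\<^sup>2" by (intro tendsto_intros u[THEN conjunct2])
      show "\<exists>N. \<forall>n\<ge>N. inner (T (u n)) (u n) \<le> a * (norm (u n))\<^sup>2" using le by blast
    qed
  qed
  note sub = csubspace_closure[OF csubspace_range[OF hermitian_clinear[OF hS]]]
  have dense: "x \<in> closure (range S)" if x: "P x = 0" for x
  proof -
    obtain y where y: "y \<in> closure (range S)" "x - y \<in> orthocomplement (closure (range S))"
      using closed_subspace_decomposition[OF sub closed_closure] by blast
    have ran: "S v \<in> closure (range S)" for v by (rule subsetD[OF closure_subset]) simp
    have "cinner (x - y) (S v) = 0" for v using y(2) ran[of v] unfolding orthocomplement_def by blast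
    then have "S (x - y) = 0" by (rule_tac cinner_eqI) (simp only: hermitian_cinner[OF hS] cinner.zero_left)
    then have "(x - y) - T (x - y) = 0" using SS[of "x - y"] hermitian_zero[OF hS] by simp
    then have ker: "P (x - y) = x - y" unfolding P_fixed kernel_iff by simp
    have "cinner (x - y) y = 0" using y unfolding orthocomplement_def by blast
    moreover have "cinner (x - y) x = 0"
      using hermitian_cinner[OF hP, of "x - y" x] ker x by (simp add: cinner.zero_right)
    ultimately have "cinner (x - y) (x - y) = 0" by (simp only: cinner.diff_right) simp
    then show ?thesis using y(1) by (simp add: cinner_self)
  qed
  show ?thesis
  proof (rule that[of "1 - a"])
    show "(1 - a) * (norm x)\<^sup>2 \<le> inner (x - T x) x" if "P x = 0" for x
      using le_closure[OF dense[OF that]] by (simp add: inner_diff_left power2_norm_eq_inner algebra_simps)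
  qed (use a in simp)
qed

text \<open>\<open>R0\<close> is the inverse of \<open>1 - T + P\<close>. Its root \<open>Z\<close> is the normalization under which the form of \<open>H\<close>
  becomes that of \<open>1 - P\<close>; see \<open>Z_form\<close> below.\<close>

definition R0 :: "'a \<Rightarrow> 'a" where
  "R0 = (SOME R. positive_op R \<and> (\<forall>x. R x - T (R x) + P (R x) = x) \<and> (\<forall>x. R (x - T x + P x) = x))"

definition Z :: "'a \<Rightarrow> 'a" where "Z = psqrt R0"
definition G :: "'a \<Rightarrow> 'a" where "G = psqrt T"
definition Q :: "'a \<Rightarrow> 'a" where "Q x = x - P x"

lemma R0: "positive_op R0" "R0 x - T (R0 x) + P (R0 x) = x" "R0 (x - T x + P x) = x"
proof -
  obtain d where d: "0 < d" "\<And>x. P x = 0 \<Longrightarrow> d * (norm x)\<^sup>2 \<le> inner (x - T x) x"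
    by (rule gap_coercive) (rule that)
  define k where "k = min d 1"
  have k: "0 < k" "k \<le> d" "k \<le> 1" using d(1) by (auto simp: k_def)
  have hB: "hermitian (\<lambda>x. x - T x + P x)"
    by (rule hermitian_add_op[OF hermitian_diff_op[OF hermitian_id hT] hP])
  have co: "k * (norm x)\<^sup>2 \<le> inner (x - T x + P x) x" for x
  proof -
    let ?y = "x - P x"
    have "P ?y = 0" by (simp add: hermitian_diff[OF hP] projection_idem[OF P])
    then have "k * (norm ?y)\<^sup>2 \<le> inner (?y - T ?y) ?y"
      using d(2)[of ?y] mult_right_mono[OF k(2), of "(norm ?y)\<^sup>2"] by simp
    also have "?y - T ?y = x - T x" by (simp add: hermitian_diff[OF hT] TP)
    also have "inner (x - T x) ?y = inner (x - T x) x"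
      using hermitian_inner[OF hP, of "x - T x" x]
      by (simp add: inner_diff_right hermitian_diff[OF hP] PT)
    finally have "k * (norm ?y)\<^sup>2 \<le> inner (x - T x) x" .
    moreover have "k * (norm (P x))\<^sup>2 \<le> inner (P x) x"
      using mult_right_mono[OF k(3), of "(norm (P x))\<^sup>2"] by (simp add: projection_form[OF P])
    ultimately show ?thesis
      using projection_pythagoras[OF P, of x] by (simp add: inner_add_left algebra_simps)
  qed
  have "\<exists>R. positive_op R \<and> (\<forall>x. R x - T (R x) + P (R x) = x) \<and> (\<forall>x. R (x - T x + P x) = x)"
    using coercive_invertible[OF hB k(1) co] by metis
  from someI_ex[OF this, folded R0_def]
  show "positive_op R0" "R0 x - T (R0 x) + P (R0 x) = x" "R0 (x - T x + P x) = x" by blast+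
qed

lemma Z: "positive_op Z" and ZZ: "Z (Z x) = R0 x" and G: "positive_op G" and GG: "G (G x) = T x"
  unfolding Z_def G_def by (rule psqrt_positive[OF R0(1)] psqrt_square[OF R0(1)] psqrt_positive[OF T_pos] psqrt_square[OF T_pos])+

lemmas hZ = positive_hermitian[OF Z] and hG = positive_hermitian[OF G]
  and hR0 = positive_hermitian[OF R0(1)]

lemma Q: "orthogonal_projection Q" unfolding Q_def by (rule projection_complement[OF P])

lemmas hQ = projection_hermitian[OF Q]

lemma T_R0: "T (R0 x) = R0 (T x)"
proof -
  have "T (R0 x) = R0 (T (R0 x) - T (T (R0 x)) + P (T (R0 x)))" by (rule R0(3)[symmetric])
  also have "T (R0 x) - T (T (R0 x)) + P (T (R0 x)) = T (R0 x - T (R0 x) + P (R0 x))"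
    by (simp add: hermitian_add[OF hT] hermitian_diff[OF hT] TP PT)
  also have "\<dots> = T x" by (simp only: R0(2))
  finally show ?thesis .
qed

lemma R0_P: "R0 (P x) = P x"
  using R0(3)[of "P x"] by (simp add: TP projection_idem[OF P])

lemma P_R0: "P (R0 x) = P x"
  by (rule cinner_eqI) (simp add: hermitian_cinner[OF hP] hermitian_cinner[OF hR0] R0_P)

lemma Z_P: "Z (P x) = P x" by (rule positive_root_fixed[OF Z]) (simp add: ZZ R0_P)
lemma G_P: "G (P x) = P x" by (rule positive_root_fixed[OF G]) (simp add: GG TP)

lemma P_Z: "P (Z x) = P x"
  by (rule cinner_eqI) (simp add: hermitian_cinner[OF hP] hermitian_cinner[OF hZ] Z_P)

lemma P_G: "P (G x) = P x"
  by (rule cinner_eqI) (simp add: hermitian_cinner[OF hP] hermitian_cinner[OF hG] G_P)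

lemma Q_Z: "Q (Z x) = Z (Q x)" and Q_G: "Q (G x) = G (Q x)"
  by (simp_all add: Q_def P_Z P_G Z_P G_P hermitian_diff[OF hZ] hermitian_diff[OF hG])

lemma T_Z: "T (Z x) = Z (T x)"
  unfolding Z_def by (rule psqrt_commute[OF R0(1) hermitian_bounded[OF hT] T_R0])

lemma Z_G: "Z (G x) = G (Z x)"
  unfolding G_def by (rule psqrt_commute[OF T_pos hermitian_bounded[OF hZ] T_Z[symmetric]])

lemma Z_form: "Z (Z x - T (Z x)) = Q x"
  using R0(2)[of x] by (simp add: Q_def hermitian_diff[OF hZ] T_Z[symmetric] ZZ[symmetric] P_Z)
    (simp add: ZZ T_Z[symmetric] P_R0 eq_diff_eq)

text \<open>For \<open>x\<close> orthogonal to \<open>ker H\<close> the equation \<open>H x = y\<close> reads \<open>(1 - T) x = T y\<close>, and \<open>1 - T\<close> agrees on such \<open>x\<close>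
  with the invertible operator \<open>1 - T + P\<close>.\<close>

lemma partial_inverse_eq: "partial_inverse H = graph_of (\<lambda>w. R0 (T (Q w)))"
proof (intro subset_antisym subrelI)
  fix w x assume "(w, x) \<in> partial_inverse H"
  then obtain z y where z: "z \<in> op_kernel H" and xy: "(x, y) \<in> H" and x: "x \<in> orthocomplement (op_kernel H)"
    and w: "w = z + y" unfolding partial_inverse_def by blast
  have Px: "P x = 0" using x P_zero by blast
  have Txy: "T (y + x) = x" using xy by (simp add: H_iff)
  have "P (y + x) = 0" using PT[of "y + x"] Txy Px by simp
  then have Py: "P y = 0" using Px by (simp add: hermitian_add[OF hP])
  have Pz: "P z = z" using z P_fixed by blast
  have "Q w = y" by (simp add: Q_def w hermitian_add[OF hP] Py Pz)
  moreover have "T y = x - T x + P x" using Txy Px by (simp add: hermitian_add[OF hT] eq_diff_eq)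
  ultimately have "R0 (T (Q w)) = x" by (simp only: R0(3))
  then show "(w, x) \<in> graph_of (\<lambda>w. R0 (T (Q w)))" by (simp add: graph_of_iff)
next
  fix w x assume "(w, x) \<in> graph_of (\<lambda>w. R0 (T (Q w)))"
  then have x: "x = R0 (T (Q w))" by (simp add: graph_of_iff)
  have Px: "P x = 0"
    by (simp add: x P_R0 PT Q_def hermitian_diff[OF hP] projection_idem[OF P])
  have "x - T x + P x = T (Q w)" unfolding x by (rule R0(2))
  then have "T (Q w + x) = x" using Px by (simp add: hermitian_add[OF hT] diff_eq_eq)
  then have "(x, Q w) \<in> H" by (simp add: H_iff)
  moreover have "P w \<in> op_kernel H" using range_P by blast
  moreover have "w = P w + Q w" by (simp add: Q_def)
  ultimately show "(w, x) \<in> partial_inverse H"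
    using Px P_zero unfolding partial_inverse_def by blast
qed

text \<open>\<open>G Z Q\<close> is a product of commuting positive operators with square \<open>T R0 Q\<close>.\<close>

lemma op_sqrt_partial_inverse: "op_sqrt (partial_inverse H) = graph_of (\<lambda>x. G (Z (Q x)))"
proof -
  have pQ: "positive_op Q" using Q hQ projection_form[OF Q] by (simp add: positive_op_def)
  have pZQ: "positive_op (\<lambda>x. Z (Q x))" by (rule positive_comp[OF Z pQ Q_Z[symmetric]])
  have pX: "positive_op (\<lambda>x. G (Z (Q x)))"
    by (rule positive_comp[OF G pZQ]) (simp add: Q_G Z_G)
  have sq: "G (Z (Q (G (Z (Q x))))) = R0 (T (Q x))" for x
    by (simp only: Q_G Q_Z projection_idem[OF Q] Z_G GG ZZ T_R0)
  have pA: "positive_op (\<lambda>x. R0 (T (Q x)))"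
    using hermitian_square_positive[OF positive_hermitian[OF pX]] unfolding sq .
  have "(\<lambda>x. G (Z (Q x))) = psqrt (\<lambda>x. R0 (T (Q x)))" by (rule psqrt_unique[OF pX sq pA])
  then show ?thesis unfolding partial_inverse_eq by (simp add: op_sqrt_graph[OF pA])
qed

lemma add_scalar_eq: "add_scalar H 1 = (graph_of T)\<inverse>"
proof (intro subset_antisym subrelI)
  fix x y assume "(x, y) \<in> add_scalar H 1"
  then obtain w where "(x, w) \<in> H" "y = w + x" unfolding add_scalar_def by auto
  then show "(x, y) \<in> (graph_of T)\<inverse>" by (simp add: H_iff graph_of_iff)
next
  fix x y assume "(x, y) \<in> (graph_of T)\<inverse>"
  then have "(x, y - x) \<in> H" by (simp add: H_iff graph_of_iff)
  then show "(x, y) \<in> add_scalar H 1" unfolding add_scalar_def by force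
qed

lemma op_sqrt_add_scalar: "op_sqrt (add_scalar H 1) = (graph_of G)\<inverse>"
  unfolding add_scalar_eq G_def by (rule op_sqrt_converse_graph[OF T_pos T_inj])

lemma G_inj: "G x = 0 \<Longrightarrow> x = 0"
  using T_inj[of x] GG[of x] hermitian_zero[OF hG] by simp

lemma form_domain_eq: "form_domain H = range G"
  unfolding form_domain_def op_sqrt_add_scalar by (auto simp: graph_of_def)

lemma op_apply_G: "op_apply (op_sqrt (add_scalar H 1)) (G u) = u"
  unfolding op_sqrt_add_scalar op_apply_def
proof (rule the_equality)
  fix y assume "(G u, y) \<in> (graph_of G)\<inverse>"
  then have "G (y - u) = 0" by (simp add: graph_of_iff hermitian_diff[OF hG])
  then have "y - u = 0" by (rule G_inj)
  then show "y = u" by simp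
qed (simp add: graph_of_iff)

lemma form_of_G: "form_of H (G u) (G v) = cinner (u - T u) v"
  by (simp add: form_of_def op_apply_G hermitian_cinner[OF hG, symmetric] GG cinner.diff_left)

lemma plus_norm_G: "plus_norm H (G u) = norm u"
proof -
  have "Re (form_of H (G u) (G u)) + (norm (G u))\<^sup>2 = (norm u)\<^sup>2"
    unfolding form_of_G power2_norm_eq_inner using hermitian_inner[OF hG, of "G u" u]
    by (simp add: inner_eq_Re_cinner[symmetric] GG inner_diff_left)
  then show ?thesis by (simp add: plus_norm_def)
qed

end

section \<open>The perturbed operator\<close>

locale form_perturbation = isolated_zero H
  for H :: "'a::complex_hilbert operator" +
  fixes V :: "'a \<Rightarrow> 'a \<Rightarrow> complex"
  assumes fb: "form_bounded_operator H V" and fs: "form_symmetric H V" and fc: "form_compact H V"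
begin

lemma G_form_domain: "G u \<in> form_domain H"
  unfolding form_domain_eq by simp

lemma antidual_Riesz:
  assumes f: "f \<in> antidual H" shows "\<exists>z. \<forall>v. f (G v) = cinner z v"
proof -
  obtain C where C: "\<And>x. x \<in> form_domain H \<Longrightarrow> cmod (f x) \<le> C * plus_norm H x"
    using f unfolding antidual_def by blast
  show ?thesis
  proof (rule Riesz_representation)
    show "f (G (x + y)) = f (G x) + f (G y)" for x y
      using f G_form_domain unfolding antidual_def by (simp add: hermitian_add[OF hG])
    show "f (G (a *\<^sub>C x)) = cnj a * f (G x)" for a x
      using f G_form_domain unfolding antidual_def by (simp add: hermitian_scaleC[OF hG])
    show "cmod (f (G x)) \<le> C * norm x" for x
      using C[OF G_form_domain, of x] by (simp add: plus_norm_G)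
  qed
qed

text \<open>The supremum is tested on \<open>z / \<parallel>z\<parallel>\<close>; for \<open>z = 0\<close> this is \<open>0\<close>, since \<open>1 / 0 = 0\<close>.\<close>

lemma norm_le_minus_norm:
  assumes f: "\<And>v. f (G v) = cinner z v" shows "norm z \<le> minus_norm H f"
  unfolding minus_norm_def
proof (rule cSup_upper)
  let ?v = "(1 / norm z) *\<^sub>R z"
  have "cmod (f (G ?v)) = norm z"
    by (simp add: f cinner_scaleR_right cinner_self norm_mult norm_divide power2_eq_square)
  moreover have "plus_norm H (G ?v) \<le> 1" unfolding plus_norm_G by simp
  ultimately show "norm z \<in> {cmod (f x) |x. x \<in> form_domain H \<and> plus_norm H x \<le> 1}"
    using G_form_domain by (intro CollectI exI[of _ "G ?v"]) simp
  show "bdd_above {cmod (f x) |x. x \<in> form_domain H \<and> plus_norm H x \<le> 1}"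
  proof (rule bdd_aboveI[of _ "norm z"])
    fix s assume "s \<in> {cmod (f x) |x. x \<in> form_domain H \<and> plus_norm H x \<le> 1}"
    then obtain x where x: "s = cmod (f x)" "x \<in> form_domain H" "plus_norm H x \<le> 1" by blast
    then obtain u where u: "x = G u" unfolding form_domain_eq by blast
    have "s \<le> norm z * norm u" unfolding x(1) u f by (rule cmod_cinner_le)
    also have "\<dots> \<le> norm z" using x(3) by (simp add: u plus_norm_G mult_left_le)
    finally show "s \<le> norm z" .
  qed
qed

text \<open>The form of \<open>V\<close> transported to the Hilbert space by the unitary \<open>G\<close> onto the form domain.\<close>

definition W :: "'a \<Rightarrow> 'a" where
  "W u = (SOME z. \<forall>v. V (G u) (G v) = cinner z v)"

lemma W: "V (G u) (G v) = cinner (W u) v"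
proof -
  have "V (G u) \<in> antidual H" using fb G_form_domain unfolding form_bounded_operator_def by blast
  from someI_ex[OF antidual_Riesz[OF this], folded W_def] show ?thesis by blast
qed

lemma hW: "hermitian W"
proof -
  have sym: "cinner (W u) v = cinner u (W v)" for u v
  proof -
    have "V (G u) (G v) = cnj (V (G v) (G u))"
      using fs G_form_domain unfolding form_symmetric_def by blast
    then show ?thesis by (simp add: W) (rule cinner_commute[symmetric])
  qed
  have add: "W (x + y) = W x + W y" for x y by (rule cinner_eqI) (simp add: sym cinner_simps)
  have sc: "W (a *\<^sub>C x) = a *\<^sub>C W x" for a x by (rule cinner_eqI) (simp add: sym cinner_simps)
  obtain C where C: "\<And>x. x \<in> form_domain H \<Longrightarrow> minus_norm H (V x) \<le> C * plus_norm H x"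
    using fb unfolding form_bounded_operator_def by blast
  have "norm (W u) \<le> norm u * C" for u
    using norm_le_minus_norm[of "V (G u)" "W u", OF W] C[OF G_form_domain, of u]
    by (simp add: plus_norm_G mult.commute)
  moreover have "W (r *\<^sub>R x) = r *\<^sub>R W x" for r x using sc[of "complex_of_real r" x] by (simp add: scaleC_of_real)
  ultimately have "bounded_linear W" using add by (intro bounded_linear_intro) auto
  then show ?thesis using add sc sym by (simp add: hermitian_def clinear_map_def)
qed

lemma W_compact: "compact_map W"
  unfolding compact_map_def
proof (intro allI impI)
  fix u :: "nat \<Rightarrow> 'a" and C assume u: "\<forall>n. norm (u n) \<le> C"
  have "\<forall>n. G (u n) \<in> form_domain H \<and> plus_norm H (G (u n)) \<le> C"
    using u G_form_domain by (simp add: plus_norm_G)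
  then have "\<exists>f\<in>antidual H. \<exists>r. strict_mono r \<and>
      (\<lambda>k. minus_norm H (\<lambda>y. V (G (u (r k))) y - f y)) \<longlonglongrightarrow> 0"
    by (rule fc[unfolded form_compact_def, THEN spec[of _ "\<lambda>n. G (u n)"], THEN spec[of _ C], THEN mp])
  then obtain f r where f: "f \<in> antidual H" and r: "strict_mono r"
    "(\<lambda>k. minus_norm H (\<lambda>y. V (G (u (r k))) y - f y)) \<longlonglongrightarrow> 0"
    by (elim bexE exE conjE) (rule that)
  obtain z where z: "\<And>v. f (G v) = cinner z v" using antidual_Riesz[OF f] by blast
  have "norm (W (u (r k)) - z) \<le> minus_norm H (\<lambda>y. V (G (u (r k))) y - f y)" for k
    by (rule norm_le_minus_norm) (simp add: W z cinner.diff_left)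
  then have "(\<lambda>k. W (u (r k)) - z) \<longlonglongrightarrow> 0"
    by (intro Lim_null_comparison[OF _ r(2)]) simp
  then have "(\<lambda>k. W (u (r k))) \<longlonglongrightarrow> z" by (rule LIM_zero_cancel)
  then show "\<exists>r l. strict_mono r \<and> (\<lambda>n. W (u (r n))) \<longlonglongrightarrow> l" using r(1) by blast
qed

text \<open>The range of \<open>G\<close> is dense, and for \<open>l = G y\<close> the inner products are \<open>\<langle>y|G (u n)\<rangle>\<close>.\<close>

lemma weakly_null:
  assumes C: "\<And>n. norm (u n) \<le> C" and lim: "(\<lambda>n. G (u n)) \<longlonglongrightarrow> 0"
  shows "(\<lambda>n. inner l (u n)) \<longlonglongrightarrow> 0"
proof (rule LIMSEQ_I)
  fix e :: real assume e: "0 < e"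
  have C0: "0 \<le> C" using C[of 0] norm_ge_zero[of "u 0"] by linarith
  have "l \<in> closure (range G)" using hermitian_range_dense[OF hG G_inj] by simp
  then obtain x where x: "x \<in> range G" "dist x l < e / (2 * (C + 1))"
    using e C0 unfolding closure_approachable by (meson divide_pos_pos mult_pos_pos zero_less_numeral add_nonneg_pos zero_less_one)
  then obtain y where y: "x = G y" by blast
  have "(\<lambda>n. inner y (G (u n))) \<longlonglongrightarrow> inner y 0" by (intro tendsto_intros lim)
  from LIMSEQ_D[OF this, of "e / 2"] e obtain N where
    N: "\<And>n. n \<ge> N \<Longrightarrow> \<bar>inner y (G (u n))\<bar> < e / 2" by auto
  have "norm (inner l (u n) - 0) < e" if "n \<ge> N" for n
  proof -
    have "\<bar>inner (l - x) (u n)\<bar> \<le> norm (l - x) * norm (u n)" by (rule Cauchy_Schwarz_ineq2)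
    also have "\<dots> \<le> e / (2 * (C + 1)) * C"
      using x(2) C[of n] e C0 by (intro mult_mono) (auto simp: dist_norm norm_minus_commute)
    also have "\<dots> \<le> e / 2" using e C0 by (simp add: field_simps)
    finally have "\<bar>inner (l - x) (u n)\<bar> \<le> e / 2" .
    moreover have "inner x (u n) = inner y (G (u n))" unfolding y by (rule hermitian_inner[OF hG])
    moreover have "inner l (u n) = inner (l - x) (u n) + inner x (u n)" by (simp add: inner_diff_left)
    ultimately show ?thesis using N[OF that] by simp
  qed
  then show "\<exists>N. \<forall>n\<ge>N. norm (inner l (u n) - 0) < e" by blast
qed

lemma norm_G: "(norm (G x))\<^sup>2 = inner (T x) x"
  using hermitian_inner[OF hG, of "G x" x] by (simp add: GG power2_norm_eq_inner)

text \<open>Form compactness makes \<open>V\<close> infinitesimally form bounded: a sequence of unit vectors that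
  violates the bound for larger and larger \<open>c\<close> would be weakly null, and then
  \<open>\<langle>W u|u\<rangle>\<close> would tend to zero along a subsequence, although the violation keeps it below \<open>-1/2\<close>.\<close>

lemma relative_bound:
  obtains c :: real where "\<And>u. (1/2) * (norm u)\<^sup>2 \<le> inner (u + (c - 1) *\<^sub>R T u + W u) u"
proof (rule ccontr)
  assume "\<not> thesis"
  then have no: "\<not> (\<forall>u. (1/2) * (norm u)\<^sup>2 \<le> inner (u + (c - 1) *\<^sub>R T u + W u) u)" for c using that by blast
  have "\<exists>v. norm v = 1 \<and> 1 + real n * inner (T v) v + inner (W v) v < 1/2" for n :: nat
  proof -
    obtain u where u: "inner (u + real n *\<^sub>R T u + W u) u < (1/2) * (norm u)\<^sup>2"
      using no[of "real n + 1"] by (auto simp: not_le)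
    have u0: "u \<noteq> 0" using u by auto
    let ?v = "(1 / norm u) *\<^sub>R u"
    have "1 + real n * inner (T ?v) ?v + inner (W ?v) ?v
        = inner (u + real n *\<^sub>R T u + W u) u / (norm u)\<^sup>2"
      using u0 by (simp add: hermitian_scaleR[OF hT] hermitian_scaleR[OF hW] inner_add_left
          power2_norm_eq_inner[symmetric] power2_eq_square add_divide_distrib)
    also have "\<dots> < 1/2" using u u0 by (simp add: divide_less_eq)
    finally show ?thesis using u0 by (intro exI[of _ ?v]) simp
  qed
  then obtain v where v: "\<And>n. norm (v n) = 1" "\<And>n::nat. 1 + real n * inner (T (v n)) (v n) + inner (W (v n)) (v n) < 1/2"
    by metis
  obtain w where w: "w > 0" "\<And>x. \<bar>inner (W x) x\<bar> \<le> w * (norm x)\<^sup>2"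
    using hermitian_inner_bound[OF hW] by metis

  have "(norm (G (v (Suc n))))\<^sup>2 \<le> w * (1 / real (Suc n))" for n
  proof -
    have "real (Suc n) * inner (T (v (Suc n))) (v (Suc n)) \<le> w"
      using v(2)[of "Suc n"] w(2)[of "v (Suc n)"] v(1)[of "Suc n"] by (simp add: abs_le_iff)
    then show ?thesis unfolding norm_G by (simp add: field_simps)
  qed
  moreover have "(\<lambda>n. w * (1 / real (Suc n))) \<longlonglongrightarrow> 0"
    using tendsto_mult[OF tendsto_const[of w] LIMSEQ_Suc[OF lim_1_over_n]] by simp
  ultimately have "(\<lambda>n. (norm (G (v (Suc n))))\<^sup>2) \<longlonglongrightarrow> 0"
    by (intro Lim_null_comparison[of "\<lambda>n. (norm (G (v (Suc n))))\<^sup>2" "\<lambda>n. w * (1 / real (Suc n))"]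
        always_eventually allI) simp_all
  then have "(\<lambda>n. norm (G (v (Suc n)))) \<longlonglongrightarrow> 0"
    using tendsto_real_sqrt[of "\<lambda>n. (norm (G (v (Suc n))))\<^sup>2" 0] by simp
  then have Gv: "(\<lambda>n. G (v (Suc n))) \<longlonglongrightarrow> 0" by (rule tendsto_norm_zero_cancel)
  have v1: "norm (v (Suc n)) \<le> 1" for n using v(1) by simp
  obtain r l where r: "strict_mono r" "(\<lambda>n. W (v (Suc (r n)))) \<longlonglongrightarrow> l"
    by (rule compact_mapD[OF W_compact v1]) (rule that)
  let ?u = "\<lambda>n. v (Suc (r n))"
  have "(\<lambda>n. G (?u n)) \<longlonglongrightarrow> 0" using LIMSEQ_subseq_LIMSEQ[OF Gv r(1)] by (simp add: o_def)
  then have lu: "(\<lambda>n. inner l (?u n)) \<longlonglongrightarrow> 0" by (rule weakly_null[of ?u 1, rotated]) (simp add: v)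
  have "(\<lambda>n. inner (W (?u n) - l) (?u n)) \<longlonglongrightarrow> 0"
  proof (rule Lim_null_comparison)
    show "\<forall>\<^sub>F n in sequentially. norm (inner (W (?u n) - l) (?u n)) \<le> norm (W (?u n) - l)"
      using Cauchy_Schwarz_ineq2[of "W (?u _) - l" "?u _"] by (simp add: v)
    show "(\<lambda>n. norm (W (?u n) - l)) \<longlonglongrightarrow> 0"
      using tendsto_norm[OF tendsto_diff[OF r(2) tendsto_const[of l]]] by simp
  qed
  from tendsto_add[OF this lu] have "(\<lambda>n. inner (W (?u n)) (?u n)) \<longlonglongrightarrow> 0"
    by (simp add: inner_diff_left)
  moreover have "inner (W (?u n)) (?u n) \<le> - (1/2)" for n
  proof -
    have "0 \<le> real (Suc (r n)) * inner (T (?u n)) (?u n)"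
      by (intro mult_nonneg_nonneg positive_inner[OF T_pos]) simp
    then show ?thesis using v(2)[of "Suc (r n)"] by linarith
  qed
  ultimately have "0 \<le> - (1/2 :: real)" using LIMSEQ_le_const2 by blast
  then show False by simp
qed

lemma form_sum_iff: "(x, z) \<in> form_sum H V \<longleftrightarrow> (\<exists>u. x = G u \<and> u - T u + W u = G z)"
proof
  assume "(x, z) \<in> form_sum H V"
  then obtain u where u: "x = G u" and eq: "\<And>v. form_of H (G u) (G v) + V (G u) (G v) = cinner z (G v)"
    unfolding form_sum_def form_domain_eq by blast
  have "u - T u + W u = G z"
    by (rule cinner_eqI) (use eq in \<open>simp add: form_of_G W cinner.add_left hermitian_cinner[OF hG]\<close>)
  then show "\<exists>u. x = G u \<and> u - T u + W u = G z" using u by blast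
next
  assume "\<exists>u. x = G u \<and> u - T u + W u = G z"
  then obtain u where u: "x = G u" "u - T u + W u = G z" by blast
  have "form_of H (G u) (G v) + V (G u) (G v) = cinner z (G v)" for v
    unfolding form_of_G W cinner.add_left[symmetric] u(2) by (rule hermitian_cinner[OF hG])
  then show "(x, z) \<in> form_sum H V" unfolding form_sum_def form_domain_eq u(1) by blast
qed

text \<open>In terms of \<open>x = G u\<close>, the equation \<open>(H\<^sub>V + c) x = y\<close> reads \<open>(1 + (c - 1) T + W) u = G y\<close>, and the
  operator on the left is coercive for suitable \<open>c\<close>.\<close>

lemma form_sum_shifted_inverse:
  obtains T' c where "inverse_of_positive T'" "form_sum H V = shifted_inverse T' c"
    "\<And>u. - c * (norm (G u))\<^sup>2 \<le> inner (u - T u + W u) u"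
proof -
  obtain c where c: "\<And>u. (1/2) * (norm u)\<^sup>2 \<le> inner (u + (c - 1) *\<^sub>R T u + W u) u"
    by (rule relative_bound) (rule that)
  have hB: "hermitian (\<lambda>u. u + (c - 1) *\<^sub>R T u + W u)"
    by (rule hermitian_add_op[OF hermitian_add_op[OF hermitian_id hermitian_scaleR_op[OF hT]] hW])
  have half: "0 < (1/2 :: real)" by simp
  obtain R where R: "positive_op R" "\<And>x. R x + (c - 1) *\<^sub>R T (R x) + W (R x) = x"
    "\<And>x. R (x + (c - 1) *\<^sub>R T x + W x) = x"
    by (rule coercive_invertible[OF hB half c]) (rule that)
  note hR = positive_hermitian[OF R(1)]
  define T' where "T' x = G (R (G x))" for x
  have "inverse_of_positive T'"
  proof
    have form: "inner (T' x) x = inner (R (G x)) (G x)" for x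
      unfolding T'_def by (rule hermitian_inner[OF hG])
    have "hermitian T'" unfolding T'_def by (rule hermitian_sandwich[OF hG hR])
    then show "positive_op T'" using positive_inner[OF R(1)] by (simp add: positive_op_def form)
    show "x = 0" if "T' x = 0" for x
    proof -
      have "inner (R (G x)) (G x) = 0" using form[of x] that by simp
      then have "R (G x) = 0" by (rule positive_inner_eq_0[OF R(1)])
      then have "G x = 0" using R(2)[of "G x"] by (simp add: hermitian_zero[OF hT] hermitian_zero[OF hW])
      then show ?thesis by (rule G_inj)
    qed
  qed
  moreover have "form_sum H V = shifted_inverse T' c"
  proof (intro subset_antisym subrelI)
    fix x z assume "(x, z) \<in> form_sum H V"
    then obtain u where u: "x = G u" "u - T u + W u = G z" unfolding form_sum_iff by blast
    define y where "y = z + c *\<^sub>R x"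
    have "G y = u + (c - 1) *\<^sub>R T u + W u"
      unfolding y_def by (simp add: hermitian_add[OF hG] hermitian_scaleR[OF hG] u GG flip: u(2))
        (simp add: algebra_simps)
    then have "R (G y) = u" using R(3)[of u] by simp
    then have "x = T' y" by (simp add: T'_def u)
    moreover have "z = y - c *\<^sub>R x" by (simp add: y_def)
    ultimately show "(x, z) \<in> shifted_inverse T' c" unfolding shifted_inverse_def by blast
  next
    fix x z assume "(x, z) \<in> shifted_inverse T' c"
    then obtain y where y: "x = T' y" "z = y - c *\<^sub>R T' y" unfolding shifted_inverse_def by blast
    define u where "u = R (G y)"
    have x: "x = G u" "T' y = G u" by (simp_all add: y T'_def u_def)
    have "u + (c - 1) *\<^sub>R T u + W u = G y" unfolding u_def by (rule R(2))
    then have "u - T u + W u = G y - c *\<^sub>R T u" by (simp add: algebra_simps)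
    also have "\<dots> = G z" by (simp add: y(2) x hermitian_diff[OF hG] hermitian_scaleR[OF hG] GG)
    finally show "(x, z) \<in> form_sum H V" unfolding form_sum_iff using x by blast
  qed
  moreover have "- c * (norm (G u))\<^sup>2 \<le> inner (u - T u + W u) u" for u
  proof -
    have "u + (c - 1) *\<^sub>R T u + W u = (u - T u + W u) + c *\<^sub>R T u" by (simp add: algebra_simps)
    then have "0 \<le> inner ((u - T u + W u) + c *\<^sub>R T u) u"
      using c[of u] zero_le_power2[of "norm u"] by (metis divide_nonneg_nonneg mult_nonneg_nonneg order_trans zero_le_numeral zero_le_one)
    then show ?thesis by (simp only: inner_add_left[of _ "c *\<^sub>R T u"] norm_G) simp
  qed
  ultimately show ?thesis by (rule that)
qed

abbreviation Pm :: "'a \<Rightarrow> 'a" where "Pm \<equiv> spectral_projection (form_sum H V) {..<0}"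

text \<open>In the coordinate \<open>v\<close> with \<open>x = J v\<close> the form of \<open>H\<close> becomes that of \<open>1 - P\<close>, and the form of \<open>V\<close> that
  of \<open>Wn\<close>.\<close>

definition J :: "'a \<Rightarrow> 'a" where "J v = G (Z v)"
definition Wn :: "'a \<Rightarrow> 'a" where "Wn v = Z (W (Z v))"

lemma hWn: "hermitian Wn"
  unfolding Wn_def by (rule hermitian_sandwich[OF hZ hW])

lemma form_J: "inner (Z v - T (Z v) + W (Z v)) (Z v) = (norm (v - P v))\<^sup>2 + inner (Wn v) v"
proof -
  have "inner (Z v - T (Z v)) (Z v) = inner (Z (Z v - T (Z v))) v"
    by (rule hermitian_inner[OF hZ, symmetric])
  also have "\<dots> = (norm (v - P v))\<^sup>2"
    unfolding Z_form using projection_form[OF Q, of v] by (simp add: Q_def)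
  moreover have "inner (W (Z v)) (Z v) = inner (Wn v) v"
    unfolding Wn_def by (rule hermitian_inner[OF hZ, symmetric])
  ultimately show ?thesis by (simp add: inner_add_left)
qed

lemma range_J: "range J = range G"
proof -
  have "G u = J (Z (u - T u + P u))" for u by (simp add: J_def ZZ R0(3))
  then have "G u \<in> range J" for u by (metis rangeI)
  then show ?thesis by (auto simp: J_def)
qed

sublocale bs: birman_schwinger P Wn Pm J
proof -
  obtain T' c where T': "inverse_of_positive T'" and eq: "form_sum H V = shifted_inverse T' c"
    and semi: "\<And>u. - c * (norm (G u))\<^sup>2 \<le> inner (u - T u + W u) u"
    by (rule form_sum_shifted_inverse) (rule that)
  interpret A: semibounded_spectral_operator "spectral_projection (form_sum H V)" "form_sum H V" c
    unfolding eq by (rule inverse_of_positive.spectral_projection_semibounded[OF T'])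
  have dom: "Domain (form_sum H V) \<subseteq> range G"
  proof
    fix x assume "x \<in> Domain (form_sum H V)"
    then obtain z where "(x, z) \<in> form_sum H V" by blast
    then show "x \<in> range G" unfolding form_sum_iff by blast
  qed
  define Gi where "Gi = inv G"
  have injG: "inj G"
  proof (rule injI)
    fix x y assume "G x = G y"
    then have "G (x - y) = 0" by (simp add: hermitian_diff[OF hG])
    then have "x - y = 0" by (rule G_inj)
    then show "x = y" by simp
  qed
  have Gi: "Gi (G u) = u" for u unfolding Gi_def by (rule inv_f_f[OF injG])
  define L where "L u = u - T u + W u" for u
  have hL: "hermitian L" unfolding L_def
    by (rule hermitian_add_op[OF hermitian_diff_op[OF hermitian_id hT] hW])
  define q where "q x y = inner (L (Gi x)) (Gi y)" for x y
  have qA: "q v x = inner w x" if vw: "(v, w) \<in> form_sum H V" and x: "x \<in> range G" for v w x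
  proof -
    obtain u where u: "v = G u" "L u = G w" using vw unfolding form_sum_iff L_def by blast
    obtain y where y: "x = G y" using x by blast
    show ?thesis using hermitian_inner[OF hG, of w y] by (simp add: q_def u y Gi)
  qed
  have q_diff: "q (x - v) (x - v) = q x x - 2 * q v x + q v v" if xv: "x \<in> range G" "v \<in> range G" for x v
  proof -
    obtain a b where ab: "x = G a" "v = G b" using xv by blast
    have "x - v = G (a - b)" by (simp add: ab hermitian_diff[OF hG])
    moreover have "inner (L a) b = inner (L b) a"
      using hermitian_inner[OF hL, of a b] by (simp add: inner_commute)
    ultimately show ?thesis
      by (simp add: q_def ab Gi hermitian_diff[OF hL] inner_diff_left inner_diff_right)
  qed
  have q_semi: "- c * (norm (x - v))\<^sup>2 \<le> q (x - v) (x - v)" if xv: "x \<in> range G" "v \<in> range G" for x v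
  proof -
    obtain a b where "x = G a" "v = G b" using xv by blast
    then have "x - v = G (a - b)" by (simp add: hermitian_diff[OF hG])
    then show ?thesis using semi[of "a - b"] by (simp add: q_def Gi L_def)
  qed
  have q_J: "q (J v) (J v) = (norm (v - P v))\<^sup>2 + inner (Wn v) v" for v
    using form_J[of v] by (simp add: q_def J_def Gi L_def)
  show "birman_schwinger P Wn Pm J"
  proof
    show "orthogonal_projection P" by (rule P)
    show "hermitian Wn" by (rule hWn)
    show "orthogonal_projection Pm" by (rule A.proj) simp
    show "clinear_map J"
      by (simp add: clinear_map_def J_def hermitian_add[OF hG] hermitian_add[OF hZ]
          hermitian_scaleC[OF hG] hermitian_scaleC[OF hZ])
    show "v = 0" if "J v = 0" for v
    proof -
      have "Z v = 0" using that G_inj by (simp add: J_def)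
      then have "R0 v = 0" using ZZ[of v] by (simp add: hermitian_zero[OF hZ])
      then show ?thesis using R0(2)[of v] by (simp add: hermitian_zero[OF hT] hermitian_zero[OF hP])
    qed
    show "range Pm \<subseteq> range J"
    proof
      fix x assume "x \<in> range Pm"
      then have "Pm x = x" by (auto simp: A.idem)
      then have "x \<in> Domain (form_sum H V)" by (rule A.lower_range_Domain)
      then show "x \<in> range J" using dom range_J by blast
    qed
    show "(norm (v - P v))\<^sup>2 + inner (Wn v) v < 0" if v: "Pm (J v) = J v" "v \<noteq> 0" for v
    proof -
      have "J v \<in> Domain (form_sum H V)" by (rule A.lower_range_Domain[OF v(1)])
      then obtain z where z: "(J v, z) \<in> form_sum H V" by blast
      have ne: "J v \<noteq> 0"
      proof
        assume "J v = 0"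
        have "Z v = 0" using \<open>J v = 0\<close> G_inj by (simp add: J_def)
        then have "R0 v = 0" using ZZ[of v] by (simp add: hermitian_zero[OF hZ])
        then show False using v(2) R0(2)[of v] by (simp add: hermitian_zero[OF hT] hermitian_zero[OF hP])
      qed
      have "inner z (J v) < 0 * (norm (J v))\<^sup>2"
        by (rule A.form_less[OF _ v(1) z _ ne]) auto
      moreover have "q (J v) (J v) = inner z (J v)"
        by (rule qA[OF z]) (use range_J in blast)
      ultimately show ?thesis by (simp add: q_J)
    qed
    show "0 \<le> (norm (v - P v))\<^sup>2 + inner (Wn v) v" if v: "Pm (J v) = 0" for v
    proof -
      have "0 \<le> q (J v) (J v)"
        by (rule A.form_nonneg[where D = "range G", OF dom qA q_diff q_semi _ v]) (use range_J in auto)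
      then show ?thesis by (simp add: q_J)
    qed
  qed
qed

lemma bs_Q: "bs.Q = Q"
  by (rule ext) (simp add: bs.Q_def Q_def)

lemma V_J: "V (J x) (J y) = cinner (Wn x) y"
  by (simp add: J_def W Wn_def hermitian_cinner[OF hZ])

lemma J_P: "J (P x) = P x"
  by (simp add: J_def Z_P G_P)

lemma dual_extension_eq:
  assumes "\<And>y. cinner z y = f (R y)" shows "dual_extension R f = z"
  unfolding dual_extension_def
proof (rule the_equality)
  fix w assume "\<forall>y. cinner w y = f (R y)"
  then have "cinner w y = cinner z y" for y by (simp add: assms)
  then show "w = z" by (rule cinner_eqI)
qed (use assms in simp)

lemma op_apply_graph: "op_apply (graph_of f) = f"
  by (rule ext) (simp add: op_apply_def graph_of_iff)

lemma K_op_eq: "K_op H V = bs.K"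
proof
  fix x
  have R: "op_apply (op_sqrt (partial_inverse H)) = (\<lambda>x. J (Q x))"
    unfolding op_sqrt_partial_inverse op_apply_graph J_def ..
  have "dual_extension (\<lambda>x. J (Q x)) (V (J (Q x))) = Q (Wn (Q x))"
    by (rule dual_extension_eq) (simp add: V_J hermitian_cinner[OF hQ])
  then show "K_op H V x = bs.K x" unfolding K_op_def R Let_def bs.K_def bs_Q by simp
qed

lemma kernel_compression_eq: "kernel_compression H V = bs.C"
proof
  fix x
  have "dual_extension P (V (P x)) = P (Wn (P x))"
  proof (rule dual_extension_eq)
    fix y
    show "cinner (P (Wn (P x))) y = V (P x) (P y)"
      using V_J[of "P x" "P y"] by (simp add: J_P hermitian_cinner[OF hP])
  qed
  then show "kernel_compression H V x = bs.C x"
    unfolding kernel_compression_def Let_def bs.C_def P_def[symmetric] .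
qed

lemma Wn_nonpos: 
  assumes "form_nonpos H V" shows "positive_op (\<lambda>v. - Wn v)"
proof -
  have "inner (Wn v) v \<le> 0" for v
  proof -
    have "Re (V (J v) (J v)) \<le> 0" using assms G_form_domain unfolding form_nonpos_def J_def by blast
    then show ?thesis by (simp add: V_J inner_eq_Re_cinner)
  qed
  then show ?thesis using hermitian_minus_op[OF hWn] by (simp add: positive_op_def)
qed

text \<open>\<open>Q\<^sub>H(x, y) = 0\<close> for \<open>y \<in> ker H\<close>, so the form of \<open>V\<close> vanishes on \<open>ker H\<close> under the hypothesis.\<close>

lemma compression_zero:
  assumes "V ` op_kernel H \<subseteq> extended_range H"
  shows "cdimension (range bs.Pc) = 0"
proof -
  have "inner (bs.C v) v = 0" for v
  proof -
    have "P v \<in> op_kernel H" unfolding range_P[symmetric] by (rule rangeI)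
    from subsetD[OF assms imageI[OF this]]
    have "\<exists>x\<in>range G. \<forall>y\<in>range G. V (P v) y = form_of H x y"
      unfolding extended_range_def form_domain_eq by (rule CollectD)
    then obtain x where x: "x \<in> range G" "\<forall>y\<in>range G. V (P v) y = form_of H x y" ..
    obtain u where "x = G u" using x(1) by blast
    then have u: "V (P v) (G w) = form_of H (G u) (G w)" for w using x(2) by simp
    have "V (P v) (P v) = form_of H (G u) (P v)" using u[of "P v"] by (simp add: G_P)
    also have "\<dots> = cinner (u - T u) (P v)" using form_of_G[of u "P v"] by (simp add: G_P)
    also have "\<dots> = cinner (P (u - T u)) v" by (rule hermitian_cinner[OF hP, symmetric])
    also have "P (u - T u) = 0" by (simp add: hermitian_diff[OF hP] PT)
    finally have "V (P v) (P v) = 0" by (simp add: cinner.zero_left)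
    then have "cinner (Wn (P v)) (P v) = 0" using V_J[of "P v" "P v"] by (simp add: J_P)
    then show ?thesis unfolding bs.C_form by (simp add: inner_eq_Re_cinner)
  qed
  then have "range bs.Pc \<subseteq> {0}" using below_zero[OF bs.hC] bs.Pc by (metis insertI1 less_irrefl subsetI)
  then have "cdimension (range bs.Pc) \<le> enat (card ({} :: 'a set))" by (intro cdimension_le_card) auto
  then show ?thesis by (simp add: zero_enat_def[symmetric])
qed

end

theorem theorem7p9:
  fixes H :: "'a::{complex_hilbert, second_countable_topology} operator"
    and V :: "'a \<Rightarrow> 'a \<Rightarrow> complex"
  assumes "selfadjoint H"
    and "spectrum H \<subseteq> complex_of_real ` {0..}"
    and "0 \<in> spectrum H"
    and "form_bounded_operator H V"
    and "form_symmetric H V"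
    and "form_compact H V"
    and "0 \<in> discrete_spectrum H"
  shows "N_plus (graph_of (K_op H V)) 1 \<le> N_minus (form_sum H V) 0
    \<and> N_minus (form_sum H V) 0 \<le> N_plus (graph_of (K_op H V)) 1 + cdimension (op_kernel H)
    \<and> (\<forall>p::real. 0 < p \<longrightarrow> form_nonpos H V \<longrightarrow> K_op H V \<in> weak_schatten p \<longrightarrow>
        0 \<le> ereal_of_enat (N_minus (form_sum H V) 0)
              - ereal_of_enat (N_minus (graph_of (kernel_compression H V)) 0)
        \<and> ereal_of_enat (N_minus (form_sum H V) 0)
              - ereal_of_enat (N_minus (graph_of (kernel_compression H V)) 0)
            \<le> ereal (weak_schatten_norm p (K_op H V) powr p)
        \<and> (V ` op_kernel H \<subseteq> extended_range H \<longrightarrow>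
            ereal_of_enat (N_minus (form_sum H V) 0)
              \<le> ereal (weak_schatten_norm p (K_op H V) powr p)))"
proof -
  interpret form_perturbation H V
    by unfold_locales (use assms in auto)
  have eqs: "N_plus (graph_of (K_op H V)) 1 = cdimension (range bs.P1)"
    "N_minus (form_sum H V) 0 = cdimension (range Pm)"
    "N_minus (graph_of (kernel_compression H V)) 0 = cdimension (range bs.Pc)"
    by (simp_all add: N_plus_def N_minus_def K_op_eq kernel_compression_eq)
  have fin: "cdimension (range bs.Pc) \<noteq> \<infinity>"
  proof -
    have "eigenspace H 0 = op_kernel H" by (simp add: eigenspace_def op_kernel_def)
    then have "cdimension (range P) \<noteq> \<infinity>"
      using assms(7) by (simp add: discrete_spectrum_def range_P)
    then show ?thesis using bs.count_compression_kernel by (cases "cdimension (range bs.Pc)") auto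
  qed
  have part2: "0 \<le> ereal_of_enat (cdimension (range Pm)) - ereal_of_enat (cdimension (range bs.Pc))
      \<and> ereal_of_enat (cdimension (range Pm)) - ereal_of_enat (cdimension (range bs.Pc))
          \<le> ereal (weak_schatten_norm p bs.K powr p)
      \<and> (V ` op_kernel H \<subseteq> extended_range H \<longrightarrow>
          ereal_of_enat (cdimension (range Pm)) \<le> ereal (weak_schatten_norm p bs.K powr p))"
    if p: "0 < p" and neg: "form_nonpos H V" and ws: "bs.K \<in> weak_schatten p" for p
  proof -
    note nW = Wn_nonpos[OF neg]
    interpret compact_positive bs.K
      by standard (use ws bs.K_positive[OF nW] compact_operator_imp_compact_map in \<open>auto simp: weak_schatten_def\<close>)
    have gt: "(norm v)\<^sup>2 < inner (bs.K v) v" if "v \<in> range bs.P1" "v \<noteq> 0" for v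
      using above_one[OF bs.hK] that bs.P1 by blast
    note bound = cdimension_le_weak_schatten_norm[OF bs.csubspace_projection_range[OF bs.hP1] gt p ws]
    obtain k where k: "cdimension (range bs.P1) = enat k" using bound(1) by auto
    obtain b where b: "cdimension (range bs.Pc) = enat b" using fin by auto
    have upper: "cdimension (range Pm) \<le> enat (k + b)"
      using bs.count_compression_upper[OF nW] by (simp add: k b)
    then obtain a where a: "cdimension (range Pm) = enat a" by (cases "cdimension (range Pm)") auto
    have "b \<le> a" "a \<le> k + b" using bs.count_compression_lower upper by (simp_all add: a b)
    moreover have "real k \<le> weak_schatten_norm p bs.K powr p" using bound(2) by (simp add: k)
    moreover have "b = 0" if "V ` op_kernel H \<subseteq> extended_range H"
      using compression_zero[OF that] by (simp add: b zero_enat_def)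
    ultimately show ?thesis by (auto simp: a b)
  qed
  show ?thesis
    unfolding eqs unfolding K_op_eq
    by (rule conjI[OF bs.count_lower conjI[OF bs.count_upper_kernel[unfolded range_P]]],
        intro allI impI, rule part2)
qed

end
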